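(* Let $k$ be a commutative ring and let $\mathcal{T}$ be a $k$-linear triangulated category with suspension functor $\Sigma$. Let $G$ be a classical generator for $\mathcal{T}$ and let $A=\bigoplus_{p\in\mathbb{Z}}\mathrm{Hom}_{\mathcal{T}}(G,\Sigma^pG)$ be the graded endomorphism algebra of $G$. Assume that the category $\mathrm{grmod}(A)$ of finitely presented graded $A$-modules is abelian (i.e. $A$ is graded right coherent) and hereditary. Then the functor $$F:\mathcal{T}\to\mathrm{grmod}(A),\qquad X\mapsto\bigoplus_{p\in\mathbb{Z}}\mathrm{Hom}_{\mathcal{T}}(G,\Sigma^pX)$$ is well-defined (i.e. $FX$ is finitely presented for every object $X$ of $\mathcal{T}$), full, essentially surjective, and its kernel has square zero (i.e. $g\circ f=0$ for all composable morphisms $f,g$ of $\mathcal{T}$ with $Ff=0$ and $Fg=0$). In particular, it induces a bijection from the set of isomorphism classes of objects (respectively, of indecomposable objects) of $\mathcal{T}$ to that of $\mathrm{grmod}(A)$.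
   Context: $G$ is a classical generator for $\mathcal{T}$ if $\mathcal{T}$ is the closure of $G$ under taking shifts, extensions and direct summands. Graded modules are $\mathbb{Z}$-graded right modules, with morphisms homogeneous of degree $0$; $\bigoplus_{p}\mathrm{Hom}_{\mathcal{T}}(G,\Sigma^pX)$ carries its natural graded right $A$-module structure given by composition. The category of graded modules is called hereditary if each subobject of a projective object is projective.
   Formalization: The formal theorem also assumes that every idempotent endomorphism in T splits; without this, pairs of finite-dimensional graded vector spaces with equal Euler characteristic and G=(k,k) violate essential surjectivity. The suspension is taken to be an automorphism of T. *)

theory Defs
  imports "HOL-Algebra.Module" "HOL-Library.FuncSet"
begin

section \<open>Linear categories\<close>

text \<open>Every pair of objects has its own \<open>k\<close>-module of morphisms. Different morphism modules may overlap
  as sets, so composition takes the three objects as arguments: \<open>Cmp C X Y Z g f\<close> is \<open>g \<circ> f\<close> for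
  \<open>f : X \<rightarrow> Y\<close> and \<open>g : Y \<rightarrow> Z\<close>. Of a morphism module only the module structure matters; the fields
  \<open>mult\<close> and \<open>one\<close> that the record type carries are ignored.\<close>

record ('o, 'm, 'k) lcat =
  Ob :: "'o set"
  Mor :: "'o \<Rightarrow> 'o \<Rightarrow> ('k, 'm) module"
  Cmp :: "'o \<Rightarrow> 'o \<Rightarrow> 'o \<Rightarrow> 'm \<Rightarrow> 'm \<Rightarrow> 'm"
  Idn :: "'o \<Rightarrow> 'm"

abbreviation mor :: "('o, 'm, 'k, 'z) lcat_scheme \<Rightarrow> 'o \<Rightarrow> 'o \<Rightarrow> 'm set" where
  "mor C X Y \<equiv> carrier (Mor C X Y)"

locale linear_category =
  fixes k :: "('k, 'r) ring_scheme" and C :: "('o, 'm, 'k, 'z) lcat_scheme"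
  assumes cring_base: "cring k"
    and Mor_module: "\<lbrakk>X \<in> Ob C; Y \<in> Ob C\<rbrakk> \<Longrightarrow> module k (Mor C X Y)"
    and Idn_closed: "X \<in> Ob C \<Longrightarrow> Idn C X \<in> mor C X X"
    and Cmp_closed: "\<lbrakk>X \<in> Ob C; Y \<in> Ob C; Z \<in> Ob C; f \<in> mor C X Y; g \<in> mor C Y Z\<rbrakk>
          \<Longrightarrow> Cmp C X Y Z g f \<in> mor C X Z"
    and Cmp_assoc: "\<lbrakk>W \<in> Ob C; X \<in> Ob C; Y \<in> Ob C; Z \<in> Ob C;
            f \<in> mor C W X; g \<in> mor C X Y; h \<in> mor C Y Z\<rbrakk>
          \<Longrightarrow> Cmp C W Y Z h (Cmp C W X Y g f) = Cmp C W X Z (Cmp C X Y Z h g) f"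
    and Idn_left: "\<lbrakk>X \<in> Ob C; Y \<in> Ob C; f \<in> mor C X Y\<rbrakk> \<Longrightarrow> Cmp C X Y Y (Idn C Y) f = f"
    and Idn_right: "\<lbrakk>X \<in> Ob C; Y \<in> Ob C; f \<in> mor C X Y\<rbrakk> \<Longrightarrow> Cmp C X X Y f (Idn C X) = f"
    and Cmp_add_left: "\<lbrakk>X \<in> Ob C; Y \<in> Ob C; Z \<in> Ob C; f \<in> mor C X Y; g \<in> mor C Y Z; g' \<in> mor C Y Z\<rbrakk>
          \<Longrightarrow> Cmp C X Y Z (g \<oplus>\<^bsub>Mor C Y Z\<^esub> g') f = Cmp C X Y Z g f \<oplus>\<^bsub>Mor C X Z\<^esub> Cmp C X Y Z g' f"
    and Cmp_add_right: "\<lbrakk>X \<in> Ob C; Y \<in> Ob C; Z \<in> Ob C; f \<in> mor C X Y; f' \<in> mor C X Y; g \<in> mor C Y Z\<rbrakk>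
          \<Longrightarrow> Cmp C X Y Z g (f \<oplus>\<^bsub>Mor C X Y\<^esub> f') = Cmp C X Y Z g f \<oplus>\<^bsub>Mor C X Z\<^esub> Cmp C X Y Z g f'"
    and Cmp_smult_left: "\<lbrakk>X \<in> Ob C; Y \<in> Ob C; Z \<in> Ob C; c \<in> carrier k; f \<in> mor C X Y; g \<in> mor C Y Z\<rbrakk>
          \<Longrightarrow> Cmp C X Y Z (c \<odot>\<^bsub>Mor C Y Z\<^esub> g) f = c \<odot>\<^bsub>Mor C X Z\<^esub> Cmp C X Y Z g f"
    and Cmp_smult_right: "\<lbrakk>X \<in> Ob C; Y \<in> Ob C; Z \<in> Ob C; c \<in> carrier k; f \<in> mor C X Y; g \<in> mor C Y Z\<rbrakk>
          \<Longrightarrow> Cmp C X Y Z g (c \<odot>\<^bsub>Mor C X Y\<^esub> f) = c \<odot>\<^bsub>Mor C X Z\<^esub> Cmp C X Y Z g f"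

definition is_iso :: "('o, 'm, 'k, 'z) lcat_scheme \<Rightarrow> 'o \<Rightarrow> 'o \<Rightarrow> 'm \<Rightarrow> bool" where
  "is_iso C X Y f \<longleftrightarrow> f \<in> mor C X Y \<and>
     (\<exists>g \<in> mor C Y X. Cmp C X Y X g f = Idn C X \<and> Cmp C Y X Y f g = Idn C Y)"

definition iso_rel :: "('o, 'm, 'k, 'z) lcat_scheme \<Rightarrow> ('o \<times> 'o) set" where
  "iso_rel C = {(X, Y). X \<in> Ob C \<and> Y \<in> Ob C \<and> (\<exists>f. is_iso C X Y f)}"

definition is_zero_object :: "('o, 'm, 'k, 'z) lcat_scheme \<Rightarrow> 'o \<Rightarrow> bool" where
  "is_zero_object C Z \<longleftrightarrow> Z \<in> Ob C \<and>
     (\<forall>X \<in> Ob C. mor C X Z = {\<zero>\<^bsub>Mor C X Z\<^esub>} \<and> mor C Z X = {\<zero>\<^bsub>Mor C Z X\<^esub>})"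

definition is_biproduct ::
    "('o, 'm, 'k, 'z) lcat_scheme \<Rightarrow> 'o \<Rightarrow> 'o \<Rightarrow> 'o \<Rightarrow> 'm \<Rightarrow> 'm \<Rightarrow> 'm \<Rightarrow> 'm \<Rightarrow> bool" where
  "is_biproduct C X Y S i j p q \<longleftrightarrow> X \<in> Ob C \<and> Y \<in> Ob C \<and> S \<in> Ob C \<and>
     i \<in> mor C X S \<and> j \<in> mor C Y S \<and> p \<in> mor C S X \<and> q \<in> mor C S Y \<and>
     Cmp C X S X p i = Idn C X \<and> Cmp C Y S Y q j = Idn C Y \<and>
     Cmp C Y S X p j = \<zero>\<^bsub>Mor C Y X\<^esub> \<and> Cmp C X S Y q i = \<zero>\<^bsub>Mor C X Y\<^esub> \<and>
     Cmp C S X S i p \<oplus>\<^bsub>Mor C S S\<^esub> Cmp C S Y S j q = Idn C S"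

definition is_direct_sum :: "('o, 'm, 'k, 'z) lcat_scheme \<Rightarrow> 'o \<Rightarrow> 'o \<Rightarrow> 'o \<Rightarrow> bool" where
  "is_direct_sum C X Y S \<longleftrightarrow> (\<exists>i j p q. is_biproduct C X Y S i j p q)"

definition indecomposables :: "('o, 'm, 'k, 'z) lcat_scheme \<Rightarrow> 'o set" where
  "indecomposables C = {X \<in> Ob C. \<not> is_zero_object C X \<and>
     (\<forall>Y Z. is_direct_sum C Y Z X \<longrightarrow> is_zero_object C Y \<or> is_zero_object C Z)}"

text \<open>Closing \<open>G\<close> under direct summands inside a triangulated category does not make idempotents split.
  This condition has to be required separately for the functor \<open>F\<close> below to be essentially surjective:
  in the category of pairs \<open>(V, W)\<close> of finite-dimensional graded vector spaces with equal Euler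
  characteristics, \<open>G = (k, k)\<close> is a classical generator whose graded endomorphism algebra is
  \<open>k \<times> k\<close>, but \<open>(k, 0)\<close> is not in the essential image of \<open>F\<close>.\<close>

definition idempotent_complete :: "('o, 'm, 'k, 'z) lcat_scheme \<Rightarrow> bool" where
  "idempotent_complete C \<longleftrightarrow> (\<forall>X \<in> Ob C. \<forall>e \<in> mor C X X. Cmp C X X X e e = e \<longrightarrow>
     (\<exists>Y \<in> Ob C. \<exists>r \<in> mor C X Y. \<exists>s \<in> mor C Y X.
        Cmp C Y X Y r s = Idn C Y \<and> Cmp C X Y X s r = e))"

locale additive_category = linear_category k C
  for k :: "('k, 'r) ring_scheme" and C :: "('o, 'm, 'k, 'z) lcat_scheme" +
  assumes zero_object: "\<exists>Z. is_zero_object C Z"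
    and direct_sum: "\<lbrakk>X \<in> Ob C; Y \<in> Ob C\<rbrakk> \<Longrightarrow> \<exists>S. is_direct_sum C X Y S"

section \<open>Abelian and hereditary categories\<close>

definition is_mono :: "('o, 'm, 'k, 'z) lcat_scheme \<Rightarrow> 'o \<Rightarrow> 'o \<Rightarrow> 'm \<Rightarrow> bool" where
  "is_mono C X Y f \<longleftrightarrow> f \<in> mor C X Y \<and>
     (\<forall>W \<in> Ob C. \<forall>g \<in> mor C W X. \<forall>h \<in> mor C W X. Cmp C W X Y f g = Cmp C W X Y f h \<longrightarrow> g = h)"

definition is_epi :: "('o, 'm, 'k, 'z) lcat_scheme \<Rightarrow> 'o \<Rightarrow> 'o \<Rightarrow> 'm \<Rightarrow> bool" where
  "is_epi C X Y f \<longleftrightarrow> f \<in> mor C X Y \<and>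
     (\<forall>Z \<in> Ob C. \<forall>g \<in> mor C Y Z. \<forall>h \<in> mor C Y Z. Cmp C X Y Z g f = Cmp C X Y Z h f \<longrightarrow> g = h)"

text \<open>\<open>i : K \<rightarrow> X\<close> is a kernel of \<open>f : X \<rightarrow> Y\<close>, and \<open>q : Y \<rightarrow> Q\<close> is a cokernel of \<open>f : X \<rightarrow> Y\<close>.\<close>

definition is_kernel :: "('o, 'm, 'k, 'z) lcat_scheme \<Rightarrow> 'o \<Rightarrow> 'o \<Rightarrow> 'm \<Rightarrow> 'o \<Rightarrow> 'm \<Rightarrow> bool" where
  "is_kernel C X Y f K i \<longleftrightarrow> K \<in> Ob C \<and> i \<in> mor C K X \<and> Cmp C K X Y f i = \<zero>\<^bsub>Mor C K Y\<^esub> \<and>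
     (\<forall>W \<in> Ob C. \<forall>g \<in> mor C W X. Cmp C W X Y f g = \<zero>\<^bsub>Mor C W Y\<^esub> \<longrightarrow>
        (\<exists>!h. h \<in> mor C W K \<and> Cmp C W K X i h = g))"

definition is_cokernel :: "('o, 'm, 'k, 'z) lcat_scheme \<Rightarrow> 'o \<Rightarrow> 'o \<Rightarrow> 'm \<Rightarrow> 'o \<Rightarrow> 'm \<Rightarrow> bool" where
  "is_cokernel C X Y f Q q \<longleftrightarrow> Q \<in> Ob C \<and> q \<in> mor C Y Q \<and> Cmp C X Y Q q f = \<zero>\<^bsub>Mor C X Q\<^esub> \<and>
     (\<forall>W \<in> Ob C. \<forall>g \<in> mor C Y W. Cmp C X Y W g f = \<zero>\<^bsub>Mor C X W\<^esub> \<longrightarrow>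
        (\<exists>!h. h \<in> mor C Q W \<and> Cmp C Y Q W h q = g))"

locale abelian_category = additive_category k C
  for k :: "('k, 'r) ring_scheme" and C :: "('o, 'm, 'k, 'z) lcat_scheme" +
  assumes has_kernel: "\<lbrakk>X \<in> Ob C; Y \<in> Ob C; f \<in> mor C X Y\<rbrakk> \<Longrightarrow> \<exists>K i. is_kernel C X Y f K i"
    and has_cokernel: "\<lbrakk>X \<in> Ob C; Y \<in> Ob C; f \<in> mor C X Y\<rbrakk> \<Longrightarrow> \<exists>Q q. is_cokernel C X Y f Q q"
    and mono_is_kernel: "\<lbrakk>X \<in> Ob C; Y \<in> Ob C; is_mono C X Y f\<rbrakk>
          \<Longrightarrow> \<exists>Z \<in> Ob C. \<exists>g \<in> mor C Y Z. is_kernel C Y Z g X f"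
    and epi_is_cokernel: "\<lbrakk>X \<in> Ob C; Y \<in> Ob C; is_epi C X Y f\<rbrakk>
          \<Longrightarrow> \<exists>W \<in> Ob C. \<exists>g \<in> mor C W X. is_cokernel C W X g Y f"

definition is_projective :: "('o, 'm, 'k, 'z) lcat_scheme \<Rightarrow> 'o \<Rightarrow> bool" where
  "is_projective C P \<longleftrightarrow> P \<in> Ob C \<and>
     (\<forall>X \<in> Ob C. \<forall>Y \<in> Ob C. \<forall>e f. is_epi C X Y e \<longrightarrow> f \<in> mor C P Y \<longrightarrow>
        (\<exists>h \<in> mor C P X. Cmp C P X Y e h = f))"

definition is_hereditary :: "('o, 'm, 'k, 'z) lcat_scheme \<Rightarrow> bool" where
  "is_hereditary C \<longleftrightarrow>
     (\<forall>P X i. is_projective C P \<longrightarrow> X \<in> Ob C \<longrightarrow> is_mono C X P i \<longrightarrow> is_projective C X)"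

section \<open>Triangulated categories\<close>

text \<open>The suspension is an automorphism \<open>\<Sigma>\<close> of the category. It is given through all its integer powers:
  \<open>ShO p\<close> and \<open>ShM p\<close> are the actions of \<open>\<Sigma>\<^sup>p\<close> on objects and morphisms, so that \<open>\<Sigma> = \<Sigma>\<^sup>1\<close>.
  A tuple \<open>(X, Y, Z, u, v, w)\<close> in \<open>Tri\<close> is a distinguished triangle
  \<open>X \<rightarrow> Y \<rightarrow> Z \<rightarrow> \<Sigma>X\<close> with maps \<open>u\<close>, \<open>v\<close>, \<open>w\<close>.\<close>

record ('o, 'm, 'k) tcat = "('o, 'm, 'k) lcat" +
  ShO :: "int \<Rightarrow> 'o \<Rightarrow> 'o"
  ShM :: "int \<Rightarrow> 'o \<Rightarrow> 'o \<Rightarrow> 'm \<Rightarrow> 'm"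
  Tri :: "('o \<times> 'o \<times> 'o \<times> 'm \<times> 'm \<times> 'm) set"

locale triangulated_category = additive_category k T
  for k :: "('k, 'r) ring_scheme" and T :: "('o, 'm, 'k, 'z) tcat_scheme" +
  assumes ShO_closed: "X \<in> Ob T \<Longrightarrow> ShO T p X \<in> Ob T"
    and ShM_closed: "\<lbrakk>X \<in> Ob T; Y \<in> Ob T; f \<in> mor T X Y\<rbrakk>
          \<Longrightarrow> ShM T p X Y f \<in> mor T (ShO T p X) (ShO T p Y)"
    and ShM_Idn: "X \<in> Ob T \<Longrightarrow> ShM T p X X (Idn T X) = Idn T (ShO T p X)"
    and ShM_Cmp: "\<lbrakk>X \<in> Ob T; Y \<in> Ob T; Z \<in> Ob T; f \<in> mor T X Y; g \<in> mor T Y Z\<rbrakk>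
          \<Longrightarrow> ShM T p X Z (Cmp T X Y Z g f) =
              Cmp T (ShO T p X) (ShO T p Y) (ShO T p Z) (ShM T p Y Z g) (ShM T p X Y f)"
    and ShM_add: "\<lbrakk>X \<in> Ob T; Y \<in> Ob T; f \<in> mor T X Y; g \<in> mor T X Y\<rbrakk>
          \<Longrightarrow> ShM T p X Y (f \<oplus>\<^bsub>Mor T X Y\<^esub> g) =
              ShM T p X Y f \<oplus>\<^bsub>Mor T (ShO T p X) (ShO T p Y)\<^esub> ShM T p X Y g"
    and ShM_smult: "\<lbrakk>X \<in> Ob T; Y \<in> Ob T; r \<in> carrier k; f \<in> mor T X Y\<rbrakk>
          \<Longrightarrow> ShM T p X Y (r \<odot>\<^bsub>Mor T X Y\<^esub> f) = r \<odot>\<^bsub>Mor T (ShO T p X) (ShO T p Y)\<^esub> ShM T p X Y f"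
    and ShO_0: "X \<in> Ob T \<Longrightarrow> ShO T 0 X = X"
    and ShM_0: "\<lbrakk>X \<in> Ob T; Y \<in> Ob T; f \<in> mor T X Y\<rbrakk> \<Longrightarrow> ShM T 0 X Y f = f"
    and ShO_ShO: "X \<in> Ob T \<Longrightarrow> ShO T p (ShO T q X) = ShO T (p + q) X"
    and ShM_ShM: "\<lbrakk>X \<in> Ob T; Y \<in> Ob T; f \<in> mor T X Y\<rbrakk>
          \<Longrightarrow> ShM T p (ShO T q X) (ShO T q Y) (ShM T q X Y f) = ShM T (p + q) X Y f"
    and Tri_typed: "(X, Y, Z, u, v, w) \<in> Tri T \<Longrightarrow> X \<in> Ob T \<and> Y \<in> Ob T \<and> Z \<in> Ob T \<and>
          u \<in> mor T X Y \<and> v \<in> mor T Y Z \<and> w \<in> mor T Z (ShO T 1 X)"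
    and TR1_iso: "\<lbrakk>(X, Y, Z, u, v, w) \<in> Tri T; X' \<in> Ob T; Y' \<in> Ob T; Z' \<in> Ob T;
            u' \<in> mor T X' Y'; v' \<in> mor T Y' Z'; w' \<in> mor T Z' (ShO T 1 X');
            is_iso T X X' a; is_iso T Y Y' b; is_iso T Z Z' c;
            Cmp T X Y Y' b u = Cmp T X X' Y' u' a;
            Cmp T Y Z Z' c v = Cmp T Y Y' Z' v' b;
            Cmp T Z (ShO T 1 X) (ShO T 1 X') (ShM T 1 X X' a) w = Cmp T Z Z' (ShO T 1 X') w' c\<rbrakk>
          \<Longrightarrow> (X', Y', Z', u', v', w') \<in> Tri T"
    and TR1_id: "\<lbrakk>X \<in> Ob T; is_zero_object T N\<rbrakk>
          \<Longrightarrow> (X, X, N, Idn T X, \<zero>\<^bsub>Mor T X N\<^esub>, \<zero>\<^bsub>Mor T N (ShO T 1 X)\<^esub>) \<in> Tri T"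
    and TR1_cone: "\<lbrakk>X \<in> Ob T; Y \<in> Ob T; u \<in> mor T X Y\<rbrakk> \<Longrightarrow> \<exists>Z v w. (X, Y, Z, u, v, w) \<in> Tri T"
    and TR2: "\<lbrakk>X \<in> Ob T; Y \<in> Ob T; Z \<in> Ob T;
            u \<in> mor T X Y; v \<in> mor T Y Z; w \<in> mor T Z (ShO T 1 X)\<rbrakk>
          \<Longrightarrow> (X, Y, Z, u, v, w) \<in> Tri T \<longleftrightarrow>
              (Y, Z, ShO T 1 X, v, w, \<ominus>\<^bsub>Mor T (ShO T 1 X) (ShO T 1 Y)\<^esub> ShM T 1 X Y u) \<in> Tri T"
    and TR3: "\<lbrakk>(X, Y, Z, u, v, w) \<in> Tri T; (X', Y', Z', u', v', w') \<in> Tri T;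
            a \<in> mor T X X'; b \<in> mor T Y Y'; Cmp T X Y Y' b u = Cmp T X X' Y' u' a\<rbrakk>
          \<Longrightarrow> \<exists>c \<in> mor T Z Z'. Cmp T Y Z Z' c v = Cmp T Y Y' Z' v' b \<and>
              Cmp T Z (ShO T 1 X) (ShO T 1 X') (ShM T 1 X X' a) w = Cmp T Z Z' (ShO T 1 X') w' c"
    and TR4: "\<lbrakk>(X, Y, Z', u, i, i') \<in> Tri T; (Y, Z, X', v, j, j') \<in> Tri T;
            (X, Z, Y', Cmp T X Y Z v u, l, l') \<in> Tri T\<rbrakk>
          \<Longrightarrow> \<exists>f g. (Z', Y', X', f, g, Cmp T X' (ShO T 1 Y) (ShO T 1 Z') (ShM T 1 Y Z' i) j') \<in> Tri T \<and>
              Cmp T Y Z' Y' f i = Cmp T Y Z Y' l v \<and> Cmp T Z' Y' (ShO T 1 X) l' f = i' \<and>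
              Cmp T Z Y' X' g l = j \<and>
              Cmp T Y' X' (ShO T 1 Y) j' g = Cmp T Y' (ShO T 1 X) (ShO T 1 Y) (ShM T 1 X Y u) l'"

text \<open>Isomorphic objects are direct summands of each other (with complement \<open>0\<close>), so the closure
  is automatically closed under isomorphism.\<close>

inductive_set thick_closure :: "('o, 'm, 'k, 'z) tcat_scheme \<Rightarrow> 'o \<Rightarrow> 'o set"
  for T :: "('o, 'm, 'k, 'z) tcat_scheme" and G :: 'o where
  base: "G \<in> thick_closure T G"
| shift: "X \<in> thick_closure T G \<Longrightarrow> ShO T p X \<in> thick_closure T G"
| extension: "\<lbrakk>(X, Y, Z, u, v, w) \<in> Tri T; X \<in> thick_closure T G; Z \<in> thick_closure T G\<rbrakk>
    \<Longrightarrow> Y \<in> thick_closure T G"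
| summand: "\<lbrakk>is_direct_sum T X Y S; S \<in> thick_closure T G\<rbrakk> \<Longrightarrow> X \<in> thick_closure T G"

definition classical_generator :: "('o, 'm, 'k, 'z) tcat_scheme \<Rightarrow> 'o \<Rightarrow> bool" where
  "classical_generator T G \<longleftrightarrow> G \<in> Ob T \<and> thick_closure T G = Ob T"

section \<open>Graded algebras and graded modules\<close>

text \<open>A \<open>\<int>\<close>-graded algebra \<open>A = \<Oplus>\<^sub>p A\<^sub>p\<close> is the family of its homogeneous components, with
  \<open>Amult A p q : A\<^sub>p \<times> A\<^sub>q \<rightarrow> A\<^sub>p\<^sub>+\<^sub>q\<close>; likewise \<open>Gact M p q : M\<^sub>p \<times> A\<^sub>q \<rightarrow> M\<^sub>p\<^sub>+\<^sub>q\<close> is the right action of a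
  graded algebra on a graded module.\<close>

record ('k, 'a) galg =
  Apart :: "int \<Rightarrow> ('k, 'a) module"
  Amult :: "int \<Rightarrow> int \<Rightarrow> 'a \<Rightarrow> 'a \<Rightarrow> 'a"
  Aone :: 'a

record ('k, 'x, 'a) gmod =
  Gpart :: "int \<Rightarrow> ('k, 'x) module"
  Gact :: "int \<Rightarrow> int \<Rightarrow> 'x \<Rightarrow> 'a \<Rightarrow> 'x"

abbreviation gcar :: "('k, 'x, 'a) gmod \<Rightarrow> int \<Rightarrow> 'x set" where
  "gcar M p \<equiv> carrier (Gpart M p)"

locale graded_algebra =
  fixes k :: "('k, 'r) ring_scheme" and A :: "('k, 'a) galg"
  assumes Apart_module: "module k (Apart A p)"
    and Amult_closed: "\<lbrakk>a \<in> carrier (Apart A p); b \<in> carrier (Apart A q)\<rbrakk>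
          \<Longrightarrow> Amult A p q a b \<in> carrier (Apart A (p + q))"
    and Aone_closed: "Aone A \<in> carrier (Apart A 0)"
    and Amult_add_left: "\<lbrakk>a \<in> carrier (Apart A p); a' \<in> carrier (Apart A p); b \<in> carrier (Apart A q)\<rbrakk>
          \<Longrightarrow> Amult A p q (a \<oplus>\<^bsub>Apart A p\<^esub> a') b = Amult A p q a b \<oplus>\<^bsub>Apart A (p + q)\<^esub> Amult A p q a' b"
    and Amult_add_right: "\<lbrakk>a \<in> carrier (Apart A p); b \<in> carrier (Apart A q); b' \<in> carrier (Apart A q)\<rbrakk>
          \<Longrightarrow> Amult A p q a (b \<oplus>\<^bsub>Apart A q\<^esub> b') = Amult A p q a b \<oplus>\<^bsub>Apart A (p + q)\<^esub> Amult A p q a b'"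
    and Amult_smult_left: "\<lbrakk>c \<in> carrier k; a \<in> carrier (Apart A p); b \<in> carrier (Apart A q)\<rbrakk>
          \<Longrightarrow> Amult A p q (c \<odot>\<^bsub>Apart A p\<^esub> a) b = c \<odot>\<^bsub>Apart A (p + q)\<^esub> Amult A p q a b"
    and Amult_smult_right: "\<lbrakk>c \<in> carrier k; a \<in> carrier (Apart A p); b \<in> carrier (Apart A q)\<rbrakk>
          \<Longrightarrow> Amult A p q a (c \<odot>\<^bsub>Apart A q\<^esub> b) = c \<odot>\<^bsub>Apart A (p + q)\<^esub> Amult A p q a b"
    and Amult_assoc: "\<lbrakk>a \<in> carrier (Apart A p); b \<in> carrier (Apart A q); b' \<in> carrier (Apart A r)\<rbrakk>
          \<Longrightarrow> Amult A (p + q) r (Amult A p q a b) b' = Amult A p (q + r) a (Amult A q r b b')"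
    and Aone_left: "a \<in> carrier (Apart A p) \<Longrightarrow> Amult A 0 p (Aone A) a = a"
    and Aone_right: "a \<in> carrier (Apart A p) \<Longrightarrow> Amult A p 0 a (Aone A) = a"

locale graded_module =
  fixes k :: "('k, 'r) ring_scheme" and A :: "('k, 'a) galg" and M :: "('k, 'x, 'a) gmod"
  assumes Gpart_module: "module k (Gpart M p)"
    and Gact_closed: "\<lbrakk>x \<in> gcar M p; a \<in> carrier (Apart A q)\<rbrakk> \<Longrightarrow> Gact M p q x a \<in> gcar M (p + q)"
    and Gact_add_left: "\<lbrakk>x \<in> gcar M p; y \<in> gcar M p; a \<in> carrier (Apart A q)\<rbrakk>
          \<Longrightarrow> Gact M p q (x \<oplus>\<^bsub>Gpart M p\<^esub> y) a = Gact M p q x a \<oplus>\<^bsub>Gpart M (p + q)\<^esub> Gact M p q y a"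
    and Gact_add_right: "\<lbrakk>x \<in> gcar M p; a \<in> carrier (Apart A q); b \<in> carrier (Apart A q)\<rbrakk>
          \<Longrightarrow> Gact M p q x (a \<oplus>\<^bsub>Apart A q\<^esub> b) = Gact M p q x a \<oplus>\<^bsub>Gpart M (p + q)\<^esub> Gact M p q x b"
    and Gact_smult_left: "\<lbrakk>c \<in> carrier k; x \<in> gcar M p; a \<in> carrier (Apart A q)\<rbrakk>
          \<Longrightarrow> Gact M p q (c \<odot>\<^bsub>Gpart M p\<^esub> x) a = c \<odot>\<^bsub>Gpart M (p + q)\<^esub> Gact M p q x a"
    and Gact_smult_right: "\<lbrakk>c \<in> carrier k; x \<in> gcar M p; a \<in> carrier (Apart A q)\<rbrakk>
          \<Longrightarrow> Gact M p q x (c \<odot>\<^bsub>Apart A q\<^esub> a) = c \<odot>\<^bsub>Gpart M (p + q)\<^esub> Gact M p q x a"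
    and Gact_assoc: "\<lbrakk>x \<in> gcar M p; a \<in> carrier (Apart A q); b \<in> carrier (Apart A r)\<rbrakk>
          \<Longrightarrow> Gact M (p + q) r (Gact M p q x a) b = Gact M p (q + r) x (Amult A q r a b)"
    and Gact_one: "x \<in> gcar M p \<Longrightarrow> Gact M p 0 x (Aone A) = x"

text \<open>Homogeneous morphisms of degree \<open>0\<close>. They are functions on the homogeneous components, fixed to
  be \<open>undefined\<close> elsewhere, so that equal morphisms are equal functions. Linearity over \<open>k\<close> follows
  from linearity over the \<open>k\<close>-algebra \<open>A\<close>.\<close>

definition ghom :: "('k, 'a) galg \<Rightarrow> ('k, 'x, 'a) gmod \<Rightarrow> ('k, 'y, 'a) gmod \<Rightarrow> (int \<Rightarrow> 'x \<Rightarrow> 'y) set" where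
  "ghom A M N = {\<phi>.
     (\<forall>p. \<phi> p \<in> gcar M p \<rightarrow>\<^sub>E gcar N p) \<and>
     (\<forall>p. \<forall>x \<in> gcar M p. \<forall>y \<in> gcar M p. \<phi> p (x \<oplus>\<^bsub>Gpart M p\<^esub> y) = \<phi> p x \<oplus>\<^bsub>Gpart N p\<^esub> \<phi> p y) \<and>
     (\<forall>p q. \<forall>x \<in> gcar M p. \<forall>a \<in> carrier (Apart A q).
        \<phi> (p + q) (Gact M p q x a) = Gact N p q (\<phi> p x) a)}"

text \<open>The free graded module of finite rank with basis elements of degrees \<open>d\<^sub>0, \<dots>, d\<^sub>n\<^sub>-\<^sub>1\<close>: its component of
  degree \<open>p\<close> consists of the lists with \<open>i\<close>-th entry in \<open>A\<close> of degree \<open>p - d\<^sub>i\<close>.\<close>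

definition free_gmod :: "('k, 'a) galg \<Rightarrow> int list \<Rightarrow> ('k, 'a list, 'a) gmod" where
  "free_gmod A ds = \<lparr>
     Gpart = (\<lambda>p. \<lparr>
       carrier = {as. length as = length ds \<and> (\<forall>i < length ds. as ! i \<in> carrier (Apart A (p - ds ! i)))},
       mult = undefined, one = undefined,
       zero = map (\<lambda>d. \<zero>\<^bsub>Apart A (p - d)\<^esub>) ds,
       add = (\<lambda>as bs. map (\<lambda>i. as ! i \<oplus>\<^bsub>Apart A (p - ds ! i)\<^esub> bs ! i) [0..<length ds]),
       smult = (\<lambda>c as. map (\<lambda>i. c \<odot>\<^bsub>Apart A (p - ds ! i)\<^esub> as ! i) [0..<length ds])\<rparr>),
     Gact = (\<lambda>p q as a. map (\<lambda>i. Amult A (p - ds ! i) q (as ! i) a) [0..<length ds])\<rparr>"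

text \<open>There is an exact sequence \<open>F\<^sub>1 \<rightarrow> F\<^sub>0 \<rightarrow> M \<rightarrow> 0\<close> with \<open>F\<^sub>0\<close>, \<open>F\<^sub>1\<close> free of finite rank.\<close>

definition finitely_presented :: "('k, 'a) galg \<Rightarrow> ('k, 'x, 'a) gmod \<Rightarrow> bool" where
  "finitely_presented A M \<longleftrightarrow> (\<exists>ds es.
     \<exists>\<phi> \<in> ghom A (free_gmod A es) (free_gmod A ds). \<exists>\<psi> \<in> ghom A (free_gmod A ds) M.
       \<forall>p. \<psi> p ` gcar (free_gmod A ds) p = gcar M p \<and>
           \<phi> p ` gcar (free_gmod A es) p = {x \<in> gcar (free_gmod A ds) p. \<psi> p x = \<zero>\<^bsub>Gpart M p\<^esub>})"

text \<open>The objects of \<open>grmod A\<close> must have their elements in one fixed type. The left summand of the type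
  below is there for \<open>A\<close> itself and for the values of the functor \<open>F\<close>, whose elements have type \<open>'a\<close>. The
  right summand contains the residue classes in a free graded module of finite rank; since every finitely
  presented graded module, with elements in any type, is isomorphic to a quotient of such a free
  module, it is isomorphic to an object of \<open>grmod A\<close> (lemma \<open>grmod_universal\<close> below).\<close>

type_synonym 'a gelt = "'a + 'a list set"

definition grmod ::
    "('k, 'r) ring_scheme \<Rightarrow> ('k, 'a) galg
      \<Rightarrow> (('k, 'a gelt, 'a) gmod, int \<Rightarrow> 'a gelt \<Rightarrow> 'a gelt, 'k) lcat" where
  "grmod k A = \<lparr>
     Ob = {M. graded_module k A M \<and> finitely_presented A M},
     Mor = (\<lambda>M N. \<lparr>
       carrier = ghom A M N, mult = undefined, one = undefined,
       zero = (\<lambda>p. \<lambda>x \<in> gcar M p. \<zero>\<^bsub>Gpart N p\<^esub>),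
       add = (\<lambda>\<phi> \<psi> p. \<lambda>x \<in> gcar M p. \<phi> p x \<oplus>\<^bsub>Gpart N p\<^esub> \<psi> p x),
       smult = (\<lambda>c \<phi> p. \<lambda>x \<in> gcar M p. c \<odot>\<^bsub>Gpart N p\<^esub> \<phi> p x)\<rparr>),
     Cmp = (\<lambda>L M N \<psi> \<phi> p. compose (gcar L p) (\<psi> p) (\<phi> p)),
     Idn = (\<lambda>M p. \<lambda>x \<in> gcar M p. x)\<rparr>"

text \<open>The graded module obtained by renaming the elements of \<open>M\<close> along maps injective on each
  component.\<close>

definition relabel :: "(int \<Rightarrow> 'x \<Rightarrow> 'y) \<Rightarrow> ('k, 'x, 'a) gmod \<Rightarrow> ('k, 'y, 'a) gmod" where
  "relabel i M = (let j = (\<lambda>p. inv_into (gcar M p) (i p)) in \<lparr>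
     Gpart = (\<lambda>p. \<lparr>
       carrier = i p ` gcar M p, mult = undefined, one = undefined,
       zero = i p \<zero>\<^bsub>Gpart M p\<^esub>,
       add = (\<lambda>x y. i p (j p x \<oplus>\<^bsub>Gpart M p\<^esub> j p y)),
       smult = (\<lambda>c x. i p (c \<odot>\<^bsub>Gpart M p\<^esub> j p x))\<rparr>),
     Gact = (\<lambda>p q x a. i (p + q) (Gact M p q (j p x) a))\<rparr>)"

section \<open>The functor given by a generator\<close>

text \<open>The product of \<open>a : G \<rightarrow> \<Sigma>\<^sup>pG\<close> and \<open>b : G \<rightarrow> \<Sigma>\<^sup>qG\<close> is \<open>\<Sigma>\<^sup>q(a) \<circ> b : G \<rightarrow> \<Sigma>\<^sup>p\<^sup>+\<^sup>qG\<close>, and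
  \<open>a\<close> may be replaced by any \<open>x : G \<rightarrow> \<Sigma>\<^sup>pX\<close>.\<close>

definition End_alg :: "('o, 'm, 'k, 'z) tcat_scheme \<Rightarrow> 'o \<Rightarrow> ('k, 'm) galg" where
  "End_alg T G = \<lparr>
     Apart = (\<lambda>p. Mor T G (ShO T p G)),
     Amult = (\<lambda>p q a b. Cmp T G (ShO T q G) (ShO T (p + q) G) (ShM T q G (ShO T p G) a) b),
     Aone = Idn T G\<rparr>"

definition Hom_gmod :: "('o, 'm, 'k, 'z) tcat_scheme \<Rightarrow> 'o \<Rightarrow> 'o \<Rightarrow> ('k, 'm, 'm) gmod" where
  "Hom_gmod T G X = \<lparr>
     Gpart = (\<lambda>p. Mor T G (ShO T p X)),
     Gact = (\<lambda>p q x b. Cmp T G (ShO T q G) (ShO T (p + q) X) (ShM T q G (ShO T p X) x) b)\<rparr>"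

definition F_ob :: "('o, 'm, 'k, 'z) tcat_scheme \<Rightarrow> 'o \<Rightarrow> 'o \<Rightarrow> ('k, 'm gelt, 'm) gmod" where
  "F_ob T G X = relabel (\<lambda>p. Inl) (Hom_gmod T G X)"

definition F_mor ::
    "('o, 'm, 'k, 'z) tcat_scheme \<Rightarrow> 'o \<Rightarrow> 'o \<Rightarrow> 'o \<Rightarrow> 'm \<Rightarrow> int \<Rightarrow> 'm gelt \<Rightarrow> 'm gelt" where
  "F_mor T G X Y f = (\<lambda>p. \<lambda>x \<in> gcar (F_ob T G X) p.
     Inl (Cmp T G (ShO T p X) (ShO T p Y) (ShM T p X Y f) (projl x)))"

section \<open>Functors\<close>

text \<open>\<open>FO\<close> and \<open>FM X Y\<close> are the actions on objects and on the morphisms \<open>X \<rightarrow> Y\<close>.\<close>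

definition is_functor ::
    "('o, 'm, 'k, 'z) lcat_scheme \<Rightarrow> ('p, 'n, 'k, 'w) lcat_scheme
      \<Rightarrow> ('o \<Rightarrow> 'p) \<Rightarrow> ('o \<Rightarrow> 'o \<Rightarrow> 'm \<Rightarrow> 'n) \<Rightarrow> bool" where
  "is_functor C D FO FM \<longleftrightarrow>
     (\<forall>X \<in> Ob C. FO X \<in> Ob D) \<and>
     (\<forall>X \<in> Ob C. \<forall>Y \<in> Ob C. \<forall>f \<in> mor C X Y. FM X Y f \<in> mor D (FO X) (FO Y)) \<and>
     (\<forall>X \<in> Ob C. FM X X (Idn C X) = Idn D (FO X)) \<and>
     (\<forall>X \<in> Ob C. \<forall>Y \<in> Ob C. \<forall>Z \<in> Ob C. \<forall>f \<in> mor C X Y. \<forall>g \<in> mor C Y Z.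
        FM X Z (Cmp C X Y Z g f) = Cmp D (FO X) (FO Y) (FO Z) (FM Y Z g) (FM X Y f))"

definition is_full ::
    "('o, 'm, 'k, 'z) lcat_scheme \<Rightarrow> ('p, 'n, 'k, 'w) lcat_scheme
      \<Rightarrow> ('o \<Rightarrow> 'p) \<Rightarrow> ('o \<Rightarrow> 'o \<Rightarrow> 'm \<Rightarrow> 'n) \<Rightarrow> bool" where
  "is_full C D FO FM \<longleftrightarrow>
     (\<forall>X \<in> Ob C. \<forall>Y \<in> Ob C. \<forall>h \<in> mor D (FO X) (FO Y). \<exists>f \<in> mor C X Y. FM X Y f = h)"

definition is_essentially_surjective ::
    "('o, 'm, 'k, 'z) lcat_scheme \<Rightarrow> ('p, 'n, 'k, 'w) lcat_scheme \<Rightarrow> ('o \<Rightarrow> 'p) \<Rightarrow> bool" where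
  "is_essentially_surjective C D FO \<longleftrightarrow> (\<forall>M \<in> Ob D. \<exists>X \<in> Ob C. (FO X, M) \<in> iso_rel D)"

definition kernel_square_zero ::
    "('o, 'm, 'k, 'z) lcat_scheme \<Rightarrow> ('p, 'n, 'k, 'w) lcat_scheme
      \<Rightarrow> ('o \<Rightarrow> 'p) \<Rightarrow> ('o \<Rightarrow> 'o \<Rightarrow> 'm \<Rightarrow> 'n) \<Rightarrow> bool" where
  "kernel_square_zero C D FO FM \<longleftrightarrow>
     (\<forall>X \<in> Ob C. \<forall>Y \<in> Ob C. \<forall>Z \<in> Ob C. \<forall>f \<in> mor C X Y. \<forall>g \<in> mor C Y Z.
        FM X Y f = \<zero>\<^bsub>Mor D (FO X) (FO Y)\<^esub> \<longrightarrow> FM Y Z g = \<zero>\<^bsub>Mor D (FO Y) (FO Z)\<^esub> \<longrightarrow>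
        Cmp C X Y Z g f = \<zero>\<^bsub>Mor C X Z\<^esub>)"

text \<open>The map on isomorphism classes induced by a functor: it sends the class \<open>c\<close> to the class of
  \<open>FO X\<close> for any \<open>X\<close> in \<open>c\<close>.\<close>

definition iso_class_map :: "('p, 'n, 'k, 'w) lcat_scheme \<Rightarrow> ('o \<Rightarrow> 'p) \<Rightarrow> 'o set \<Rightarrow> 'p set" where
  "iso_class_map D FO c = iso_rel D `` (FO ` c)"

section \<open>Basic properties\<close>

text \<open>The constructions above have the expected types: \<open>grmod A\<close> is a linear category containing a copy of
  every finitely presented graded module, \<open>End_alg T G\<close> is a graded algebra, and \<open>Hom_gmod T G X\<close> is a
  graded module over it.\<close>

lemma module_facts:
  assumes "module k M"
  shows "\<And>x y. \<lbrakk>x \<in> carrier M; y \<in> carrier M\<rbrakk> \<Longrightarrow> x \<oplus>\<^bsub>M\<^esub> y \<in> carrier M"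
    and "\<zero>\<^bsub>M\<^esub> \<in> carrier M"
    and "\<And>x. x \<in> carrier M \<Longrightarrow> \<ominus>\<^bsub>M\<^esub> x \<in> carrier M"
    and "\<And>x. x \<in> carrier M \<Longrightarrow> \<ominus>\<^bsub>M\<^esub> x \<oplus>\<^bsub>M\<^esub> x = \<zero>\<^bsub>M\<^esub>"
    and "\<And>x. x \<in> carrier M \<Longrightarrow> \<zero>\<^bsub>M\<^esub> \<oplus>\<^bsub>M\<^esub> x = x"
    and "\<And>x y. \<lbrakk>x \<in> carrier M; y \<in> carrier M\<rbrakk> \<Longrightarrow> x \<oplus>\<^bsub>M\<^esub> y = y \<oplus>\<^bsub>M\<^esub> x"
    and "\<And>x y z. \<lbrakk>x \<in> carrier M; y \<in> carrier M; z \<in> carrier M\<rbrakk>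
           \<Longrightarrow> (x \<oplus>\<^bsub>M\<^esub> y) \<oplus>\<^bsub>M\<^esub> z = x \<oplus>\<^bsub>M\<^esub> (y \<oplus>\<^bsub>M\<^esub> z)"
    and "\<And>c x. \<lbrakk>c \<in> carrier k; x \<in> carrier M\<rbrakk> \<Longrightarrow> c \<odot>\<^bsub>M\<^esub> x \<in> carrier M"
proof -
  interpret module k M by (rule assms)
  show "\<And>x y. \<lbrakk>x \<in> carrier M; y \<in> carrier M\<rbrakk> \<Longrightarrow> x \<oplus>\<^bsub>M\<^esub> y \<in> carrier M"
    and "\<zero>\<^bsub>M\<^esub> \<in> carrier M"
    and "\<And>x. x \<in> carrier M \<Longrightarrow> \<ominus>\<^bsub>M\<^esub> x \<in> carrier M"
    and "\<And>x. x \<in> carrier M \<Longrightarrow> \<ominus>\<^bsub>M\<^esub> x \<oplus>\<^bsub>M\<^esub> x = \<zero>\<^bsub>M\<^esub>"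
    and "\<And>x. x \<in> carrier M \<Longrightarrow> \<zero>\<^bsub>M\<^esub> \<oplus>\<^bsub>M\<^esub> x = x"
    and "\<And>x y. \<lbrakk>x \<in> carrier M; y \<in> carrier M\<rbrakk> \<Longrightarrow> x \<oplus>\<^bsub>M\<^esub> y = y \<oplus>\<^bsub>M\<^esub> x"
    and "\<And>x y z. \<lbrakk>x \<in> carrier M; y \<in> carrier M; z \<in> carrier M\<rbrakk>
           \<Longrightarrow> (x \<oplus>\<^bsub>M\<^esub> y) \<oplus>\<^bsub>M\<^esub> z = x \<oplus>\<^bsub>M\<^esub> (y \<oplus>\<^bsub>M\<^esub> z)"
    and "\<And>c x. \<lbrakk>c \<in> carrier k; x \<in> carrier M\<rbrakk> \<Longrightarrow> c \<odot>\<^bsub>M\<^esub> x \<in> carrier M"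
    by (auto simp: M.l_neg M.a_assoc intro: M.a_comm)
qed

lemma relabel_graded_module:
  assumes M: "graded_module k A M" and inj: "\<And>p. inj_on (i p) (gcar M p)"
  shows "graded_module k A (relabel i M)"
proof -
  interpret M: graded_module k A M by (rule M)
  have mod: "module k (Gpart M p)" for p by (rule M.Gpart_module)
  have cr: "cring k" using mod[of 0] by (rule module.axioms)
  note mf [simp] = module_facts[OF mod] M.Gact_closed
  have j [simp]: "inv_into (gcar M p) (i p) (i p x) = x" if "x \<in> gcar M p" for p x
    using that inj by simp
  have "module k (Gpart (relabel i M) p)" for p
  proof (rule moduleI[OF cr])
    show "abelian_group (Gpart (relabel i M) p)"
    proof (rule abelian_groupI)
      fix x assume "x \<in> gcar (relabel i M) p"
      then obtain x' where x': "x' \<in> gcar M p" "x = i p x'" by (auto simp: relabel_def)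
      then have "i p (\<ominus>\<^bsub>Gpart M p\<^esub> x') \<oplus>\<^bsub>Gpart (relabel i M) p\<^esub> x = \<zero>\<^bsub>Gpart (relabel i M) p\<^esub>"
        by (simp add: relabel_def del: mf(6))
      then show "\<exists>y\<in>gcar (relabel i M) p. y \<oplus>\<^bsub>Gpart (relabel i M) p\<^esub> x = \<zero>\<^bsub>Gpart (relabel i M) p\<^esub>"
        using x' by (intro bexI[where x = "i p (\<ominus>\<^bsub>Gpart M p\<^esub> x')"]) (auto simp: relabel_def)
    next
      fix x y assume "x \<in> gcar (relabel i M) p" "y \<in> gcar (relabel i M) p"
      then show "x \<oplus>\<^bsub>Gpart (relabel i M) p\<^esub> y = y \<oplus>\<^bsub>Gpart (relabel i M) p\<^esub> x"
        using module_facts(6)[OF mod] by (auto simp: relabel_def)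
    qed (auto simp: relabel_def simp del: mf(6))
  qed (auto simp: relabel_def module.smult_l_distr[OF mod] module.smult_r_distr[OF mod]
      module.smult_assoc1[OF mod] module.smult_one[OF mod] simp del: mf(6))
  moreover have "Gact M (p + q) r (Gact M p q x a) b = Gact M p (q + r) x (Amult A q r a b)"
    "Gact M p q x a \<in> gcar M (p + q)"
    if "x \<in> gcar M p" "a \<in> carrier (Apart A q)" "b \<in> carrier (Apart A r)" for p q r x a b
    using that M.Gact_assoc by auto
  ultimately show ?thesis
    by (intro graded_module.intro)
      (auto simp: relabel_def M.Gact_add_left M.Gact_add_right M.Gact_smult_left M.Gact_smult_right
        M.Gact_one add.assoc simp del: mf(6))
qed

lemma free_gmod_closed:
  assumes "graded_algebra k A" "x \<in> gcar (free_gmod A ds) p"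
  shows "y \<in> gcar (free_gmod A ds) p \<Longrightarrow> x \<oplus>\<^bsub>Gpart (free_gmod A ds) p\<^esub> y \<in> gcar (free_gmod A ds) p"
    and "a \<in> carrier (Apart A q) \<Longrightarrow> Gact (free_gmod A ds) p q x a \<in> gcar (free_gmod A ds) (p + q)"
proof -
  interpret graded_algebra k A by (rule assms)
  show "y \<in> gcar (free_gmod A ds) p \<Longrightarrow> x \<oplus>\<^bsub>Gpart (free_gmod A ds) p\<^esub> y \<in> gcar (free_gmod A ds) p"
    using assms(2) by (auto simp: free_gmod_def module_facts(1)[OF Apart_module])
  then show "a \<in> carrier (Apart A q) \<Longrightarrow> Gact (free_gmod A ds) p q x a \<in> gcar (free_gmod A ds) (p + q)"
    using assms(2) Amult_closed[of "x ! i" "p - ds ! i" a q for i]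
    by (auto simp: free_gmod_def diff_add_eq)
qed

lemma relabel_finitely_presented:
  assumes A: "graded_algebra k A" and M: "graded_module k A M"
    and inj: "\<And>p. inj_on (i p) (gcar M p)" and fp: "finitely_presented A M"
  shows "finitely_presented A (relabel i M)"
proof -
  interpret M: graded_module k A M by (rule M)
  have mod: "module k (Gpart M p)" for p by (rule M.Gpart_module)
  obtain ds es \<phi> \<psi> where \<phi>: "\<phi> \<in> ghom A (free_gmod A es) (free_gmod A ds)"
    and \<psi>: "\<psi> \<in> ghom A (free_gmod A ds) M"
    and sur: "\<And>p. \<psi> p ` gcar (free_gmod A ds) p = gcar M p"
    and ker: "\<And>p. \<phi> p ` gcar (free_gmod A es) p = {x \<in> gcar (free_gmod A ds) p. \<psi> p x = \<zero>\<^bsub>Gpart M p\<^esub>}"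
    using fp unfolding finitely_presented_def
  proof (elim exE bexE, goal_cases)
    case (1 ds es \<phi> \<psi>)
    then show ?case using 1(1)[of \<phi> es ds \<psi>] by simp
  qed
  define F where "F = free_gmod A ds"
  define \<chi> where "\<chi> = (\<lambda>p. \<lambda>x \<in> gcar F p. i p (\<psi> p x))"
  have psi: "\<psi> p x \<in> gcar M p" if "x \<in> gcar F p" for p x
    using sur[of p] that by (auto simp: F_def)
  have [simp]: "inv_into (gcar M p) (i p) (i p x) = x" if "x \<in> gcar M p" for p x
    using that inj by simp
  have "\<chi> \<in> ghom A F (relabel i M)"
    using \<psi> psi free_gmod_closed[OF A, of _ ds]
    by (auto simp: ghom_def \<chi>_def relabel_def simp flip: F_def)
  moreover have "\<chi> p ` gcar F p = gcar (relabel i M) p" for p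
    using sur[of p] by (auto simp: relabel_def \<chi>_def F_def image_iff) (metis imageE)
  moreover have "\<phi> p ` gcar (free_gmod A es) p = {x \<in> gcar F p. \<chi> p x = \<zero>\<^bsub>Gpart (relabel i M) p\<^esub>}" for p
    using ker[of p] psi module_facts(2)[OF mod] inj_on_eq_iff[OF inj]
    by (auto simp: relabel_def \<chi>_def simp flip: F_def)
  ultimately show ?thesis
    using \<phi> unfolding finitely_presented_def F_def by blast
qed

lemma relabel_iso:
  assumes M: "graded_module k A M" and inj: "\<And>p. inj_on (i p) (gcar M p)"
  shows "(\<lambda>p. \<lambda>x \<in> gcar M p. i p x) \<in> ghom A M (relabel i M)"
    and "bij_betw (\<lambda>x \<in> gcar M p. i p x) (gcar M p) (gcar (relabel i M) p)"
proof -
  interpret M: graded_module k A M by (rule M)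
  show "(\<lambda>p. \<lambda>x \<in> gcar M p. i p x) \<in> ghom A M (relabel i M)"
    using inj module_facts(1)[OF M.Gpart_module] M.Gact_closed
    by (auto simp: ghom_def relabel_def)
  show "bij_betw (\<lambda>x \<in> gcar M p. i p x) (gcar M p) (gcar (relabel i M) p)"
    using inj[of p] by (auto simp: bij_betw_def relabel_def inj_on_def)
qed

lemma grmod_universal:
  fixes M :: "('k, 'x, 'a) gmod"
  assumes A: "graded_algebra k A" and M: "graded_module k A M" and fp: "finitely_presented A M"
  shows "\<exists>N \<in> Ob (grmod k A). \<exists>\<phi> \<in> ghom A M N. \<forall>p. bij_betw (\<phi> p) (gcar M p) (gcar N p)"
proof -
  obtain ds \<psi> where sur: "\<And>p. \<psi> p ` gcar (free_gmod A ds) p = gcar M p"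
    using fp unfolding finitely_presented_def
  proof (elim exE bexE, goal_cases)
    case (1 ds es \<phi> \<psi>)
    then show ?case using 1(1)[of \<psi> ds] by simp
  qed
  define i :: "int \<Rightarrow> 'x \<Rightarrow> 'a gelt"
    where "i = (\<lambda>p x. Inr {y \<in> gcar (free_gmod A ds) p. \<psi> p y = x})"
  have inj: "inj_on (i p) (gcar M p)" for p
    using sur[of p] by (auto simp: i_def inj_on_def set_eq_iff image_iff) metis
  have "relabel i M \<in> Ob (grmod k A)"
    using relabel_graded_module[OF M inj] relabel_finitely_presented[OF A M inj fp]
    by (simp add: grmod_def)
  then show ?thesis
    by (intro bexI[where x = "relabel i M"] bexI[OF _ relabel_iso(1)[OF M inj]] allI relabel_iso(2)[OF M inj])
qed

lemma ghom_smult: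
  assumes A: "graded_algebra k A" and M: "graded_module k A M" and N: "graded_module k A N"
    and f: "f \<in> ghom A M N" and c: "c \<in> carrier k" and x: "x \<in> gcar M p"
  shows "f p (c \<odot>\<^bsub>Gpart M p\<^esub> x) = c \<odot>\<^bsub>Gpart N p\<^esub> f p x"
proof -
  interpret A: graded_algebra k A by (rule A)
  interpret M: graded_module k A M by (rule M)
  interpret N: graded_module k A N by (rule N)
  let ?c = "c \<odot>\<^bsub>Apart A 0\<^esub> Aone A"
  have fx: "f p x \<in> gcar N p" using f x by (auto simp: ghom_def)
  have "?c \<in> carrier (Apart A 0)"
    using module_facts(8)[OF A.Apart_module c A.Aone_closed] .
  then have "f (p + 0) (Gact M p 0 x ?c) = Gact N p 0 (f p x) ?c"
    using f x unfolding ghom_def by blast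
  then show ?thesis
    using M.Gact_smult_right[OF c x A.Aone_closed] N.Gact_smult_right[OF c fx A.Aone_closed]
    by (simp add: M.Gact_one[OF x] N.Gact_one[OF fx])
qed

lemma ghomD:
  assumes "f \<in> ghom A M N"
  shows "x \<in> gcar M p \<Longrightarrow> f p x \<in> gcar N p"
    and "\<lbrakk>x \<in> gcar M p; y \<in> gcar M p\<rbrakk> \<Longrightarrow> f p (x \<oplus>\<^bsub>Gpart M p\<^esub> y) = f p x \<oplus>\<^bsub>Gpart N p\<^esub> f p y"
    and "\<lbrakk>x \<in> gcar M p; a \<in> carrier (Apart A q)\<rbrakk> \<Longrightarrow> f (p + q) (Gact M p q x a) = Gact N p q (f p x) a"
    and "f p \<in> extensional (gcar M p)"
  using assms by (auto simp: ghom_def PiE_def)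

lemma ghom_eqI:
  assumes "f \<in> ghom A M N" "g \<in> ghom A M N" "\<And>p x. x \<in> gcar M p \<Longrightarrow> f p x = g p x"
  shows "f = g"
  using assms(3) by (intro ext extensionalityI[OF ghomD(4)[OF assms(1)] ghomD(4)[OF assms(2)]] )

lemma Mor_grmod_module:
  assumes A: "graded_algebra k A" and M: "graded_module k A M" and N: "graded_module k A N"
  shows "module k (Mor (grmod k A) M N)" (is "module k ?H")
proof -
  interpret A: graded_algebra k A by (rule A)
  interpret M: graded_module k A M by (rule M)
  interpret N: graded_module k A N by (rule N)
  have mod: "module k (Gpart N p)" for p by (rule N.Gpart_module)
  note MF = module_facts[OF M.Gpart_module] M.Gact_closed
  note NF = module_facts[OF mod] N.Gact_closed
  have ab: "abelian_group (Gpart N p)" for p using mod by (rule module.axioms)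
  have cr: "cring k" using mod[of 0] by (rule module.axioms)
  note sm = module.smult_l_distr[OF mod] module.smult_r_distr[OF mod]
      module.smult_assoc1[OF mod] module.smult_one[OF mod]
  have car [simp]: "carrier ?H = ghom A M N" by (simp add: grmod_def)
  have add_app: "(f \<oplus>\<^bsub>?H\<^esub> g) p x = f p x \<oplus>\<^bsub>Gpart N p\<^esub> g p x" if "x \<in> gcar M p" for f g p x
    using that by (simp add: grmod_def)
  have zero_app: "\<zero>\<^bsub>?H\<^esub> p x = \<zero>\<^bsub>Gpart N p\<^esub>" if "x \<in> gcar M p" for p x
    using that by (simp add: grmod_def)
  have smult_app: "(c \<odot>\<^bsub>?H\<^esub> f) p x = c \<odot>\<^bsub>Gpart N p\<^esub> f p x" if "x \<in> gcar M p" for c f p x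
    using that by (simp add: grmod_def)
  have four: "(a \<oplus>\<^bsub>Gpart N p\<^esub> b) \<oplus>\<^bsub>Gpart N p\<^esub> (c \<oplus>\<^bsub>Gpart N p\<^esub> d) = (a \<oplus>\<^bsub>Gpart N p\<^esub> c) \<oplus>\<^bsub>Gpart N p\<^esub> (b \<oplus>\<^bsub>Gpart N p\<^esub> d)"
    if "a \<in> gcar N p" "b \<in> gcar N p" "c \<in> gcar N p" "d \<in> gcar N p" for a b c d p
  proof -
    interpret abelian_group "Gpart N p" by (rule ab)
    show ?thesis using that by (simp add: a_ac)
  qed
  have zz: "\<zero>\<^bsub>Gpart N p\<^esub> \<oplus>\<^bsub>Gpart N p\<^esub> \<zero>\<^bsub>Gpart N p\<^esub> = \<zero>\<^bsub>Gpart N p\<^esub>" for p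
    using NF(5)[OF NF(2)] .
  have za: "Gact N p q \<zero>\<^bsub>Gpart N p\<^esub> a = \<zero>\<^bsub>Gpart N (p + q)\<^esub>" if "a \<in> carrier (Apart A q)" for p q a
  proof -
    interpret abelian_group "Gpart N (p + q)" by (rule ab)
    have "Gact N p q \<zero>\<^bsub>Gpart N p\<^esub> a = Gact N p q \<zero>\<^bsub>Gpart N p\<^esub> a \<oplus>\<^bsub>Gpart N (p + q)\<^esub> Gact N p q \<zero>\<^bsub>Gpart N p\<^esub> a"
      using N.Gact_add_left[OF NF(2) NF(2) that, of p] zz by simp
    then show ?thesis
      using NF(9)[OF NF(2) that, of p] by (metis add.l_cancel_one' zero_closed)
  qed
  have zero_in: "\<zero>\<^bsub>?H\<^esub> \<in> ghom A M N"
    by (auto simp: ghom_def grmod_def MF(1,9) NF(2) zz za)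
  have add_in: "f \<oplus>\<^bsub>?H\<^esub> g \<in> ghom A M N" if f: "f \<in> ghom A M N" and g: "g \<in> ghom A M N" for f g
    using ghomD[OF f] ghomD[OF g]
    by (auto simp: ghom_def grmod_def MF(1,9) NF(1) four N.Gact_add_left)
  have smult_in: "c \<odot>\<^bsub>?H\<^esub> f \<in> ghom A M N" if c: "c \<in> carrier k" and f: "f \<in> ghom A M N" for c f
    using ghomD[OF f] c
    by (auto simp: ghom_def grmod_def MF(1,9) NF(8) N.Gact_smult_left sm)
  show ?thesis
  proof (rule moduleI[OF cr])
    show "abelian_group ?H"
    proof (rule abelian_groupI)
      fix f assume f: "f \<in> carrier ?H"
      interpret k: cring k by (rule cr)
      let ?g = "(\<ominus>\<^bsub>k\<^esub> \<one>\<^bsub>k\<^esub>) \<odot>\<^bsub>?H\<^esub> f"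
      have g: "?g \<in> ghom A M N" using smult_in f by simp
      have "?g \<oplus>\<^bsub>?H\<^esub> f = \<zero>\<^bsub>?H\<^esub>"
      proof (rule ghom_eqI[OF add_in[OF g] zero_in])
        show "f \<in> ghom A M N" using f by simp
        fix p x assume x: "x \<in> gcar M p"
        interpret Np: module k "Gpart N p" by (rule mod)
        have fx: "f p x \<in> gcar N p" using ghomD(1)[of f A M N] f x by simp
        show "(?g \<oplus>\<^bsub>?H\<^esub> f) p x = \<zero>\<^bsub>?H\<^esub> p x"
          using fx by (simp add: add_app[OF x] zero_app[OF x] smult_app[OF x] Np.smult_l_minus Np.l_neg)
      qed
      then show "\<exists>g \<in> carrier ?H. g \<oplus>\<^bsub>?H\<^esub> f = \<zero>\<^bsub>?H\<^esub>" using g by auto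
    next
      fix f g assume "f \<in> carrier ?H" "g \<in> carrier ?H"
      then have f: "f \<in> ghom A M N" and g: "g \<in> ghom A M N" by auto
      show "f \<oplus>\<^bsub>?H\<^esub> g = g \<oplus>\<^bsub>?H\<^esub> f"
        by (rule ghom_eqI[OF add_in[OF f g] add_in[OF g f]])
          (simp add: add_app, rule NF(6)[OF ghomD(1)[OF f] ghomD(1)[OF g]])
      fix h assume "h \<in> carrier ?H"
      then have h: "h \<in> ghom A M N" by auto
      show "(f \<oplus>\<^bsub>?H\<^esub> g) \<oplus>\<^bsub>?H\<^esub> h = f \<oplus>\<^bsub>?H\<^esub> (g \<oplus>\<^bsub>?H\<^esub> h)"
        by (rule ghom_eqI[OF add_in[OF add_in[OF f g] h] add_in[OF f add_in[OF g h]]])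
          (simp add: add_app NF(7) ghomD(1)[OF f] ghomD(1)[OF g] ghomD(1)[OF h])
    next
      fix f assume "f \<in> carrier ?H"
      then have f: "f \<in> ghom A M N" by auto
      show "\<zero>\<^bsub>?H\<^esub> \<oplus>\<^bsub>?H\<^esub> f = f"
        by (rule ghom_eqI[OF add_in[OF zero_in f] f])
          (simp add: add_app zero_app NF(5) ghomD(1)[OF f])
    qed (auto simp: zero_in add_in)
  next
    interpret k: cring k by (rule cr)
    fix a b f assume a: "a \<in> carrier k" and b: "b \<in> carrier k" and "f \<in> carrier ?H"
    then have f: "f \<in> ghom A M N" by auto
    show "(a \<oplus>\<^bsub>k\<^esub> b) \<odot>\<^bsub>?H\<^esub> f = a \<odot>\<^bsub>?H\<^esub> f \<oplus>\<^bsub>?H\<^esub> b \<odot>\<^bsub>?H\<^esub> f"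
      by (rule ghom_eqI[OF smult_in[OF k.a_closed[OF a b] f] add_in[OF smult_in[OF a f] smult_in[OF b f]]])
        (simp add: add_app smult_app sm a b ghomD(1)[OF f])
    show "(a \<otimes>\<^bsub>k\<^esub> b) \<odot>\<^bsub>?H\<^esub> f = a \<odot>\<^bsub>?H\<^esub> (b \<odot>\<^bsub>?H\<^esub> f)"
      by (rule ghom_eqI[OF smult_in[OF k.m_closed[OF a b] f] smult_in[OF a smult_in[OF b f]]])
        (simp add: smult_app sm a b ghomD(1)[OF f])
  next
    fix a f g assume a: "a \<in> carrier k" and "f \<in> carrier ?H" and "g \<in> carrier ?H"
    then have f: "f \<in> ghom A M N" and g: "g \<in> ghom A M N" by auto
    show "a \<odot>\<^bsub>?H\<^esub> (f \<oplus>\<^bsub>?H\<^esub> g) = a \<odot>\<^bsub>?H\<^esub> f \<oplus>\<^bsub>?H\<^esub> a \<odot>\<^bsub>?H\<^esub> g"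
      by (rule ghom_eqI[OF smult_in[OF a add_in[OF f g]] add_in[OF smult_in[OF a f] smult_in[OF a g]]])
        (simp add: add_app smult_app sm a ghomD(1)[OF f] ghomD(1)[OF g])
  next
    interpret k: cring k by (rule cr)
    fix f assume "f \<in> carrier ?H"
    then have f: "f \<in> ghom A M N" by auto
    show "\<one>\<^bsub>k\<^esub> \<odot>\<^bsub>?H\<^esub> f = f"
      by (rule ghom_eqI[OF smult_in[OF k.one_closed f] f]) (simp add: smult_app sm ghomD(1)[OF f])
  qed (auto simp: smult_in)
qed

lemma grmod_linear_category:
  assumes A: "graded_algebra k A"
  shows "linear_category k (grmod k A)"
proof -
  have gm: "graded_module k A M" if "M \<in> Ob (grmod k A)" for M
    using that by (simp add: grmod_def)
  have car: "carrier (Mor (grmod k A) M N) = ghom A M N" for M N by (simp add: grmod_def)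
  have cmp: "Cmp (grmod k A) L M N g f = (\<lambda>p. compose (gcar L p) (g p) (f p))" for L M N f g
    by (simp add: grmod_def)
  have addd: "f \<oplus>\<^bsub>Mor (grmod k A) M N\<^esub> g = (\<lambda>p. \<lambda>x \<in> gcar M p. f p x \<oplus>\<^bsub>Gpart N p\<^esub> g p x)" for M N f g
    by (simp add: grmod_def)
  have smu: "c \<odot>\<^bsub>Mor (grmod k A) M N\<^esub> f = (\<lambda>p. \<lambda>x \<in> gcar M p. c \<odot>\<^bsub>Gpart N p\<^esub> f p x)" for M N c f
    by (simp add: grmod_def)
  have idn: "Idn (grmod k A) M = (\<lambda>p. \<lambda>x \<in> gcar M p. x)" for M
    by (simp add: grmod_def)
  show ?thesis
  proof (rule linear_category.intro, goal_cases)
    case 1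
    show ?case using graded_algebra.Apart_module[OF A, of 0] by (rule module.axioms)
  next
    case (2 X Y)
    then show ?case using Mor_grmod_module[OF A gm gm] by blast
  next
    case (3 X)
    interpret graded_module k A X by (rule gm[OF 3])
    show ?case unfolding car idn
      by (auto simp: ghom_def module_facts(1)[OF Gpart_module] Gact_closed)
  next
    case (4 X Y Z f g)
    interpret graded_module k A X by (rule gm[OF 4(1)])
    note f = ghomD[OF 4(4)[unfolded car]] and g = ghomD[OF 4(5)[unfolded car]]
    show ?case unfolding car cmp ghom_def
      by (auto simp: compose_def module_facts(1)[OF Gpart_module] Gact_closed f(1-3) g(1-3))
  next
    case (5 W X Y Z f g h)
    then show ?case by (auto simp: car cmp compose_def fun_eq_iff restrict_def dest: ghomD(1))
  next
    case (6 X Y f)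
    then have f: "f \<in> ghom A X Y" by (simp add: car)
    show ?case
      by (auto simp: cmp idn compose_def fun_eq_iff ghomD(1)[OF f] extensional_arb[OF ghomD(4)[OF f]] restrict_def)
  next
    case (7 X Y f)
    then have f: "f \<in> ghom A X Y" by (simp add: car)
    show ?case
      by (auto simp: cmp idn compose_def fun_eq_iff ghomD(1)[OF f] extensional_arb[OF ghomD(4)[OF f]] restrict_def)
  next
    case (8 X Y Z f g g')
    then show ?case
      by (auto simp: car cmp addd compose_def fun_eq_iff restrict_def dest: ghomD(1))
  next
    case (9 X Y Z f f' g)
    then show ?case
      by (auto simp: car cmp addd compose_def fun_eq_iff restrict_def ghomD)
  next
    case (10 X Y Z c f g)
    then show ?case
      by (auto simp: car cmp smu compose_def fun_eq_iff restrict_def dest: ghomD(1))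
  next
    case (11 X Y Z c f g)
    then show ?case
      using ghom_smult[OF A gm gm, of Y Z g c] by (auto simp: car cmp smu compose_def fun_eq_iff ghomD)
  qed
qed
lemma (in triangulated_category) Hom_gmod_graded_module:
  assumes G: "G \<in> Ob T" and X: "X \<in> Ob T"
  shows "graded_module k (End_alg T G) (Hom_gmod T G X)"
proof (rule graded_module.intro, goal_cases)
  case (1 p)
  show ?case using Mor_module[OF G ShO_closed[OF X]] by (simp add: Hom_gmod_def)
next
  case (2 x p a q)
  then show ?case 
    using Cmp_closed[of G "ShO T q G" "ShO T (p+q) X"] ShM_closed[of G "ShO T p X" x q] G X
    by (simp add: Hom_gmod_def End_alg_def ShO_closed ShO_ShO add.commute)
next
  case (3 x p y a q)
  then show ?case 
    using Cmp_add_left[of G "ShO T q G" "ShO T (p+q) X"] ShM_closed[of G "ShO T p X" _ q] G X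
    by (simp add: Hom_gmod_def End_alg_def ShO_closed ShO_ShO ShM_add add.commute)
next
  case (4 x p a q b)
  then show ?case
    using Cmp_add_right[of G "ShO T q G" "ShO T (p+q) X"] ShM_closed[of G "ShO T p X" _ q] G X
    by (simp add: Hom_gmod_def End_alg_def ShO_closed ShO_ShO ShM_add add.commute)
next
  case (5 c x p a q)
  then show ?case
    using Cmp_smult_left[of G "ShO T q G" "ShO T (p+q) X"] ShM_closed[of G "ShO T p X" _ q] G X
    by (simp add: Hom_gmod_def End_alg_def ShO_closed ShO_ShO ShM_smult add.commute)
next
  case (6 c x p a q)
  then show ?case
    using Cmp_smult_right[of G "ShO T q G" "ShO T (p+q) X"] ShM_closed[of G "ShO T p X" _ q] G X
    by (simp add: Hom_gmod_def End_alg_def ShO_closed ShO_ShO add.commute)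
next
  case (7 x p a q b r)
  define x' where "x' = ShM T q G (ShO T p X) x"
  have [simp]: "x \<in> mor T G (ShO T p X)" "a \<in> mor T G (ShO T q G)" "b \<in> mor T G (ShO T r G)"
    using 7 by (auto simp: Hom_gmod_def End_alg_def)
  have x': "x' \<in> mor T (ShO T q G) (ShO T (p + q) X)"
    using ShM_closed[of G "ShO T p X" x q] G X by (simp add: x'_def ShO_closed ShO_ShO add.commute)
  have 1: "ShM T r (ShO T q G) (ShO T (p + q) X) x' = ShM T (q + r) G (ShO T p X) x"
    using ShM_ShM[of G "ShO T p X" x r q] G X by (simp add: x'_def ShO_closed ShO_ShO add.commute)
  have 2: "ShM T r G (ShO T (p + q) X) (Cmp T G (ShO T q G) (ShO T (p + q) X) x' a) =
      Cmp T (ShO T r G) (ShO T (q + r) G) (ShO T (p + q + r) X) 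
        (ShM T (q + r) G (ShO T p X) x) (ShM T r G (ShO T q G) a)"
    using ShM_Cmp[of G "ShO T q G" "ShO T (p + q) X" a x' r] G X x'
    by (simp add: 1 ShO_closed ShO_ShO add.commute add.left_commute)
  have 3: "ShM T r G (ShO T q G) a \<in> mor T (ShO T r G) (ShO T (q + r) G)"
    "ShM T (q + r) G (ShO T p X) x \<in> mor T (ShO T (q + r) G) (ShO T (p + q + r) X)"
    using ShM_closed[of G "ShO T q G" a r] ShM_closed[of G "ShO T p X" x "q + r"] G X
    by (simp_all add: ShO_closed ShO_ShO add.commute add.left_commute)
  show ?case
    using Cmp_assoc[of G "ShO T r G" "ShO T (q + r) G" "ShO T (p + q + r) X"] G X 3 2
    by (simp add: Hom_gmod_def End_alg_def ShO_closed add.assoc flip: x'_def)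
next
  case (8 x p)
  then show ?case
    using G X Idn_right[of G "ShO T p X" x] by (simp add: Hom_gmod_def End_alg_def ShO_closed ShO_0 ShM_0)
qed

lemma (in triangulated_category) End_alg_graded_algebra:
  assumes G: "G \<in> Ob T"
  shows "graded_algebra k (End_alg T G)"
proof -
  interpret H: graded_module k "End_alg T G" "Hom_gmod T G G"
    by (rule Hom_gmod_graded_module[OF G G])
  have [simp]: "Gpart (Hom_gmod T G G) = Apart (End_alg T G)"
    "Gact (Hom_gmod T G G) = Amult (End_alg T G)"
    by (simp_all add: Hom_gmod_def End_alg_def)
  show ?thesis
  proof (rule graded_algebra.intro)
    show "Aone (End_alg T G) \<in> carrier (Apart (End_alg T G) 0)"
      using Idn_closed[OF G] by (simp add: End_alg_def ShO_0 G)
    show "Amult (End_alg T G) 0 p (Aone (End_alg T G)) a = a"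
      if "a \<in> carrier (Apart (End_alg T G) p)" for a p
      using that Idn_left[of G "ShO T p G" a] by (simp add: End_alg_def ShO_0 ShO_closed ShM_Idn G)
  qed (use H.Gpart_module H.Gact_closed H.Gact_add_left H.Gact_add_right H.Gact_smult_left
      H.Gact_smult_right H.Gact_assoc H.Gact_one in simp_all)
qed

end

(*
  Let add(G) consist of the direct summands of finite sums of shifts of G. By Yoneda, F is fully
  faithful on Hom(P, -) for P in add(G). Since grmod(A) is hereditary and idempotents of T split, the
  image of F f, for f : P -> Q in add(G), is a direct summand of F P, so f is the projection of P onto a
  summand I followed by a map I -> Q on which F is injective.  Call X presentable if F X is the cokernel
  of F g for some g in add(G).  A presentable X is the cone of a map I -> E in add(G) with F I -> F E
  injective, and conversely every cone of a map in add(G) is presentable.  Presentability passes to direct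
  summands and, by the octahedral axiom applied to these cones, to extensions.  As G generates T, every X sits in a
  triangle I -> E -> X -> S I with 0 -> F I -> F E -> F X -> 0 exact.  A map F X -> F Y then lifts to E -> Y
  vanishing on I, hence to X -> Y; a map killed by F vanishes on E, hence factors through X -> S I, and the
  composite of the factor with another map killed by F is zero; and a finitely presented M is F of the
  cone of a lift of a presentation made injective.
*)
theory Submission
  imports Defs
begin

text \<open>\<open>F\<close> cannot be treated as a functor into \<open>grmod A\<close> from the
  start: that \<open>F X\<close> is finitely presented is itself a conclusion. Injectivity,
  surjectivity and exactness of \<open>F f\<close> are therefore expressed by \<open>gmono\<close>,
  \<open>gsurj\<close> and \<open>gexact\<close>, on maps from all shifts of \<open>G\<close>, and
  only \<open>F P\<close> for \<open>P\<close> in add(G) enters \<open>grmod A\<close> early. A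
  second obstacle is that the hypotheses on \<open>grmod A\<close> are categorical while the
  argument works with elements. Yoneda for shifts of \<open>G\<close> identifies categorical kernels
  with elementwise ones; coherence then makes images finitely presented, which is what makes
  epimorphisms surjective and \<open>F P\<close> projective. The generator acts twice: it makes
  \<open>F\<close> detect isomorphisms, through the vanishing of all maps into a cone, and it drives
  the induction making every object presentable. The bijections rest on a fact about endomorphisms:
  one that \<open>F\<close> sends to the identity differs from it by an element of square zero.
  Hence \<open>F\<close> reflects isomorphisms, and decompositions of \<open>F X\<close> lift to
  \<open>X\<close>.\<close>

context linear_category
begin

section \<open>Arithmetic in morphism modules\<close>

lemma Mor_group: "\<lbrakk>X \<in> Ob C; Y \<in> Ob C\<rbrakk> \<Longrightarrow> abelian_group (Mor C X Y)"
  using Mor_module by (rule module.axioms)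

lemma Mor_monoid: "\<lbrakk>X \<in> Ob C; Y \<in> Ob C\<rbrakk> \<Longrightarrow> abelian_monoid (Mor C X Y)"
  using Mor_group by (rule abelian_group.axioms)

lemmas hom_add_closed [simp] = abelian_monoid.a_closed [OF Mor_monoid]
lemmas hom_minus_closed [simp] = abelian_group.a_inv_closed [OF Mor_group]
lemmas hom_assoc = abelian_monoid.a_assoc [OF Mor_monoid]
lemmas hom_comm = abelian_monoid.a_comm [OF Mor_monoid]

lemma hom_zero_closed [simp]: "\<lbrakk>X \<in> Ob C; Y \<in> Ob C\<rbrakk> \<Longrightarrow> \<zero>\<^bsub>Mor C X Y\<^esub> \<in> mor C X Y"
  by (rule module_facts(2)[OF Mor_module])

lemma hom_l_zero [simp]:
  "\<lbrakk>X \<in> Ob C; Y \<in> Ob C; f \<in> mor C X Y\<rbrakk> \<Longrightarrow> \<zero>\<^bsub>Mor C X Y\<^esub> \<oplus>\<^bsub>Mor C X Y\<^esub> f = f"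
  by (rule module_facts(5)[OF Mor_module])

lemma hom_r_zero [simp]:
  "\<lbrakk>X \<in> Ob C; Y \<in> Ob C; f \<in> mor C X Y\<rbrakk> \<Longrightarrow> f \<oplus>\<^bsub>Mor C X Y\<^esub> \<zero>\<^bsub>Mor C X Y\<^esub> = f"
  using hom_l_zero hom_comm by simp

lemma hom_r_neg [simp]:
  "\<lbrakk>X \<in> Ob C; Y \<in> Ob C; f \<in> mor C X Y\<rbrakk> \<Longrightarrow> f \<oplus>\<^bsub>Mor C X Y\<^esub> \<ominus>\<^bsub>Mor C X Y\<^esub> f = \<zero>\<^bsub>Mor C X Y\<^esub>"
  using abelian_group.r_neg [OF Mor_group] by blast

lemma hom_l_neg [simp]:
  "\<lbrakk>X \<in> Ob C; Y \<in> Ob C; f \<in> mor C X Y\<rbrakk> \<Longrightarrow> \<ominus>\<^bsub>Mor C X Y\<^esub> f \<oplus>\<^bsub>Mor C X Y\<^esub> f = \<zero>\<^bsub>Mor C X Y\<^esub>"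
  using abelian_group.l_neg [OF Mor_group] by blast

lemma hom_minus_minus [simp]:
  "\<lbrakk>X \<in> Ob C; Y \<in> Ob C; f \<in> mor C X Y\<rbrakk> \<Longrightarrow> \<ominus>\<^bsub>Mor C X Y\<^esub> (\<ominus>\<^bsub>Mor C X Y\<^esub> f) = f"
  using abelian_group.minus_minus [OF Mor_group] by blast

lemma hom_minus_zero [simp]:
  "\<lbrakk>X \<in> Ob C; Y \<in> Ob C\<rbrakk> \<Longrightarrow> \<ominus>\<^bsub>Mor C X Y\<^esub> \<zero>\<^bsub>Mor C X Y\<^esub> = \<zero>\<^bsub>Mor C X Y\<^esub>"
  using hom_r_neg hom_l_zero hom_zero_closed hom_minus_closed by metis

lemma hom_diff_eq_zero:
  assumes "X \<in> Ob C" "Y \<in> Ob C" "f \<in> mor C X Y" "g \<in> mor C X Y"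
  shows "f \<oplus>\<^bsub>Mor C X Y\<^esub> \<ominus>\<^bsub>Mor C X Y\<^esub> g = \<zero>\<^bsub>Mor C X Y\<^esub> \<longleftrightarrow> f = g"
proof
  assume e: "f \<oplus>\<^bsub>Mor C X Y\<^esub> \<ominus>\<^bsub>Mor C X Y\<^esub> g = \<zero>\<^bsub>Mor C X Y\<^esub>"
  have "f = (f \<oplus>\<^bsub>Mor C X Y\<^esub> \<ominus>\<^bsub>Mor C X Y\<^esub> g) \<oplus>\<^bsub>Mor C X Y\<^esub> g"
    using assms by (simp add: hom_assoc)
  then show "f = g" using e assms by simp
qed (use assms in simp)

lemma hom_diff_add [simp]:
  assumes "X \<in> Ob C" "Y \<in> Ob C" "f \<in> mor C X Y" "g \<in> mor C X Y"
  shows "g \<oplus>\<^bsub>Mor C X Y\<^esub> (f \<oplus>\<^bsub>Mor C X Y\<^esub> \<ominus>\<^bsub>Mor C X Y\<^esub> g) = f"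
proof -
  interpret abelian_group "Mor C X Y" by (rule Mor_group[OF assms(1,2)])
  show ?thesis using assms by (metis a_lcomm a_inv_closed r_neg r_zero)
qed

text \<open>This is how additive operations are seen to preserve zero: the image of
  \<open>0 = 0 + 0\<close> is unchanged when added to itself.\<close>

lemma hom_add_self_zero:
  assumes "X \<in> Ob C" "Y \<in> Ob C" "f \<in> mor C X Y" "f \<oplus>\<^bsub>Mor C X Y\<^esub> f = f"
  shows "f = \<zero>\<^bsub>Mor C X Y\<^esub>"
  using assms abelian_group.r_neg1[OF Mor_group] hom_l_neg by metis

lemma hom_eq_minusI:
  assumes "X \<in> Ob C" "Y \<in> Ob C" "f \<in> mor C X Y" "g \<in> mor C X Y" "f \<oplus>\<^bsub>Mor C X Y\<^esub> g = \<zero>\<^bsub>Mor C X Y\<^esub>"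
  shows "f = \<ominus>\<^bsub>Mor C X Y\<^esub> g"
  using hom_diff_eq_zero[OF assms(1,2,3) hom_minus_closed[OF assms(1,2,4)]] assms by simp

declare Cmp_closed [simp]
declare Idn_closed [simp]
declare Idn_left [simp]
declare Idn_right [simp]

lemma Cmp_zero_right [simp]:
  assumes "X \<in> Ob C" "Y \<in> Ob C" "Z \<in> Ob C" "g \<in> mor C Y Z"
  shows "Cmp C X Y Z g \<zero>\<^bsub>Mor C X Y\<^esub> = \<zero>\<^bsub>Mor C X Z\<^esub>"
  using assms Cmp_add_right[OF assms(1,2,3) hom_zero_closed hom_zero_closed assms(4)]
  by (intro hom_add_self_zero) auto

lemma Cmp_zero_left [simp]:
  assumes "X \<in> Ob C" "Y \<in> Ob C" "Z \<in> Ob C" "f \<in> mor C X Y"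
  shows "Cmp C X Y Z \<zero>\<^bsub>Mor C Y Z\<^esub> f = \<zero>\<^bsub>Mor C X Z\<^esub>"
  using assms Cmp_add_left[OF assms(1,2,3,4) hom_zero_closed hom_zero_closed]
  by (intro hom_add_self_zero) auto

lemma Cmp_minus_right [simp]:
  assumes "X \<in> Ob C" "Y \<in> Ob C" "Z \<in> Ob C" "f \<in> mor C X Y" "g \<in> mor C Y Z"
  shows "Cmp C X Y Z g (\<ominus>\<^bsub>Mor C X Y\<^esub> f) = \<ominus>\<^bsub>Mor C X Z\<^esub> Cmp C X Y Z g f"
  using assms Cmp_add_right[OF assms(1,2,3) _ assms(4,5), of "\<ominus>\<^bsub>Mor C X Y\<^esub> f"]
  by (intro hom_eq_minusI) auto

lemma Cmp_minus_left [simp]: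
  assumes "X \<in> Ob C" "Y \<in> Ob C" "Z \<in> Ob C" "f \<in> mor C X Y" "g \<in> mor C Y Z"
  shows "Cmp C X Y Z (\<ominus>\<^bsub>Mor C Y Z\<^esub> g) f = \<ominus>\<^bsub>Mor C X Z\<^esub> Cmp C X Y Z g f"
  using assms Cmp_add_left[OF assms(1,2,3,4) _ assms(5), of "\<ominus>\<^bsub>Mor C Y Z\<^esub> g"]
  by (intro hom_eq_minusI) auto

section \<open>Zero objects and isomorphism classes\<close>

lemma zero_objectI:
  assumes X: "X \<in> Ob C" and "Idn C X = \<zero>\<^bsub>Mor C X X\<^esub>"
  shows "is_zero_object C X"
proof -
  have "f = \<zero>\<^bsub>Mor C Y X\<^esub>" if "Y \<in> Ob C" "f \<in> mor C Y X" for Y f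
    using Cmp_zero_left[of Y X X f] that assms by (metis Idn_left)
  moreover have "f = \<zero>\<^bsub>Mor C X Y\<^esub>" if "Y \<in> Ob C" "f \<in> mor C X Y" for Y f
    using Cmp_zero_right[of X X Y f] that assms by (metis Idn_right)
  ultimately show ?thesis using X unfolding is_zero_object_def by auto
qed

lemma zero_object_Ob: "is_zero_object C Z \<Longrightarrow> Z \<in> Ob C"
  by (simp add: is_zero_object_def)

lemma zero_object_in: "\<lbrakk>is_zero_object C Z; X \<in> Ob C; f \<in> mor C X Z\<rbrakk> \<Longrightarrow> f = \<zero>\<^bsub>Mor C X Z\<^esub>"
  by (auto simp: is_zero_object_def)

lemma zero_object_out: "\<lbrakk>is_zero_object C Z; X \<in> Ob C; f \<in> mor C Z X\<rbrakk> \<Longrightarrow> f = \<zero>\<^bsub>Mor C Z X\<^esub>"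
  by (auto simp: is_zero_object_def)

lemma zero_object_iff: "X \<in> Ob C \<Longrightarrow> is_zero_object C X \<longleftrightarrow> Idn C X = \<zero>\<^bsub>Mor C X X\<^esub>"
  using zero_objectI zero_object_in[of X X "Idn C X"] by auto

text \<open>Since \<open>g = g f h = h\<close>, two one-sided inverses suffice. Lifting an
  isomorphism along a functor produces them by separate corrections.\<close>

lemma is_isoI:
  assumes "X \<in> Ob C" "Y \<in> Ob C" "f \<in> mor C X Y" "g \<in> mor C Y X" "h \<in> mor C Y X"
    and gf: "Cmp C X Y X g f = Idn C X" and fh: "Cmp C Y X Y f h = Idn C Y"
  shows "is_iso C X Y f"
proof -
  have "g = Cmp C Y X X (Cmp C X Y X g f) h"
    using assms Cmp_assoc[of Y X Y X h f g] by simp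
  then have "g = h" using assms by simp
  then show ?thesis using assms unfolding is_iso_def by blast
qed

lemma iso_rel_refl: "X \<in> Ob C \<Longrightarrow> (X, X) \<in> iso_rel C"
  unfolding iso_rel_def is_iso_def by (auto intro!: exI[of _ "Idn C X"])

lemma iso_rel_sym: "(X, Y) \<in> iso_rel C \<Longrightarrow> (Y, X) \<in> iso_rel C"
  unfolding iso_rel_def is_iso_def by auto

lemma iso_rel_trans:
  assumes "(X, Y) \<in> iso_rel C" "(Y, Z) \<in> iso_rel C"
  shows "(X, Z) \<in> iso_rel C"
proof -
  have [simp]: "X \<in> Ob C" "Y \<in> Ob C" "Z \<in> Ob C" using assms by (auto simp: iso_rel_def)
  obtain f f' where [simp]: "f \<in> mor C X Y" "f' \<in> mor C Y X"
    and f: "Cmp C X Y X f' f = Idn C X" "Cmp C Y X Y f f' = Idn C Y"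
    using assms(1) by (auto simp: iso_rel_def is_iso_def)
  obtain g g' where [simp]: "g \<in> mor C Y Z" "g' \<in> mor C Z Y"
    and g: "Cmp C Y Z Y g' g = Idn C Y" "Cmp C Z Y Z g g' = Idn C Z"
    using assms(2) by (auto simp: iso_rel_def is_iso_def)
  have "Cmp C X Z X (Cmp C Z Y X f' g') (Cmp C X Y Z g f)
      = Cmp C X Y X f' (Cmp C X Y Y (Cmp C Y Z Y g' g) f)"
    by (simp add: Cmp_assoc)
  moreover have "Cmp C Z X Z (Cmp C X Y Z g f) (Cmp C Z Y X f' g')
      = Cmp C Z Y Z g (Cmp C Z Y Y (Cmp C Y X Y f f') g')"
    by (simp add: Cmp_assoc)
  ultimately have "is_iso C X Z (Cmp C X Y Z g f)"
    unfolding is_iso_def using f g by (auto intro!: bexI[of _ "Cmp C Z Y X f' g'"])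
  then show ?thesis by (auto simp: iso_rel_def)
qed

lemma equiv_iso_rel: "equiv (Ob C) (iso_rel C)"
proof (rule equivI)
  show "refl_on (Ob C) (iso_rel C)" using iso_rel_refl by (blast intro: refl_onI)
  show "sym (iso_rel C)" using iso_rel_sym by (blast intro: symI)
  show "trans (iso_rel C)" using iso_rel_trans by (blast intro: transI)
qed (auto simp: iso_rel_def)

lemma zero_object_iso:
  assumes "(X, Y) \<in> iso_rel C" "is_zero_object C X"
  shows "is_zero_object C Y"
proof -
  have [simp]: "X \<in> Ob C" "Y \<in> Ob C" using assms by (auto simp: iso_rel_def)
  obtain f f' where [simp]: "f \<in> mor C X Y" "f' \<in> mor C Y X"
    and f: "Cmp C Y X Y f f' = Idn C Y"
    using assms(1) by (auto simp: iso_rel_def is_iso_def)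
  have "f = \<zero>\<^bsub>Mor C X Y\<^esub>" by (rule zero_object_out[OF assms(2)]) auto
  then show ?thesis using f by (simp add: zero_object_iff)
qed

section \<open>Biproducts, their uniqueness, and complementary idempotents\<close>

lemma biproduct_transport:
  assumes b: "is_biproduct C X Y S i j p q" and "S' \<in> Ob C"
    and f: "f \<in> mor C S S'" "f' \<in> mor C S' S" "Cmp C S S' S f' f = Idn C S"
        "Cmp C S' S S' f f' = Idn C S'"
  shows "is_biproduct C X Y S' (Cmp C X S S' f i) (Cmp C Y S S' f j) (Cmp C S' S X p f')
      (Cmp C S' S Y q f')"
proof -
  have [simp]: "X \<in> Ob C" "Y \<in> Ob C" "S \<in> Ob C" "S' \<in> Ob C" "i \<in> mor C X S" "j \<in> mor C Y S"
     "p \<in> mor C S X" "q \<in> mor C S Y" using b assms(2) by (auto simp: is_biproduct_def)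
  note [simp] = f(1,2)
  have *: "Cmp C U S' V (Cmp C S' S V x f') (Cmp C U S S' f y) = Cmp C U S V x y"
    if [simp]: "x \<in> mor C S V" "y \<in> mor C U S" "U \<in> Ob C" "V \<in> Ob C" for U V x y
  proof -
    have "Cmp C U S' V (Cmp C S' S V x f') (Cmp C U S S' f y)
        = Cmp C U S V x (Cmp C U S S (Cmp C S S' S f' f) y)"
      by (simp add: Cmp_assoc)
    then show ?thesis by (simp add: f)
  qed
  have **: "Cmp C S' U S' (Cmp C U S S' f y) (Cmp C S' S U x f')
      = Cmp C S' S S' f (Cmp C S' S S (Cmp C S U S y x) f')"
    if [simp]: "x \<in> mor C S U" "y \<in> mor C U S" "U \<in> Ob C" for U x y
    by (simp add: Cmp_assoc)
  have "Cmp C S' X S' (Cmp C X S S' f i) (Cmp C S' S X p f') \<oplus>\<^bsub>Mor C S' S'\<^esub>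
      Cmp C S' Y S' (Cmp C Y S S' f j) (Cmp C S' S Y q f') = Idn C S'"
  proof -
    have "Cmp C S' X S' (Cmp C X S S' f i) (Cmp C S' S X p f') \<oplus>\<^bsub>Mor C S' S'\<^esub>
      Cmp C S' Y S' (Cmp C Y S S' f j) (Cmp C S' S Y q f') =
      Cmp C S' S S' f (Cmp C S' S S (Cmp C S X S i p \<oplus>\<^bsub>Mor C S S\<^esub> Cmp C S Y S j q) f')"
      using ** by (simp add: Cmp_add_left Cmp_add_right)
    then show ?thesis using b f by (simp add: is_biproduct_def)
  qed
  then show ?thesis using b by (simp add: is_biproduct_def *)
qed

lemma direct_sum_iso:
  assumes "is_direct_sum C X Y S" "(S, S') \<in> iso_rel C"
  shows "is_direct_sum C X Y S'"
  using assms biproduct_transport unfolding is_direct_sum_def iso_rel_def is_iso_def by blast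

lemma direct_sum_Ob: "is_direct_sum C X Y S \<Longrightarrow> X \<in> Ob C \<and> Y \<in> Ob C \<and> S \<in> Ob C"
  by (auto simp: is_direct_sum_def is_biproduct_def)

lemma indecomposable_iso:
  assumes i: "(X, Y) \<in> iso_rel C" and X: "X \<in> indecomposables C"
  shows "Y \<in> indecomposables C"
proof -
  have "\<not> is_zero_object C Y" using X zero_object_iso[OF iso_rel_sym[OF i]]
      by (auto simp: indecomposables_def)
  moreover have "is_zero_object C U \<or> is_zero_object C V" if "is_direct_sum C U V Y" for U V
    using direct_sum_iso[OF that iso_rel_sym[OF i]] X by (auto simp: indecomposables_def)
  ultimately show ?thesis using i by (auto simp: indecomposables_def iso_rel_def)
qed

lemma direct_sum_unique:
  assumes "is_direct_sum C X Y S" "is_direct_sum C X' Y' S'" "(X, X') \<in> iso_rel C" "(Y, Y') \<in> iso_rel C"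
  shows "(S, S') \<in> iso_rel C"
proof -
  obtain i j p q where b: "is_biproduct C X Y S i j p q" using assms by (auto simp: is_direct_sum_def)
  obtain i' j' p' q' where b': "is_biproduct C X' Y' S' i' j' p' q'" using assms
      by (auto simp: is_direct_sum_def)
  obtain f f' where [simp]: "f \<in> mor C X X'" "f' \<in> mor C X' X"
    and f: "Cmp C X X' X f' f = Idn C X" "Cmp C X' X X' f f' = Idn C X'"
    using assms by (auto simp: iso_rel_def is_iso_def)
  obtain g g' where [simp]: "g \<in> mor C Y Y'" "g' \<in> mor C Y' Y"
    and g: "Cmp C Y Y' Y g' g = Idn C Y" "Cmp C Y' Y Y' g g' = Idn C Y'"
    using assms by (auto simp: iso_rel_def is_iso_def)
  \<comment> \<open>Stated for arbitrary biproduct data with only \<open>f' f = 1\<close> and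
    \<open>g' g = 1\<close>, so that exchanging the two sides yields the other composite.\<close>
  have main: "Cmp C S S' S (Cmp C S' X' S (Cmp C X' X S i f') p'
      \<oplus>\<^bsub>Mor C S' S\<^esub> Cmp C S' Y' S (Cmp C Y' Y S j g') q')
     (Cmp C S X S' (Cmp C X X' S' i' f) p \<oplus>\<^bsub>Mor C S S'\<^esub> Cmp C S Y S' (Cmp C Y Y' S' j' g) q) = Idn C S"
    if b: "is_biproduct C X Y S i j p q" and b': "is_biproduct C X' Y' S' i' j' p' q'"
      and [simp]: "f \<in> mor C X X'" "f' \<in> mor C X' X" "g \<in> mor C Y Y'" "g' \<in> mor C Y' Y"
      and f: "Cmp C X X' X f' f = Idn C X" and g: "Cmp C Y Y' Y g' g = Idn C Y"
    for X Y S i j p q X' Y' S' i' j' p' q' f f' g g'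
  proof -
    have [simp]: "X \<in> Ob C" "Y \<in> Ob C" "S \<in> Ob C" "i \<in> mor C X S" "j \<in> mor C Y S"
      "p \<in> mor C S X" "q \<in> mor C S Y" using b by (auto simp: is_biproduct_def)
    have [simp]: "X' \<in> Ob C" "Y' \<in> Ob C" "S' \<in> Ob C" "i' \<in> mor C X' S'" "j' \<in> mor C Y' S'"
      "p' \<in> mor C S' X'" "q' \<in> mor C S' Y'" using b' by (auto simp: is_biproduct_def)
    have e: "Cmp C S S' S (Cmp C S' V S a t) (Cmp C S U S' w c)
       = Cmp C S V S a (Cmp C S U V (Cmp C U S' V t w) c)"
      if [simp]: "U \<in> Ob C" "V \<in> Ob C" "t \<in> mor C S' V" "w \<in> mor C U S'" "a \<in> mor C V S"
          "c \<in> mor C S U" for U V t w a c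
      by (simp add: Cmp_assoc)
    have e2: "Cmp C X S' X' p' (Cmp C X X' S' i' f) = f" "Cmp C Y S' Y' q' (Cmp C Y Y' S' j' g) = g"
      "Cmp C X S' Y' q' (Cmp C X X' S' i' f) = \<zero>\<^bsub>Mor C X Y'\<^esub>"
          "Cmp C Y S' X' p' (Cmp C Y Y' S' j' g) = \<zero>\<^bsub>Mor C Y X'\<^esub>"
      using b' by (simp_all add: Cmp_assoc is_biproduct_def)
    have e3: "Cmp C S X' S (Cmp C X' X S i f') (Cmp C S X X' f p)
        = Cmp C S X S i (Cmp C S X X (Cmp C X X' X f' f) p)"
       "Cmp C S Y' S (Cmp C Y' Y S j g') (Cmp C S Y Y' g q)
           = Cmp C S Y S j (Cmp C S Y Y (Cmp C Y Y' Y g' g) q)"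
      by (simp_all add: Cmp_assoc)
    show ?thesis
      using b by (simp add: Cmp_add_left Cmp_add_right e e2 e3 f g is_biproduct_def)
  qed
  have O [simp]: "S \<in> Ob C" "S' \<in> Ob C" "X \<in> Ob C" "X' \<in> Ob C" "Y \<in> Ob C" "Y' \<in> Ob C"
    "i \<in> mor C X S" "j \<in> mor C Y S" "p \<in> mor C S X" "q \<in> mor C S Y"
    "i' \<in> mor C X' S'" "j' \<in> mor C Y' S'" "p' \<in> mor C S' X'" "q' \<in> mor C S' Y'"
    using b b' by (auto simp: is_biproduct_def)
  define m where "m = Cmp C S X S' (Cmp C X X' S' i' f) p
      \<oplus>\<^bsub>Mor C S S'\<^esub> Cmp C S Y S' (Cmp C Y Y' S' j' g) q"
  define m' where "m' = Cmp C S' X' S (Cmp C X' X S i f') p'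
      \<oplus>\<^bsub>Mor C S' S\<^esub> Cmp C S' Y' S (Cmp C Y' Y S j g') q'"
  have "Cmp C S S' S m' m = Idn C S" "Cmp C S' S S' m m' = Idn C S'"
    using main[OF b b' _ _ _ _ f(1) g(1)] main[OF b' b _ _ _ _ f(2) g(2)]
        by (simp_all add: m_def m'_def)
  moreover have "m \<in> mor C S S'" "m' \<in> mor C S' S" by (simp_all add: m_def m'_def)
  ultimately show ?thesis unfolding iso_rel_def is_iso_def by auto
qed

text \<open>Splitting both \<open>e\<close> and its complement \<open>1 - e\<close> turns an object
  into a biproduct; these are the identities this takes.\<close>

lemma idempotent_compl:
  assumes [simp]: "X \<in> Ob C" "e \<in> mor C X X" and "Cmp C X X X e e = e"
  defines "e' \<equiv> Idn C X \<oplus>\<^bsub>Mor C X X\<^esub> \<ominus>\<^bsub>Mor C X X\<^esub> e"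
  shows "e' \<in> mor C X X" "Cmp C X X X e' e = \<zero>\<^bsub>Mor C X X\<^esub>" "Cmp C X X X e e' = \<zero>\<^bsub>Mor C X X\<^esub>"
      "Cmp C X X X e' e' = e'"
  using assms(3) by (simp_all add: e'_def Cmp_add_left Cmp_add_right)

end

section \<open>Full functors whose kernel has square zero\<close>

locale additive_functor = C: linear_category k C + D: linear_category k D
  for k :: "('k, 'r) ring_scheme" and C :: "('o, 'm, 'k, 'z) lcat_scheme"
    and D :: "('p, 'n, 'k, 'w) lcat_scheme" +
  fixes FO :: "'o \<Rightarrow> 'p" and FM :: "'o \<Rightarrow> 'o \<Rightarrow> 'm \<Rightarrow> 'n"
  assumes is_functor: "is_functor C D FO FM"
    and FM_add: "\<lbrakk>X \<in> Ob C; Y \<in> Ob C; f \<in> mor C X Y; g \<in> mor C X Y\<rbrakk>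
      \<Longrightarrow> FM X Y (f \<oplus>\<^bsub>Mor C X Y\<^esub> g) = FM X Y f \<oplus>\<^bsub>Mor D (FO X) (FO Y)\<^esub> FM X Y g"
begin

lemma FO_closed [simp]: "X \<in> Ob C \<Longrightarrow> FO X \<in> Ob D"
  using is_functor by (simp add: is_functor_def)

lemma FM_closed [simp]: "\<lbrakk>X \<in> Ob C; Y \<in> Ob C; f \<in> mor C X Y\<rbrakk> \<Longrightarrow> FM X Y f \<in> mor D (FO X) (FO Y)"
  using is_functor by (simp add: is_functor_def)

lemma FM_Idn [simp]: "X \<in> Ob C \<Longrightarrow> FM X X (Idn C X) = Idn D (FO X)"
  using is_functor by (simp add: is_functor_def)

lemma FM_Cmp: "\<lbrakk>X \<in> Ob C; Y \<in> Ob C; Z \<in> Ob C; f \<in> mor C X Y; g \<in> mor C Y Z\<rbrakk>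
    \<Longrightarrow> FM X Z (Cmp C X Y Z g f) = Cmp D (FO X) (FO Y) (FO Z) (FM Y Z g) (FM X Y f)"
  using is_functor by (simp add: is_functor_def)

lemma FM_zero [simp]:
  assumes "X \<in> Ob C" "Y \<in> Ob C"
  shows "FM X Y \<zero>\<^bsub>Mor C X Y\<^esub> = \<zero>\<^bsub>Mor D (FO X) (FO Y)\<^esub>"
  using assms FM_add[of X Y "\<zero>\<^bsub>Mor C X Y\<^esub>" "\<zero>\<^bsub>Mor C X Y\<^esub>"] by (intro D.hom_add_self_zero) simp_all

lemma FO_iso: "(X, Y) \<in> iso_rel C \<Longrightarrow> (FO X, FO Y) \<in> iso_rel D"
  unfolding iso_rel_def is_iso_def
proof clarsimp
  fix f g assume [simp]: "X \<in> Ob C" "Y \<in> Ob C" "f \<in> mor C X Y" "g \<in> mor C Y X"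
    and fg: "Cmp C X Y X g f = Idn C X" "Cmp C Y X Y f g = Idn C Y"
  show "\<exists>f. f \<in> mor D (FO X) (FO Y) \<and> (\<exists>g\<in>mor D (FO Y) (FO X).
     Cmp D (FO X) (FO Y) (FO X) g f = Idn D (FO X) \<and> Cmp D (FO Y) (FO X) (FO Y) f g = Idn D (FO Y))"
    using FM_Cmp[of X Y X f g] FM_Cmp[of Y X Y g f] fg
    by (auto intro!: exI[of _ "FM X Y f"] bexI[of _ "FM Y X g"])
qed

lemma FO_direct_sum:
  assumes "is_direct_sum C X Y S"
  shows "is_direct_sum D (FO X) (FO Y) (FO S)"
proof -
  obtain i j p q where b: "is_biproduct C X Y S i j p q" using assms by (auto simp: is_direct_sum_def)
  have [simp]: "X \<in> Ob C" "Y \<in> Ob C" "S \<in> Ob C" "i \<in> mor C X S" "j \<in> mor C Y S"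
      "p \<in> mor C S X" "q \<in> mor C S Y" using b by (auto simp: is_biproduct_def)
  have "is_biproduct D (FO X) (FO Y) (FO S) (FM X S i) (FM Y S j) (FM S X p) (FM S Y q)"
    using b by (simp add: is_biproduct_def flip: FM_Cmp FM_add)
  then show ?thesis by (auto simp: is_direct_sum_def)
qed

end

text \<open>\<open>C_sum\<close> is included so that two summands of \<open>F X\<close>, once
  realized by objects of \<open>C\<close>, can be added up in \<open>C\<close>.\<close>

locale epivalence = additive_functor +
  assumes full: "is_full C D FO FM"
    and ess_surj: "is_essentially_surjective C D FO"
    and ksz: "kernel_square_zero C D FO FM"
    and C_sum: "\<lbrakk>X \<in> Ob C; Y \<in> Ob C\<rbrakk> \<Longrightarrow> \<exists>S. is_direct_sum C X Y S"
begin

text \<open>An endomorphism \<open>t\<close> with \<open>F t = 1\<close> is invertible: \<open>n = t - 1\<close> satisfies \<open>n \<circ> n = 0\<close>, so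
  \<open>1 - n\<close> is inverse to \<open>t\<close>.\<close>

lemma unipotent_inverse:
  assumes [simp]: "X \<in> Ob C" "t \<in> mor C X X" and t: "FM X X t = Idn D (FO X)"
  shows "\<exists>t' \<in> mor C X X. Cmp C X X X t' t = Idn C X \<and> Cmp C X X X t t' = Idn C X"
proof -
  define n where "n = t \<oplus>\<^bsub>Mor C X X\<^esub> \<ominus>\<^bsub>Mor C X X\<^esub> Idn C X"
  have [simp]: "n \<in> mor C X X" by (simp add: n_def)
  have tn: "t = Idn C X \<oplus>\<^bsub>Mor C X X\<^esub> n" by (simp add: n_def)
  have "FM X X n \<oplus>\<^bsub>Mor D (FO X) (FO X)\<^esub> Idn D (FO X) = Idn D (FO X)"
    using t FM_add[of X X n "Idn C X"] by (simp add: tn C.hom_comm)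
  then have "FM X X n = \<zero>\<^bsub>Mor D (FO X) (FO X)\<^esub>"
    using D.hom_assoc[of "FO X" "FO X" "FM X X n" "Idn D (FO X)"
        "\<ominus>\<^bsub>Mor D (FO X) (FO X)\<^esub> Idn D (FO X)"] by simp
  then have nn: "Cmp C X X X n n = \<zero>\<^bsub>Mor C X X\<^esub>"
    using ksz unfolding kernel_square_zero_def by (metis \<open>n \<in> mor C X X\<close> assms(1))
  show ?thesis
    by (rule bexI[of _ "Idn C X \<oplus>\<^bsub>Mor C X X\<^esub> \<ominus>\<^bsub>Mor C X X\<^esub> n"])
      (simp_all add: tn C.Cmp_add_left C.Cmp_add_right nn C.hom_assoc)
qed

text \<open>Fullness lifts an isomorphism and its inverse to \<open>f\<close> and \<open>g\<close>.
  Both composites map to identities, hence are invertible by \<open>unipotent_inverse\<close>, which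
  makes \<open>f\<close> left and right invertible.\<close>

lemma iso_rel_iff:
  assumes [simp]: "X \<in> Ob C" "Y \<in> Ob C"
  shows "(FO X, FO Y) \<in> iso_rel D \<longleftrightarrow> (X, Y) \<in> iso_rel C"
proof
  assume "(FO X, FO Y) \<in> iso_rel D"
  then obtain f g where f: "f \<in> mor C X Y" and g: "g \<in> mor C Y X"
    and fg: "Cmp D (FO X) (FO Y) (FO X) (FM Y X g) (FM X Y f) = Idn D (FO X)"
      "Cmp D (FO Y) (FO X) (FO Y) (FM X Y f) (FM Y X g) = Idn D (FO Y)"
    using full unfolding is_full_def iso_rel_def is_iso_def by (smt (verit)
        assms mem_Collect_eq case_prodD)
  note [simp] = f g
  obtain a where [simp]: "a \<in> mor C X X" and a: "Cmp C X X X a (Cmp C X Y X g f) = Idn C X"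
    using unipotent_inverse[of X "Cmp C X Y X g f"] fg by (auto simp: FM_Cmp)
  obtain b where [simp]: "b \<in> mor C Y Y" and b: "Cmp C Y Y Y (Cmp C Y X Y f g) b = Idn C Y"
    using unipotent_inverse[of Y "Cmp C Y X Y f g"] fg by (auto simp: FM_Cmp)
  have "is_iso C X Y f"
  proof (rule C.is_isoI)
    show "Cmp C X Y X (Cmp C Y X X a g) f = Idn C X" using a by (simp add: C.Cmp_assoc)
    show "Cmp C Y X Y f (Cmp C Y Y X g b) = Idn C Y" using b by (simp add: C.Cmp_assoc)
  qed simp_all
  then show "(X, Y) \<in> iso_rel C" by (auto simp: iso_rel_def)
qed (rule FO_iso)

text \<open>If \<open>F X\<close> is zero, then \<open>F\<close> kills the identity of
  \<open>X\<close>, so the square of this identity vanishes.\<close>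

lemma zero_object_iff:
  assumes [simp]: "X \<in> Ob C"
  shows "is_zero_object D (FO X) \<longleftrightarrow> is_zero_object C X"
proof
  assume "is_zero_object D (FO X)"
  then have "FM X X (Idn C X) = \<zero>\<^bsub>Mor D (FO X) (FO X)\<^esub>" by (simp add: D.zero_object_iff)
  then have "Cmp C X X X (Idn C X) (Idn C X) = \<zero>\<^bsub>Mor C X X\<^esub>"
    using ksz unfolding kernel_square_zero_def by (metis C.Idn_closed assms)
  then show "is_zero_object C X" by (simp add: C.zero_object_iff)
next
  assume "is_zero_object C X"
  then show "is_zero_object D (FO X)"
    using FM_zero[of X X] by (simp add: C.zero_object_iff D.zero_object_iff flip: FM_Idn)
qed

text \<open>To lift a decomposition of \<open>F X\<close> into \<open>M\<close> and
  \<open>N\<close>, realize these up to isomorphism by \<open>Y\<close> and \<open>Z\<close>. Then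
  \<open>F\<close> of the sum of \<open>Y\<close> and \<open>Z\<close> is isomorphic to
  \<open>F X\<close>, and reflection of isomorphisms identifies that sum with
  \<open>X\<close>.\<close>

lemma indecomposable_iff:
  assumes [simp]: "X \<in> Ob C"
  shows "FO X \<in> indecomposables D \<longleftrightarrow> X \<in> indecomposables C"
proof
  assume F: "FO X \<in> indecomposables D"
  show "X \<in> indecomposables C"
  proof -
    have "is_zero_object C Y \<or> is_zero_object C Z" if "is_direct_sum C Y Z X" for Y Z
      using FO_direct_sum[OF that] F C.direct_sum_Ob[OF that] zero_object_iff
      by (auto simp: indecomposables_def)
    then show ?thesis using F by (simp add: indecomposables_def zero_object_iff)
  qed
next
  assume X: "X \<in> indecomposables C"
  have "is_zero_object D M \<or> is_zero_object D N" if d: "is_direct_sum D M N (FO X)" for M N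
  proof -
    have "M \<in> Ob D" "N \<in> Ob D" using d by (auto simp: is_direct_sum_def is_biproduct_def)
    then obtain Y Z where [simp]: "Y \<in> Ob C" "Z \<in> Ob C"
      and i: "(FO Y, M) \<in> iso_rel D" "(FO Z, N) \<in> iso_rel D"
      using ess_surj unfolding is_essentially_surjective_def by metis
    obtain S where S: "is_direct_sum C Y Z S" using C_sum[of Y Z] by auto
    then have "(FO S, FO X) \<in> iso_rel D"
      using D.direct_sum_unique[OF FO_direct_sum d i] by blast
    then have "(S, X) \<in> iso_rel C"
      using S by (subst (asm) iso_rel_iff) (auto simp: is_direct_sum_def is_biproduct_def)
    then have "is_direct_sum C Y Z X" using S C.direct_sum_iso by blast
    then have "is_zero_object C Y \<or> is_zero_object C Z" using X by (auto simp: indecomposables_def)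
    then show ?thesis using zero_object_iff D.zero_object_iso i by (metis \<open>Y \<in> Ob C\<close> \<open>Z \<in> Ob C\<close>)
  qed
  then show "FO X \<in> indecomposables D" using X by (simp add: indecomposables_def zero_object_iff)
qed

text \<open>Formulated for an isomorphism-closed class \<open>S'\<close> and its preimage
  \<open>S\<close>, which covers all objects and the indecomposable ones at once.\<close>

lemma bij_iso_classes:
  assumes S: "S \<subseteq> Ob C" and S': "S' \<subseteq> Ob D" and iff: "\<And>X. X \<in> Ob C \<Longrightarrow> FO X \<in> S' \<longleftrightarrow> X \<in> S"
    and closed: "\<And>M N. (M, N) \<in> iso_rel D \<Longrightarrow> M \<in> S' \<Longrightarrow> N \<in> S'"
  shows "bij_betw (iso_class_map D FO) (S // iso_rel C) (S' // iso_rel D)"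
proof -
  have eq: "iso_class_map D FO (iso_rel C `` {X}) = iso_rel D `` {FO X}" if X: "X \<in> Ob C" for X
    unfolding iso_class_map_def using X C.iso_rel_refl[OF X] FO_iso D.iso_rel_trans by blast
  have D_eq: "iso_rel D `` {M} = iso_rel D `` {N}" if "(M, N) \<in> iso_rel D" for M N
    using that by (rule equiv_class_eq[OF D.equiv_iso_rel])
  show ?thesis unfolding bij_betw_def
  proof
    show "inj_on (iso_class_map D FO) (S // iso_rel C)"
    proof (rule inj_onI)
      fix c d assume "c \<in> S // iso_rel C" "d \<in> S // iso_rel C"
          and e: "iso_class_map D FO c = iso_class_map D FO d"
      then obtain X Y where c: "c = iso_rel C `` {X}" "d = iso_rel C `` {Y}" and X: "X \<in> Ob C"
          "Y \<in> Ob C"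
        using S by (auto elim!: quotientE)
      then have "iso_rel D `` {FO X} = iso_rel D `` {FO Y}" using e by (simp add: eq)
      then have "(FO X, FO Y) \<in> iso_rel D" using X by (metis D.equiv_iso_rel FO_closed eq_equiv_class)
      then have "(X, Y) \<in> iso_rel C" using X by (simp add: iso_rel_iff)
      then show "c = d" unfolding c by (rule equiv_class_eq[OF C.equiv_iso_rel])
    qed
    show "iso_class_map D FO ` (S // iso_rel C) = S' // iso_rel D"
    proof (intro equalityI subsetI)
      fix c assume "c \<in> iso_class_map D FO ` (S // iso_rel C)"
      then obtain X where X: "X \<in> S" "c = iso_rel D `` {FO X}" using S eq by (auto elim!: quotientE)
      then show "c \<in> S' // iso_rel D" using S iff by (auto intro!: quotientI)
    next
      fix c assume "c \<in> S' // iso_rel D"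
      then obtain M where M: "M \<in> S'" "c = iso_rel D `` {M}" by (auto elim!: quotientE)
      then obtain X where X: "X \<in> Ob C" "(FO X, M) \<in> iso_rel D"
        using ess_surj S' unfolding is_essentially_surjective_def by blast
      then have "FO X \<in> S'" using closed M D.iso_rel_sym by blast
      then have "iso_rel C `` {X} \<in> S // iso_rel C" using X iff by (auto intro!: quotientI)
      moreover have "c = iso_class_map D FO (iso_rel C `` {X})" using M X eq D_eq by simp
      ultimately show "c \<in> iso_class_map D FO ` (S // iso_rel C)" by blast
    qed
  qed
qed

end

section \<open>Exactness of triangles\<close>

context triangulated_category
begin

declare ShO_closed [simp]
declare ShO_0 [simp]
declare ShM_0 [simp]
declare ShO_ShO [simp]
text \<open>The outer objects enter through equations because \<open>ShO T q X\<close> loses this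
  shape once iterated shifts have been merged.\<close>

lemma ShM_ShM' [simp]:
  "\<lbrakk>X \<in> Ob T; Y \<in> Ob T; f \<in> mor T X Y; X' = ShO T q X; Y' = ShO T q Y\<rbrakk>
    \<Longrightarrow> ShM T p X' Y' (ShM T q X Y f) = ShM T (p + q) X Y f"
  using ShM_ShM by simp
declare ShM_Idn [simp]

lemma ShM_closed' [simp]:
  "\<lbrakk>X \<in> Ob T; Y \<in> Ob T; f \<in> mor T X Y; X' = ShO T p X; Y' = ShO T p Y\<rbrakk> \<Longrightarrow> ShM T p X Y f \<in> mor T X' Y'"
  using ShM_closed by simp

lemma ShM_zero [simp]:
  assumes "X \<in> Ob T" "Y \<in> Ob T"
  shows "ShM T p X Y \<zero>\<^bsub>Mor T X Y\<^esub> = \<zero>\<^bsub>Mor T (ShO T p X) (ShO T p Y)\<^esub>"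
  using assms ShM_add[of X Y "\<zero>\<^bsub>Mor T X Y\<^esub>" "\<zero>\<^bsub>Mor T X Y\<^esub>" p] by (intro hom_add_self_zero) simp_all

lemma ShM_minus [simp]:
  assumes "X \<in> Ob T" "Y \<in> Ob T" "f \<in> mor T X Y"
  shows "ShM T p X Y (\<ominus>\<^bsub>Mor T X Y\<^esub> f) = \<ominus>\<^bsub>Mor T (ShO T p X) (ShO T p Y)\<^esub> ShM T p X Y f"
  using assms ShM_add[of X Y "\<ominus>\<^bsub>Mor T X Y\<^esub> f" f p] by (intro hom_eq_minusI) simp_all

lemma ShM_inj:
  assumes "X \<in> Ob T" "Y \<in> Ob T" "f \<in> mor T X Y" "g \<in> mor T X Y" "ShM T p X Y f = ShM T p X Y g"
  shows "f = g"
proof -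
  have "f = ShM T (-p) (ShO T p X) (ShO T p Y) (ShM T p X Y f)" using assms(1-3) by simp
  also have "\<dots> = g" unfolding assms(5) using assms(1,2,4) by simp
  finally show ?thesis .
qed

lemma ShM_eq_zero:
  assumes "X \<in> Ob T" "Y \<in> Ob T" "f \<in> mor T X Y" "ShM T p X Y f = \<zero>\<^bsub>Mor T (ShO T p X) (ShO T p Y)\<^esub>"
  shows "f = \<zero>\<^bsub>Mor T X Y\<^esub>"
  using assms by (intro ShM_inj[of X Y f _ p]) simp_all

lemma ShM_surj:
  assumes "X \<in> Ob T" "Y \<in> Ob T" "f \<in> mor T (ShO T p X) (ShO T p Y)"
  shows "\<exists>g \<in> mor T X Y. ShM T p X Y g = f"
  using assms ShM_ShM[of "ShO T p X" "ShO T p Y" f p "-p"]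
  by (intro bexI[of _ "ShM T (-p) (ShO T p X) (ShO T p Y) f"]) simp_all

lemma zero_object_shift:
  assumes N: "is_zero_object T N"
  shows "is_zero_object T (ShO T p N)"
proof -
  note [simp] = zero_object_Ob[OF N]
  have "ShM T p N N (Idn T N) = \<zero>\<^bsub>Mor T (ShO T p N) (ShO T p N)\<^esub>"
    using N by (simp add: zero_object_iff del: ShM_Idn)
  then show ?thesis by (simp add: zero_object_iff)
qed

lemma Tri_Ob:
  assumes "(X, Y, Z, u, v, w) \<in> Tri T"
  shows "X \<in> Ob T" "Y \<in> Ob T" "Z \<in> Ob T" "u \<in> mor T X Y" "v \<in> mor T Y Z" "w \<in> mor T Z (ShO T 1 X)"
  using Tri_typed[OF assms] by auto

lemma Tri_rotate:
  assumes "(X, Y, Z, u, v, w) \<in> Tri T"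
  shows "(Y, Z, ShO T 1 X, v, w, \<ominus>\<^bsub>Mor T (ShO T 1 X) (ShO T 1 Y)\<^esub> ShM T 1 X Y u) \<in> Tri T"
  using TR2[OF Tri_Ob[OF assms]] assms by blast

lemma Tri_rotate_back:
  assumes "(X, Y, Z, u, v, w) \<in> Tri T"
  shows "(ShO T (-1) Z, X, Y, \<ominus>\<^bsub>Mor T (ShO T (-1) Z) X\<^esub> ShM T (-1) Z (ShO T 1 X) w, u, v) \<in> Tri T"
  using Tri_Ob[OF assms] assms by (subst TR2) simp_all

text \<open>TR3 extends \<open>(1, u)\<close> to a morphism from the trivial triangle on
  \<open>X\<close>, whose third object is zero; hence \<open>v u\<close> factors through a zero
  object.\<close>

lemma Tri_comp_zero:
  assumes t: "(X, Y, Z, u, v, w) \<in> Tri T"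
  shows "Cmp T X Y Z v u = \<zero>\<^bsub>Mor T X Z\<^esub>"
proof -
  note [simp] = Tri_Ob[OF t]
  obtain N where N: "is_zero_object T N" using zero_object by blast
  note [simp] = zero_object_Ob[OF N]
  show ?thesis
    using TR3[OF TR1_id[OF _ N, of X] t, of "Idn T X" u] by auto
qed

lemma Tri_comp_zero':
  assumes t: "(X, Y, Z, u, v, w) \<in> Tri T"
  shows "Cmp T Y Z (ShO T 1 X) w v = \<zero>\<^bsub>Mor T Y (ShO T 1 X)\<^esub>"
  by (rule Tri_comp_zero[OF Tri_rotate[OF t]])

text \<open>\<open>(0, y)\<close> starts a morphism to the triangle \<open>0 -> W -> W\<close>: the
  commuting square required by TR3 is exactly \<open>y u = 0\<close>, and the third component is the
  factorization.\<close>

lemma Tri_coexact: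
  assumes t: "(X, Y, Z, u, v, w) \<in> Tri T" and W [simp]: "W \<in> Ob T"
    and y: "y \<in> mor T Y W" "Cmp T X Y W y u = \<zero>\<^bsub>Mor T X W\<^esub>"
  shows "\<exists>z \<in> mor T Z W. Cmp T Y Z W z v = y"
proof -
  note [simp] = Tri_Ob[OF t] y
  obtain N where N: "is_zero_object T N" using zero_object by blast
  note [simp] = zero_object_Ob[OF N]
  have "(N, W, W, \<zero>\<^bsub>Mor T N W\<^esub>, Idn T W, \<zero>\<^bsub>Mor T W (ShO T 1 N)\<^esub>) \<in> Tri T"
    using TR1_id[OF W zero_object_shift[OF N, of 1]]
      zero_object_out[OF zero_object_shift[OF N, of 1], of "ShO T 1 W"
          "\<zero>\<^bsub>Mor T (ShO T 1 N) (ShO T 1 W)\<^esub>"]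
    by (subst TR2) simp_all
  from TR3[OF t this, of "\<zero>\<^bsub>Mor T X N\<^esub>" y] show ?thesis by auto
qed

text \<open>TR3 produces only third components, so both triangles are rotated until the wanted map
  \<open>W -> X\<close> stands there, shifted once; it is then desuspended.\<close>

lemma Tri_exact:
  assumes t: "(X, Y, Z, u, v, w) \<in> Tri T" and W [simp]: "W \<in> Ob T"
    and x: "x \<in> mor T W Y" "Cmp T W Y Z v x = \<zero>\<^bsub>Mor T W Z\<^esub>"
  shows "\<exists>x' \<in> mor T W X. Cmp T W X Y u x' = x"
proof -
  note [simp] = Tri_Ob[OF t] x
  obtain N where N: "is_zero_object T N" using zero_object by blast
  note [simp] = zero_object_Ob[OF N]
  obtain c where [simp]: "c \<in> mor T (ShO T 1 W) (ShO T 1 X)"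
    and c: "Cmp T (ShO T 1 W) (ShO T 1 W) (ShO T 1 Y) (ShM T 1 W Y x)
       (\<ominus>\<^bsub>Mor T (ShO T 1 W) (ShO T 1 W)\<^esub> ShM T 1 W W (Idn T W))
     = Cmp T (ShO T 1 W) (ShO T 1 X) (ShO T 1 Y) (\<ominus>\<^bsub>Mor T (ShO T 1 X) (ShO T 1 Y)\<^esub> ShM T 1 X Y u) c"
    using TR3[OF Tri_rotate[OF TR1_id[OF W N]] Tri_rotate[OF t], of x "\<zero>\<^bsub>Mor T N Z\<^esub>"] by auto
  obtain x' where [simp]: "x' \<in> mor T W X" and x': "ShM T 1 W X x' = c" using ShM_surj[of W X c 1]
      by auto
  \<comment> \<open>Rotation put a minus sign on both sides; the signs cancel.\<close>
  have "\<ominus>\<^bsub>Mor T (ShO T 1 W) (ShO T 1 Y)\<^esub> ShM T 1 W Y x =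
      \<ominus>\<^bsub>Mor T (ShO T 1 W) (ShO T 1 Y)\<^esub> ShM T 1 W Y (Cmp T W X Y u x')"
    using c by (simp add: ShM_Cmp flip: x')
  then have "ShM T 1 W Y x = ShM T 1 W Y (Cmp T W X Y u x')"
    using hom_minus_minus by (metis Cmp_closed ShM_closed ShO_closed Tri_Ob(1,2,4)[OF t] W
        \<open>x' \<in> mor T W X\<close> x(1))
  then have "x = Cmp T W X Y u x'" by (intro ShM_inj[of W Y x _ 1]) simp_all
  then show ?thesis by auto
qed

text \<open>As the last map is zero, the identity of \<open>Z\<close> lifts to a section
  \<open>s\<close> of \<open>v\<close>, and \<open>1 - s v\<close> is killed by \<open>v\<close>, so
  it factors through \<open>u\<close>. Such a decomposition of the identity is what
  \<open>projsI\<close> asks for.\<close>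

lemma Tri_split:
  assumes t: "(X, Y, Z, u, v, \<zero>\<^bsub>Mor T Z (ShO T 1 X)\<^esub>) \<in> Tri T"
  shows "\<exists>s \<in> mor T Z Y. \<exists>r \<in> mor T Y X. Cmp T Y Z Y s v \<oplus>\<^bsub>Mor T Y Y\<^esub> Cmp T Y X Y u r = Idn T Y"
proof -
  note [simp] = Tri_Ob[OF t]
  obtain s where [simp]: "s \<in> mor T Z Y" and s: "Cmp T Z Y Z v s = Idn T Z"
    using Tri_exact[OF Tri_rotate[OF t], of Z "Idn T Z"] by auto
  let ?e = "Idn T Y \<oplus>\<^bsub>Mor T Y Y\<^esub> \<ominus>\<^bsub>Mor T Y Y\<^esub> Cmp T Y Z Y s v"
  have "Cmp T Y Y Z v ?e = \<zero>\<^bsub>Mor T Y Z\<^esub>"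
    by (simp add: Cmp_add_right Cmp_assoc s)
  then obtain r where "r \<in> mor T Y X" "Cmp T Y X Y u r = ?e"
    using Tri_exact[OF t, of Y ?e] by auto
  then show ?thesis by (intro bexI[of _ s] bexI[of _ r]) simp_all
qed

end

section \<open>Maps tested on shifts of the generator\<close>

locale triangulated_with_object = triangulated_category k T
  for k :: "('k, 'r) ring_scheme" and T :: "('o, 'm, 'k, 'z) tcat_scheme" +
  fixes G :: 'o
  assumes G [simp]: "G \<in> Ob T"
begin

text \<open>This and the next two are injectivity, surjectivity and exactness after applying
  \<open>F\<close>. Shifting identifies degree \<open>p\<close> of \<open>F X\<close> with
  \<open>Hom(\<Sigma>\<^sup>-\<^sup>pG, X)\<close>, so letting \<open>d\<close> vary covers all
  degrees.\<close>

definition gmono :: "'o \<Rightarrow> 'o \<Rightarrow> 'm \<Rightarrow> bool" where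
  "gmono X Y f \<longleftrightarrow> (\<forall>d. \<forall>x \<in> mor T (ShO T d G) X.
     Cmp T (ShO T d G) X Y f x = \<zero>\<^bsub>Mor T (ShO T d G) Y\<^esub> \<longrightarrow> x = \<zero>\<^bsub>Mor T (ShO T d G) X\<^esub>)"

definition gsurj :: "'o \<Rightarrow> 'o \<Rightarrow> 'm \<Rightarrow> bool" where
  "gsurj X Y f \<longleftrightarrow> (\<forall>d. \<forall>y \<in> mor T (ShO T d G) Y. \<exists>x \<in> mor T (ShO T d G) X. Cmp T (ShO T d G) X Y f x
      = y)"

text \<open>Only the inclusion of the kernel in the image; that the composite is zero is stated
  separately.\<close>

definition gexact :: "'o \<Rightarrow> 'o \<Rightarrow> 'o \<Rightarrow> 'm \<Rightarrow> 'm \<Rightarrow> bool" where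
  "gexact X Y Z f g \<longleftrightarrow> (\<forall>d. \<forall>y \<in> mor T (ShO T d G) Y.
     Cmp T (ShO T d G) Y Z g y = \<zero>\<^bsub>Mor T (ShO T d G) Z\<^esub> \<longrightarrow>
     (\<exists>x \<in> mor T (ShO T d G) X. Cmp T (ShO T d G) X Y f x = y))"

lemma gmonoD:
  "\<lbrakk>gmono X Y f; x \<in> mor T (ShO T d G) X; Cmp T (ShO T d G) X Y f x = \<zero>\<^bsub>Mor T (ShO T d G) Y\<^esub>\<rbrakk>
    \<Longrightarrow> x = \<zero>\<^bsub>Mor T (ShO T d G) X\<^esub>"
  by (simp add: gmono_def)

lemma gsurjD:
  assumes "gsurj X Y f" "y \<in> mor T (ShO T d G) Y"
  obtains x where "x \<in> mor T (ShO T d G) X" "Cmp T (ShO T d G) X Y f x = y"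
  using assms unfolding gsurj_def by blast

lemma gexactD:
  assumes "gexact X Y Z f g" "y \<in> mor T (ShO T d G) Y"
      "Cmp T (ShO T d G) Y Z g y = \<zero>\<^bsub>Mor T (ShO T d G) Z\<^esub>"
  obtains x where "x \<in> mor T (ShO T d G) X" "Cmp T (ShO T d G) X Y f x = y"
  using assms unfolding gexact_def by blast

text \<open>The ideal of morphisms that factor through finite direct sums of shifts of \<open>G\<close>. The objects
  whose identity belongs to it are the direct summands of such sums.\<close>

inductive_set addG :: "'o \<Rightarrow> 'o \<Rightarrow> 'm set" for X Y where
  zero: "\<zero>\<^bsub>Mor T X Y\<^esub> \<in> addG X Y"
| step: "\<lbrakk>a \<in> mor T X (ShO T d G); b \<in> mor T (ShO T d G) Y; e \<in> addG X Y\<rbrakk>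
    \<Longrightarrow> Cmp T X (ShO T d G) Y b a \<oplus>\<^bsub>Mor T X Y\<^esub> e \<in> addG X Y"

definition projs :: "'o set" where
  "projs = {P \<in> Ob T. Idn T P \<in> addG P P}"

lemma projs_Ob [simp]: "P \<in> projs \<Longrightarrow> P \<in> Ob T"
  by (simp add: projs_def)

lemma projs_Idn: "P \<in> projs \<Longrightarrow> Idn T P \<in> addG P P"
  unfolding projs_def by blast

lemma projs_IdnI: "\<lbrakk>P \<in> Ob T; Idn T P \<in> addG P P\<rbrakk> \<Longrightarrow> P \<in> projs"
  unfolding projs_def by blast

lemma addG_closed:
  assumes "X \<in> Ob T" "Y \<in> Ob T" "e \<in> addG X Y"
  shows "e \<in> mor T X Y"
  using assms(3) by induct (use assms(1,2) in simp_all)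

lemma addG_add:
  assumes [simp]: "X \<in> Ob T" "Y \<in> Ob T" and "e \<in> addG X Y" and f: "f \<in> addG X Y"
  shows "e \<oplus>\<^bsub>Mor T X Y\<^esub> f \<in> addG X Y"
  using assms(3)
proof induct
  case zero
  then show ?case using f addG_closed[OF _ _ f] by simp
next
  case (step a d b e)
  then show ?case using addG_closed[OF _ _ f] addG_closed[of X Y e] by (simp add: hom_assoc addG.step)
qed

lemma addG_comp:
  assumes [simp]: "W \<in> Ob T" "X \<in> Ob T" "Y \<in> Ob T" "Z \<in> Ob T" "x \<in> mor T W X" "y \<in> mor T Y Z"
    and "e \<in> addG X Y"
  shows "Cmp T W Y Z y (Cmp T W X Y e x) \<in> addG W Z"
  using assms(7)
proof induct
  case zero
  then show ?case by (simp add: addG.zero)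
next
  case (step a d b e)
  note [simp] = step(1,2) addG_closed[OF _ _ step(3)]
  have "Cmp T W Y Z y (Cmp T W X Y (Cmp T X (ShO T d G) Y b a) x) =
      Cmp T W (ShO T d G) Z (Cmp T (ShO T d G) Y Z y b) (Cmp T W X (ShO T d G) a x)"
    by (simp add: Cmp_assoc)
  then show ?case using step(4) by (simp add: Cmp_add_left Cmp_add_right addG.step)
qed

lemma addG_shift:
  assumes [simp]: "X \<in> Ob T" "Y \<in> Ob T" and "e \<in> addG X Y"
  shows "ShM T p X Y e \<in> addG (ShO T p X) (ShO T p Y)"
  using assms(3)
proof induct
  case zero
  then show ?case by (simp add: addG.zero)
next
  case (step a d b e)
  note [simp] = step(1,2) addG_closed[OF _ _ step(3)]
  show ?case
    using addG.step[of "ShM T p X (ShO T d G) a" "ShO T p X" "p + d"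
        "ShM T p (ShO T d G) Y b", OF _ _ step(4)]
    by (simp add: ShM_add ShM_Cmp)
qed

lemma shift_G_projs [simp]: "ShO T d G \<in> projs"
  using addG.step[of "Idn T (ShO T d G)" "ShO T d G" d "Idn T (ShO T d G)"
      "ShO T d G", OF _ _ addG.zero]
  by (intro projs_IdnI) simp_all

lemma projs_shift [simp]: "P \<in> projs \<Longrightarrow> ShO T p P \<in> projs"
  using addG_shift[of P P "Idn T P" p] projs_Idn[of P] by (intro projs_IdnI) simp_all

lemma zero_projs: "is_zero_object T N \<Longrightarrow> N \<in> projs"
  using addG.zero[of N N] zero_object_iff[of N] by (intro projs_IdnI) (simp_all add: zero_object_Ob)

text \<open>The maps need not be biproduct data, so that the decomposition supplied by
  \<open>Tri_split\<close> can be used.\<close>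

lemma projsI:
  assumes "Y \<in> Ob T" "P \<in> projs" "Q \<in> projs"
    and "a \<in> mor T Y P" "b \<in> mor T P Y" "c \<in> mor T Y Q" "d \<in> mor T Q Y"
    and "Cmp T Y P Y b a \<oplus>\<^bsub>Mor T Y Y\<^esub> Cmp T Y Q Y d c = Idn T Y"
  shows "Y \<in> projs"
  using addG_comp[of Y P P Y a b "Idn T P"] addG_comp[of Y Q Q Y c d "Idn T Q"]
    addG_add[of Y Y "Cmp T Y P Y b a" "Cmp T Y Q Y d c"] assms projs_Idn[of P] projs_Idn[of Q]
  by (intro projs_IdnI) simp_all

lemma projs_retract:
  assumes "Y \<in> Ob T" "P \<in> projs" "a \<in> mor T Y P" "b \<in> mor T P Y" "Cmp T Y P Y b a = Idn T Y"
  shows "Y \<in> projs"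
  using addG_comp[of Y P P Y a b "Idn T P"] assms projs_Idn[of P]
  by (intro projs_IdnI) simp_all

lemma projs_biproduct:
  assumes "is_biproduct T P Q S i j p q" "P \<in> projs" "Q \<in> projs"
  shows "S \<in> projs"
  using assms by (intro projsI[of S P Q p i q j]) (auto simp: is_biproduct_def)

text \<open>\<open>f e = 0\<close> for every \<open>e\<close> in \<open>addG P P\<close>, by
  induction: a term \<open>f b a\<close> vanishes because \<open>b\<close> starts at a shift of
  \<open>G\<close>. The identity of \<open>P\<close> is one such \<open>e\<close>.\<close>

lemma projs_faithful:
  assumes P: "P \<in> projs" and [simp]: "X \<in> Ob T" "f \<in> mor T P X"
    and 0: "\<And>d x. x \<in> mor T (ShO T d G) P \<Longrightarrow> Cmp T (ShO T d G) P X f x = \<zero>\<^bsub>Mor T (ShO T d G) X\<^esub>"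
  shows "f = \<zero>\<^bsub>Mor T P X\<^esub>"
proof -
  note [simp] = projs_Ob[OF P]
  have "Cmp T P P X f e = \<zero>\<^bsub>Mor T P X\<^esub>" if "e \<in> addG P P" for e
    using that
  proof induct
    case (step a d b e)
    note [simp] = step(1,2) addG_closed[OF _ _ step(3)]
    show ?case using step(4) by (simp add: Cmp_add_right Cmp_assoc 0)
  qed simp
  from this[OF projs_Idn[OF P]] show ?thesis by simp
qed

text \<open>\<open>y e\<close> lifts for every \<open>e\<close> in \<open>addG P P\<close>, again by
  induction: \<open>y b\<close> lifts because \<open>b\<close> starts at a shift of
  \<open>G\<close>, and lifts add up. The case \<open>e = 1\<close> is the claim.\<close>

lemma gexactD_projs:
  assumes P: "P \<in> projs" and [simp]: "X \<in> Ob T" "Y \<in> Ob T" "Z \<in> Ob T" "f \<in> mor T X Y" "g \<in> mor T Y Z"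
    and ex: "gexact X Y Z f g" and [simp]: "y \<in> mor T P Y" and gy: "Cmp T P Y Z g y = \<zero>\<^bsub>Mor T P Z\<^esub>"
  shows "\<exists>x \<in> mor T P X. Cmp T P X Y f x = y"
proof -
  note [simp] = projs_Ob[OF P]
  have "\<exists>x \<in> mor T P X. Cmp T P X Y f x = Cmp T P P Y y e" if "e \<in> addG P P" for e
    using that
  proof induct
    case zero
    then show ?case by (intro bexI[of _ "\<zero>\<^bsub>Mor T P X\<^esub>"]) simp_all
  next
    case (step a d b e)
    note [simp] = step(1,2) addG_closed[OF _ _ step(3)]
    obtain x where [simp]: "x \<in> mor T P X" and x: "Cmp T P X Y f x = Cmp T P P Y y e" using step(4)
        by auto
    have "Cmp T (ShO T d G) Y Z g (Cmp T (ShO T d G) P Y y b) = \<zero>\<^bsub>Mor T (ShO T d G) Z\<^esub>"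
      by (simp add: Cmp_assoc gy)
    then obtain z where [simp]: "z \<in> mor T (ShO T d G) X"
      and z: "Cmp T (ShO T d G) X Y f z = Cmp T (ShO T d G) P Y y b"
      using gexactD[OF ex, of "Cmp T (ShO T d G) P Y y b" d] by auto
    show ?case
      by (rule bexI[of _ "Cmp T P (ShO T d G) X z a \<oplus>\<^bsub>Mor T P X\<^esub> x"])
        (simp_all add: Cmp_add_right x Cmp_assoc z)
  qed
  from this[OF projs_Idn[OF P]] show ?thesis by simp
qed

text \<open>Surjectivity is exactness in front of a zero map.\<close>

lemma gsurjD_projs:
  assumes "P \<in> projs" "X \<in> Ob T" "Y \<in> Ob T" "f \<in> mor T X Y" "gsurj X Y f" "y \<in> mor T P Y"
  shows "\<exists>x \<in> mor T P X. Cmp T P X Y f x = y"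
  using assms by (intro gexactD_projs[of P X Y Y f "\<zero>\<^bsub>Mor T Y Y\<^esub>"]) (auto simp: gexact_def gsurj_def)

section \<open>Stability of the three tests under shifts\<close>

lemma shifted_test:
  assumes "X \<in> Ob T" "y \<in> mor T (ShO T d G) (ShO T p X)"
  obtains x where "x \<in> mor T (ShO T (d - p) G) X" "ShM T p (ShO T (d - p) G) X x = y"
  using ShM_surj[of "ShO T (d - p) G" X y p] assms by auto

lemma gmono_shift:
  assumes [simp]: "X \<in> Ob T" "Y \<in> Ob T" "f \<in> mor T X Y" and f: "gmono X Y f"
  shows "gmono (ShO T p X) (ShO T p Y) (ShM T p X Y f)"
  unfolding gmono_def
proof (intro allI ballI impI)
  fix d x assume "x \<in> mor T (ShO T d G) (ShO T p X)"
    and 0: "Cmp T (ShO T d G) (ShO T p X) (ShO T p Y) (ShM T p X Y f) x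
        = \<zero>\<^bsub>Mor T (ShO T d G) (ShO T p Y)\<^esub>"
  then obtain x' where [simp]: "x' \<in> mor T (ShO T (d - p) G) X"
      and x: "ShM T p (ShO T (d - p) G) X x' = x"
    using shifted_test by (metis assms(1))
  have "ShM T p (ShO T (d - p) G) Y (Cmp T (ShO T (d - p) G) X Y f x')
      = \<zero>\<^bsub>Mor T (ShO T p (ShO T (d - p) G)) (ShO T p Y)\<^esub>"
    using 0 by (simp add: ShM_Cmp flip: x)
  then have "Cmp T (ShO T (d - p) G) X Y f x' = \<zero>\<^bsub>Mor T (ShO T (d - p) G) Y\<^esub>"
    by (rule ShM_eq_zero[rotated 3]) simp_all
  then show "x = \<zero>\<^bsub>Mor T (ShO T d G) (ShO T p X)\<^esub>"
    using gmonoD[OF f \<open>x' \<in> _\<close>] by (simp flip: x)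
qed

lemma gsurj_shift:
  assumes [simp]: "X \<in> Ob T" "Y \<in> Ob T" "f \<in> mor T X Y" and f: "gsurj X Y f"
  shows "gsurj (ShO T p X) (ShO T p Y) (ShM T p X Y f)"
  unfolding gsurj_def
proof (intro allI ballI)
  fix d y assume "y \<in> mor T (ShO T d G) (ShO T p Y)"
  then obtain y' where [simp]: "y' \<in> mor T (ShO T (d - p) G) Y"
      and y: "ShM T p (ShO T (d - p) G) Y y' = y"
    using shifted_test by (metis assms(2))
  then obtain x where [simp]: "x \<in> mor T (ShO T (d - p) G) X" and "Cmp T (ShO T (d - p) G) X Y f x = y'"
    using gsurjD[OF f] by metis
  then show "\<exists>x \<in> mor T (ShO T d G) (ShO T p X). Cmp T (ShO T d G) (ShO T p X) (ShO T p Y)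
      (ShM T p X Y f) x = y"
    using ShM_Cmp[of "ShO T (d - p) G" X Y x f p] y
        by (intro bexI[of _ "ShM T p (ShO T (d - p) G) X x"]) simp_all
qed

lemma gexact_shift:
  assumes [simp]: "X \<in> Ob T" "Y \<in> Ob T" "Z \<in> Ob T" "f \<in> mor T X Y" "g \<in> mor T Y Z"
      and f: "gexact X Y Z f g"
  shows "gexact (ShO T p X) (ShO T p Y) (ShO T p Z) (ShM T p X Y f) (ShM T p Y Z g)"
  unfolding gexact_def
proof (intro allI ballI impI)
  fix d y assume "y \<in> mor T (ShO T d G) (ShO T p Y)"
    and 0: "Cmp T (ShO T d G) (ShO T p Y) (ShO T p Z) (ShM T p Y Z g) y
        = \<zero>\<^bsub>Mor T (ShO T d G) (ShO T p Z)\<^esub>"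
  then obtain y' where [simp]: "y' \<in> mor T (ShO T (d - p) G) Y"
      and y: "ShM T p (ShO T (d - p) G) Y y' = y"
    using shifted_test by (metis assms(2))
  have "ShM T p (ShO T (d - p) G) Z (Cmp T (ShO T (d - p) G) Y Z g y')
      = \<zero>\<^bsub>Mor T (ShO T p (ShO T (d - p) G)) (ShO T p Z)\<^esub>"
    using 0 by (simp add: ShM_Cmp flip: y)
  then have "Cmp T (ShO T (d - p) G) Y Z g y' = \<zero>\<^bsub>Mor T (ShO T (d - p) G) Z\<^esub>"
    by (rule ShM_eq_zero[rotated 3]) simp_all
  then obtain x where [simp]: "x \<in> mor T (ShO T (d - p) G) X" and "Cmp T (ShO T (d - p) G) X Y f x = y'"
    using gexactD[OF f \<open>y' \<in> _\<close>] by blast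
  then show "\<exists>x \<in> mor T (ShO T d G) (ShO T p X). Cmp T (ShO T d G) (ShO T p X) (ShO T p Y)
      (ShM T p X Y f) x = y"
    using ShM_Cmp[of "ShO T (d - p) G" X Y x f p] y
        by (intro bexI[of _ "ShM T p (ShO T (d - p) G) X x"]) simp_all
qed

end

text \<open>\<open>splitting\<close> is what hereditariness gives: a morphism \<open>P \<rightarrow> Q\<close> between summands of sums of shifts of
  \<open>G\<close> is the projection onto a direct summand followed by a morphism injective on \<open>Hom(\<Sigma>\<^sup>dG, -)\<close>.\<close>

locale triangulated_with_generator = triangulated_with_object k T G
  for k :: "('k, 'r) ring_scheme" and T :: "('o, 'm, 'k, 'z) tcat_scheme" and G :: 'o +
  assumes generator: "thick_closure T G = Ob T"
    and splitting: "\<lbrakk>P \<in> projs; Q \<in> projs; f \<in> mor T P Q\<rbrakk> \<Longrightarrow>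
      \<exists>I K i j p q. is_biproduct T I K P i j p q \<and> gmono I Q (Cmp T I P Q f i) \<and>
        Cmp T P I Q (Cmp T I P Q f i) p = f"
begin

text \<open>The objects with no nonzero map to any shift of \<open>D\<close> include
  \<open>G\<close> and are closed under shifts, extensions and summands. Quantifying over
  \<open>p\<close> keeps the induction stable under shifts.\<close>

lemma G_orthogonal:
  assumes [simp]: "D \<in> Ob T" and D: "\<And>d x. x \<in> mor T (ShO T d G) D \<Longrightarrow> x = \<zero>\<^bsub>Mor T (ShO T d G) D\<^esub>"
    and Y: "Y \<in> Ob T"
  shows "\<forall>p. \<forall>x \<in> mor T Y (ShO T p D). x = \<zero>\<^bsub>Mor T Y (ShO T p D)\<^esub>"
proof -
  have Ob: "Z \<in> Ob T" if "Z \<in> thick_closure T G" for Z using that generator by simp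
  have "Y \<in> thick_closure T G" using Y generator by simp
  then show ?thesis
  proof (induct rule: thick_closure.induct)
    case base
    show ?case
    proof (intro allI ballI)
      fix p x assume "x \<in> mor T G (ShO T p D)"
      then obtain x' where [simp]: "x' \<in> mor T (ShO T (0 - p) G) D"
          and x: "ShM T p (ShO T (0 - p) G) D x' = x"
        using shifted_test[of D x 0 p] by auto
      show "x = \<zero>\<^bsub>Mor T G (ShO T p D)\<^esub>"
        using D[OF \<open>x' \<in> _\<close>] by (simp flip: x)
    qed
  next
    case (shift X q)
    note [simp] = Ob[OF shift(1)]
    show ?case
    proof (intro allI ballI)
      fix p x assume [simp]: "x \<in> mor T (ShO T q X) (ShO T p D)"
      have "ShM T (-q) (ShO T q X) (ShO T p D) x \<in> mor T X (ShO T (p - q) D)" by simp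
      then have "ShM T (-q) (ShO T q X) (ShO T p D) x = \<zero>\<^bsub>Mor T (ShO T (-q) (ShO T q X)) (ShO T (-q)
          (ShO T p D))\<^esub>"
        using shift(2) by simp
      then show "x = \<zero>\<^bsub>Mor T (ShO T q X) (ShO T p D)\<^esub>"
        by (rule ShM_eq_zero[rotated 3]) simp_all
    qed
  next
    case (extension X Y Z u v w)
    note [simp] = Tri_Ob[OF extension(1)]
    show ?case
    proof (intro allI ballI)
      fix p x assume [simp]: "x \<in> mor T Y (ShO T p D)"
      have "Cmp T X Y (ShO T p D) x u = \<zero>\<^bsub>Mor T X (ShO T p D)\<^esub>"
        using extension(3) by simp
      then obtain z where "z \<in> mor T Z (ShO T p D)" and z: "Cmp T Y Z (ShO T p D) z v = x"
        using Tri_coexact[OF extension(1), of "ShO T p D" x] by auto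
      then have "z = \<zero>\<^bsub>Mor T Z (ShO T p D)\<^esub>" using extension(5) by blast
      then show "x = \<zero>\<^bsub>Mor T Y (ShO T p D)\<^esub>" using z by simp
    qed
  next
    case (summand X Y S)
    obtain i j r s where b: "is_biproduct T X Y S i j r s" using summand
        by (auto simp: is_direct_sum_def)
    then have [simp]: "X \<in> Ob T" "S \<in> Ob T" "i \<in> mor T X S" "r \<in> mor T S X"
        and ri: "Cmp T X S X r i = Idn T X"
      by (auto simp: is_biproduct_def)
    show ?case
    proof (intro allI ballI)
      fix p x assume [simp]: "x \<in> mor T X (ShO T p D)"
      have "Cmp T X S (ShO T p D) (Cmp T S X (ShO T p D) x r) i
          = Cmp T X X (ShO T p D) x (Cmp T X S X r i)"
        by (simp add: Cmp_assoc)
      moreover have "Cmp T S X (ShO T p D) x r = \<zero>\<^bsub>Mor T S (ShO T p D)\<^esub>" using summand(3) by simp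
      ultimately show "x = \<zero>\<^bsub>Mor T X (ShO T p D)\<^esub>" by (simp add: ri)
    qed
  qed
qed

text \<open>Long exact sequence: \<open>w z\<close> is killed by \<open>\<Sigma>f\<close>, which is
  still injective under \<open>F\<close>, so \<open>w z = 0\<close> and \<open>z\<close> comes from
  \<open>Y\<close>.\<close>

lemma cone_gsurj:
  assumes t: "(X, Y, Z, f, v, w) \<in> Tri T" and inj: "gmono X Y f"
  shows "gsurj Y Z v"
  unfolding gsurj_def
proof (intro allI ballI)
  fix d z assume [simp]: "z \<in> mor T (ShO T d G) Z"
  note [simp] = Tri_Ob[OF t]
  have "Cmp T (ShO T d G) (ShO T 1 X) (ShO T 1 Y) (\<ominus>\<^bsub>Mor T (ShO T 1 X) (ShO T 1 Y)\<^esub> ShM T 1 X Y f)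
      (Cmp T (ShO T d G) Z (ShO T 1 X) w z) = \<zero>\<^bsub>Mor T (ShO T d G) (ShO T 1 Y)\<^esub>"
    using Tri_comp_zero'[OF Tri_rotate[OF t]] by (simp add: Cmp_assoc del: Cmp_minus_left)
  then have "Cmp T (ShO T d G) (ShO T 1 X) (ShO T 1 Y) (ShM T 1 X Y f)
      (Cmp T (ShO T d G) Z (ShO T 1 X) w z) = \<zero>\<^bsub>Mor T (ShO T d G) (ShO T 1 Y)\<^esub>"
    using hom_minus_minus[of "ShO T d G" "ShO T 1 Y"
        "Cmp T (ShO T d G) (ShO T 1 X) (ShO T 1 Y) (ShM T 1 X Y f)
      (Cmp T (ShO T d G) Z (ShO T 1 X) w z)"] by simp
  then have "Cmp T (ShO T d G) Z (ShO T 1 X) w z = \<zero>\<^bsub>Mor T (ShO T d G) (ShO T 1 X)\<^esub>"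
    by (intro gmonoD[OF gmono_shift[OF _ _ _ inj, of 1]]) simp_all
  then show "\<exists>y \<in> mor T (ShO T d G) Y. Cmp T (ShO T d G) Y Z v y = z"
    using Tri_exact[OF Tri_rotate[OF t], of "ShO T d G" z] by auto
qed

text \<open>Shifts of the cone \<open>D\<close> receive only zero maps: from shifts of
  \<open>G\<close> by \<open>cone_gsurj\<close> and the surjectivity of \<open>f\<close>, then from
  all objects by \<open>G_orthogonal\<close>. So the identity of \<open>Y\<close> lifts to a right
  inverse \<open>s\<close> of \<open>f\<close>, and \<open>1 - s f\<close>, which factors through
  \<open>\<Sigma>\<^sup>-\<^sup>1D\<close>, is zero.\<close>

lemma gbij_iso:
  assumes [simp]: "X \<in> Ob T" "Y \<in> Ob T" "f \<in> mor T X Y" and inj: "gmono X Y f" and surj: "gsurj X Y f"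
  shows "is_iso T X Y f"
proof -
  obtain D e w where t: "(X, Y, D, f, e, w) \<in> Tri T" using TR1_cone by (metis assms(1-3))
  note [simp] = Tri_Ob[OF t]
  have "z = \<zero>\<^bsub>Mor T (ShO T d G) D\<^esub>" if [simp]: "z \<in> mor T (ShO T d G) D" for d z
  proof -
    obtain y where [simp]: "y \<in> mor T (ShO T d G) Y" and y: "Cmp T (ShO T d G) Y D e y = z"
      using gsurjD[OF cone_gsurj[OF t inj], of z d] by auto
    obtain x where [simp]: "x \<in> mor T (ShO T d G) X" and x: "Cmp T (ShO T d G) X Y f x = y"
      using gsurjD[OF surj, of y d] by auto
    show ?thesis using Tri_comp_zero[OF t] by (simp add: Cmp_assoc flip: x y)
  qed
  note D0 = G_orthogonal[OF _ this]
  have "e = \<zero>\<^bsub>Mor T Y D\<^esub>" using D0[of Y] by (metis ShO_0 Tri_Ob(2,3,5)[OF t])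
  then obtain s where [simp]: "s \<in> mor T Y X" and s: "Cmp T Y X Y f s = Idn T Y"
    using Tri_exact[OF t, of Y "Idn T Y"] by auto
  let ?e = "Idn T X \<oplus>\<^bsub>Mor T X X\<^esub> \<ominus>\<^bsub>Mor T X X\<^esub> Cmp T X Y X s f"
  have "Cmp T X X Y f ?e = \<zero>\<^bsub>Mor T X Y\<^esub>"
    by (simp add: Cmp_add_right Cmp_assoc s)
  then obtain c where c: "c \<in> mor T X (ShO T (-1) D)"
    "Cmp T X (ShO T (-1) D) X (\<ominus>\<^bsub>Mor T (ShO T (-1) D) X\<^esub> ShM T (-1) D (ShO T 1 X) w) c = ?e"
    using Tri_exact[OF Tri_rotate_back[OF t], of X ?e] by auto
  have "c = \<zero>\<^bsub>Mor T X (ShO T (-1) D)\<^esub>" using D0[of X] c(1) by simp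
  then have "?e = \<zero>\<^bsub>Mor T X X\<^esub>" using c(2) by simp
  then have "Cmp T X Y X s f = Idn T X" by (simp add: hom_diff_eq_zero)
  then show ?thesis using s by (auto simp: is_iso_def)
qed

text \<open>The map from the cone of \<open>f\<close> to \<open>X\<close> induced by \<open>s\<close> is bijective on \<open>Hom(\<Sigma>\<^sup>dG, -)\<close>, hence
  an isomorphism.\<close>

lemma short_exact_triangle:
  assumes [simp]: "X \<in> Ob T" "I \<in> Ob T" "E \<in> Ob T" "f \<in> mor T I E" "s \<in> mor T E X"
    and sf: "Cmp T I E X s f = \<zero>\<^bsub>Mor T I X\<^esub>"
    and inj: "gmono I E f" and ex: "gexact I E X f s" and surj: "gsurj E X s"
  shows "\<exists>w. (I, E, X, f, s, w) \<in> Tri T"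
proof -
  obtain C c d where t: "(I, E, C, f, c, d) \<in> Tri T" using TR1_cone by (metis assms(2-4))
  note [simp] = Tri_Ob[OF t]
  obtain g where [simp]: "g \<in> mor T C X" and g: "Cmp T E C X g c = s"
    using Tri_coexact[OF t, of X s] sf by auto
  have "gmono C X g"
    unfolding gmono_def
  proof (intro allI ballI impI)
    fix n z assume [simp]: "z \<in> mor T (ShO T n G) C"
        and 0: "Cmp T (ShO T n G) C X g z = \<zero>\<^bsub>Mor T (ShO T n G) X\<^esub>"
    obtain x where [simp]: "x \<in> mor T (ShO T n G) E" and x: "Cmp T (ShO T n G) E C c x = z"
      using gsurjD[OF cone_gsurj[OF t inj], of z n] by auto
    have "Cmp T (ShO T n G) E X s x = \<zero>\<^bsub>Mor T (ShO T n G) X\<^esub>"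
      using 0 by (simp add: Cmp_assoc g flip: x)
    then obtain y where [simp]: "y \<in> mor T (ShO T n G) I" and y: "Cmp T (ShO T n G) I E f y = x"
      using gexactD[OF ex] by (metis \<open>x \<in> mor T (ShO T n G) E\<close>)
    show "z = \<zero>\<^bsub>Mor T (ShO T n G) C\<^esub>" using Tri_comp_zero[OF t] by (simp add: Cmp_assoc flip: x y)
  qed
  moreover have "gsurj C X g"
    unfolding gsurj_def
  proof (intro allI ballI)
    fix n y assume "y \<in> mor T (ShO T n G) X"
    then obtain x where [simp]: "x \<in> mor T (ShO T n G) E" and x: "Cmp T (ShO T n G) E X s x = y"
      using gsurjD[OF surj] by blast
    show "\<exists>x \<in> mor T (ShO T n G) C. Cmp T (ShO T n G) C X g x = y"
      using x by (intro bexI[of _ "Cmp T (ShO T n G) E C c x"]) (simp_all add: Cmp_assoc g)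
  qed
  ultimately have iso: "is_iso T C X g" by (intro gbij_iso) simp_all
  then obtain h where [simp]: "h \<in> mor T X C" and h: "Cmp T C X C h g = Idn T C"
    by (auto simp: is_iso_def)
  have id: "is_iso T Y Y (Idn T Y)" if "Y \<in> Ob T" for Y using that by (auto simp: is_iso_def)
  have "(I, E, X, f, s, Cmp T X C (ShO T 1 I) d h) \<in> Tri T"
    by (rule TR1_iso[OF t _ _ _ _ _ _ id id iso]) (simp_all add: g h flip: Cmp_assoc)
  then show ?thesis by blast
qed

section \<open>Two-term resolutions\<close>

text \<open>\<open>F g\<close> need not be injective, so the relations may be redundant. Summands
  and cones are easily shown to have this form; \<open>presentable_resolution\<close> then removes
  the redundancy.\<close>

definition presentable :: "'o \<Rightarrow> bool" where
  "presentable X \<longleftrightarrow> X \<in> Ob T \<and> (\<exists>R \<in> projs. \<exists>E \<in> projs. \<exists>g \<in> mor T R E. \<exists>s \<in> mor T E X.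
     Cmp T R E X s g = \<zero>\<^bsub>Mor T R X\<^esub> \<and> gexact R E X g s \<and> gsurj E X s)"

text \<open>Exactness in the middle comes with the triangle, so only the two ends are
  recorded.\<close>

definition resolution :: "'o \<Rightarrow> 'o \<Rightarrow> 'o \<Rightarrow> 'm \<Rightarrow> 'm \<Rightarrow> 'm \<Rightarrow> bool" where
  "resolution I E X f s w \<longleftrightarrow> I \<in> projs \<and> E \<in> projs \<and> (I, E, X, f, s, w) \<in> Tri T \<and> gmono I E f
      \<and> gsurj E X s"

lemma gmono_part:
  assumes P: "P \<in> projs" and Q: "Q \<in> projs" and f [simp]: "f \<in> mor T P Q"
  obtains I i p where "I \<in> projs" "i \<in> mor T I P" "p \<in> mor T P I" "Cmp T I P I p i = Idn T I"
    "gmono I Q (Cmp T I P Q f i)" "Cmp T P I Q (Cmp T I P Q f i) p = f"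
proof -
  obtain I K i j p q where b: "is_biproduct T I K P i j p q"
    and m: "gmono I Q (Cmp T I P Q f i)" "Cmp T P I Q (Cmp T I P Q f i) p = f"
    using splitting[OF P Q f] by blast
  have "I \<in> projs" using b by (intro projs_retract[OF _ P, of I i p]) (auto simp: is_biproduct_def)
  then show ?thesis using that[of I i p] m b by (auto simp: is_biproduct_def)
qed

text \<open>Write \<open>g\<close> as a projection \<open>p\<close> onto a summand \<open>I\<close>
  followed by the injective \<open>g i\<close>. Under \<open>F\<close>, \<open>g\<close> and
  \<open>g i\<close> have the same image, so \<open>g i\<close> gives the same relations without
  redundancy, and \<open>short_exact_triangle\<close> applies.\<close>

lemma presentable_resolution:
  assumes "presentable X"
  shows "\<exists>I E f s w. resolution I E X f s w"
proof -
  obtain R E g s where R: "R \<in> projs" and E: "E \<in> projs" and [simp]: "g \<in> mor T R E" "s \<in> mor T E X"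
      "X \<in> Ob T"
    and sg: "Cmp T R E X s g = \<zero>\<^bsub>Mor T R X\<^esub>" and ex: "gexact R E X g s" and surj: "gsurj E X s"
    using assms unfolding presentable_def by blast
  note [simp] = projs_Ob[OF R] projs_Ob[OF E]
  obtain I i p where I: "I \<in> projs" and [simp]: "i \<in> mor T I R" "p \<in> mor T R I"
    and m: "gmono I E (Cmp T I R E g i)" "Cmp T R I E (Cmp T I R E g i) p = g"
    using gmono_part[OF R E] by (metis \<open>g \<in> mor T R E\<close>)
  note [simp] = projs_Ob[OF I]
  have "gexact I E X (Cmp T I R E g i) s"
    unfolding gexact_def
  proof (intro allI ballI impI)
    fix d y assume "y \<in> mor T (ShO T d G) E" "Cmp T (ShO T d G) E X s y = \<zero>\<^bsub>Mor T (ShO T d G) X\<^esub>"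
    then obtain x where [simp]: "x \<in> mor T (ShO T d G) R" and x: "Cmp T (ShO T d G) R E g x = y"
      by (rule gexactD[OF ex])
    show "\<exists>x \<in> mor T (ShO T d G) I. Cmp T (ShO T d G) I E (Cmp T I R E g i) x = y"
      using m x by (intro bexI[of _ "Cmp T (ShO T d G) R I p x"]) (simp_all add: Cmp_assoc)
  qed
  moreover have "Cmp T I E X s (Cmp T I R E g i) = \<zero>\<^bsub>Mor T I X\<^esub>" by (simp add: Cmp_assoc sg)
  ultimately obtain w where "(I, E, X, Cmp T I R E g i, s, w) \<in> Tri T"
    using short_exact_triangle[of X I E "Cmp T I R E g i" s] m surj by auto
  then show ?thesis using I E m surj unfolding resolution_def by blast
qed

text \<open>With \<open>K\<close> the summand of \<open>\<Sigma>Q1\<close> killed by \<open>\<Sigma>Q1 \<rightarrow> \<Sigma>Q0\<close>, the inclusion of \<open>K\<close> lifts to \<open>X\<close>, and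
  \<open>Q0 \<oplus> K \<rightarrow> X\<close> is surjective under \<open>F\<close> with the same relations as \<open>Q0\<close>.\<close>

lemma cone_presentable:
  assumes Q1: "Q1 \<in> projs" and Q0: "Q0 \<in> projs" and t: "(Q1, Q0, X, f, s, w) \<in> Tri T"
  shows "presentable X"
proof -
  note [simp] = Tri_Ob[OF t]
  let ?S1 = "ShO T 1 Q1" and ?S0 = "ShO T 1 Q0"
  let ?f = "\<ominus>\<^bsub>Mor T ?S1 ?S0\<^esub> ShM T 1 Q1 Q0 f"
  \<comment> \<open>Two rotations give the stretch \<open>X -> \<Sigma>Q1 -> \<Sigma>Q0\<close>. The
    part of \<open>F X\<close> not coming from \<open>Q0\<close> is mapped by \<open>w\<close> onto
    the kernel of the second map.\<close>
  have t2: "(X, ?S1, ?S0, w, ?f, \<ominus>\<^bsub>Mor T ?S0 (ShO T 1 X)\<^esub> ShM T 1 Q0 X s) \<in> Tri T"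
    by (intro Tri_rotate t)
  obtain I K i k p q where b: "is_biproduct T I K ?S1 i k p q"
    and m: "gmono I ?S0 (Cmp T I ?S1 ?S0 ?f i)" "Cmp T ?S1 I ?S0 (Cmp T I ?S1 ?S0 ?f i) p = ?f"
    using splitting[of ?S1 ?S0 ?f] Q1 Q0 by auto
  from b have [simp]: "I \<in> Ob T" "K \<in> Ob T" "i \<in> mor T I ?S1" "k \<in> mor T K ?S1" "p \<in> mor T ?S1 I"
      "q \<in> mor T ?S1 K"
    and b': "Cmp T K ?S1 I p k = \<zero>\<^bsub>Mor T K I\<^esub>" "Cmp T K ?S1 K q k = Idn T K"
    "Cmp T ?S1 I ?S1 i p \<oplus>\<^bsub>Mor T ?S1 ?S1\<^esub> Cmp T ?S1 K ?S1 k q = Idn T ?S1"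
    by (auto simp: is_biproduct_def)
  have K: "K \<in> projs" using Q1 b' by (intro projs_retract[of K ?S1 k q]) simp_all
  have fi: "Cmp T I ?S1 ?S0 ?f i \<in> mor T I ?S0" by simp
  have "Cmp T K ?S1 ?S0 ?f k = Cmp T K ?S1 ?S0 (Cmp T ?S1 I ?S0 (Cmp T I ?S1 ?S0 ?f i) p) k" using m
      by simp
  also have "\<dots> = Cmp T K I ?S0 (Cmp T I ?S1 ?S0 ?f i) (Cmp T K ?S1 I p k)"
    using fi by (subst Cmp_assoc) simp_all
  finally have fk: "Cmp T K ?S1 ?S0 ?f k = \<zero>\<^bsub>Mor T K ?S0\<^esub>" using fi
      by (simp add: b' del: Cmp_minus_left)
  \<comment> \<open>An element killed by \<open>\<Sigma>f\<close> has zero component in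
    \<open>I\<close>, where the map is injective, so it equals \<open>k q y\<close>.\<close>
  have kernel: "\<exists>x \<in> mor T (ShO T d G) K. Cmp T (ShO T d G) K ?S1 k x = y"
    if [simp]: "y \<in> mor T (ShO T d G) ?S1" and 0: "Cmp T (ShO T d G) ?S1 ?S0 ?f y
        = \<zero>\<^bsub>Mor T (ShO T d G) ?S0\<^esub>" for d y
  proof -
    have "Cmp T (ShO T d G) I ?S0 (Cmp T I ?S1 ?S0 ?f i) (Cmp T (ShO T d G) ?S1 I p y) =
       Cmp T (ShO T d G) ?S1 ?S0 (Cmp T ?S1 I ?S0 (Cmp T I ?S1 ?S0 ?f i) p) y"
      using fi by (subst Cmp_assoc) simp_all
    then have "Cmp T (ShO T d G) ?S1 I p y = \<zero>\<^bsub>Mor T (ShO T d G) I\<^esub>"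
      using 0 unfolding m(2) by (intro gmonoD[OF m(1)]) simp_all
    moreover have "y = Cmp T (ShO T d G) ?S1 ?S1 (Cmp T ?S1 I ?S1 i p
        \<oplus>\<^bsub>Mor T ?S1 ?S1\<^esub> Cmp T ?S1 K ?S1 k q) y"
      by (simp add: b')
    ultimately have "y = Cmp T (ShO T d G) K ?S1 k (Cmp T (ShO T d G) ?S1 K q y)"
      by (simp add: Cmp_add_left flip: Cmp_assoc)
    then show ?thesis by (intro bexI[of _ "Cmp T (ShO T d G) ?S1 K q y"]) simp_all
  qed
  obtain l where [simp]: "l \<in> mor T K X" and l: "Cmp T K X ?S1 w l = k"
    using Tri_exact[OF t2, of K k] fk by auto
  obtain E where "is_direct_sum T Q0 K E" using direct_sum[of Q0 K] by auto
  then obtain a c r u where bE: "is_biproduct T Q0 K E a c r u" by (auto simp: is_direct_sum_def)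
  then have [simp]: "E \<in> Ob T" "a \<in> mor T Q0 E" "c \<in> mor T K E" "r \<in> mor T E Q0" "u \<in> mor T E K"
    and bE': "Cmp T Q0 E Q0 r a = Idn T Q0" "Cmp T K E K u c = Idn T K"
     "Cmp T K E Q0 r c = \<zero>\<^bsub>Mor T K Q0\<^esub>" "Cmp T Q0 E K u a = \<zero>\<^bsub>Mor T Q0 K\<^esub>"
     "Cmp T E Q0 E a r \<oplus>\<^bsub>Mor T E E\<^esub> Cmp T E K E c u = Idn T E"
    by (auto simp: is_biproduct_def)
  have E: "E \<in> projs" by (rule projs_biproduct[OF bE Q0 K])
  define e where "e = Cmp T E Q0 X s r \<oplus>\<^bsub>Mor T E X\<^esub> Cmp T E K X l u"
  have [simp]: "e \<in> mor T E X" by (simp add: e_def)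
  have ea: "Cmp T Q0 E X e a = s"
    by (simp add: e_def Cmp_add_left bE' flip: Cmp_assoc)
  have ec: "Cmp T K E X e c = l"
    by (simp add: e_def Cmp_add_left bE' flip: Cmp_assoc)
  have ws: "Cmp T Q0 X ?S1 w s = \<zero>\<^bsub>Mor T Q0 ?S1\<^esub>" by (rule Tri_comp_zero'[OF t])
  have we: "Cmp T E X ?S1 w e = Cmp T E K ?S1 k u"
    by (simp add: e_def Cmp_add_right Cmp_assoc l ws)
  have "gsurj E X e"
    unfolding gsurj_def
  proof (intro allI ballI)
    fix d x assume [simp]: "x \<in> mor T (ShO T d G) X"
    let ?D = "ShO T d G"
    have "Cmp T ?D ?S1 ?S0 ?f (Cmp T ?D X ?S1 w x) = \<zero>\<^bsub>Mor T ?D ?S0\<^esub>"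
      using Tri_comp_zero[OF t2] by (simp add: Cmp_assoc del: Cmp_minus_left)
    then obtain y where [simp]: "y \<in> mor T ?D K" and y: "Cmp T ?D K ?S1 k y = Cmp T ?D X ?S1 w x"
      using kernel[of "Cmp T ?D X ?S1 w x" d] by auto
    \<comment> \<open>Subtracting \<open>l y\<close> removes the image under \<open>w\<close>, so
      the remainder comes from \<open>Q0\<close>.\<close>
    let ?x = "x \<oplus>\<^bsub>Mor T ?D X\<^esub> \<ominus>\<^bsub>Mor T ?D X\<^esub> Cmp T ?D K X l y"
    have "Cmp T ?D X ?S1 w ?x = \<zero>\<^bsub>Mor T ?D ?S1\<^esub>"
      by (simp add: Cmp_add_right Cmp_assoc l y)
    then obtain z where [simp]: "z \<in> mor T ?D Q0" and z: "Cmp T ?D Q0 X s z = ?x"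
      using Tri_exact[OF Tri_rotate[OF t], of ?D ?x] by auto
    have "Cmp T ?D E X e (Cmp T ?D Q0 E a z \<oplus>\<^bsub>Mor T ?D E\<^esub> Cmp T ?D K E c y) = x"
      by (simp add: Cmp_add_right Cmp_assoc ea ec z) (simp add: hom_assoc)
    then show "\<exists>x' \<in> mor T ?D E. Cmp T ?D E X e x' = x"
      by (intro bexI[of _ "Cmp T ?D Q0 E a z \<oplus>\<^bsub>Mor T ?D E\<^esub> Cmp T ?D K E c y"]) simp_all
  qed
  moreover have "gexact Q1 E X (Cmp T Q1 Q0 E a f) e"
    unfolding gexact_def
  proof (intro allI ballI impI)
    fix d z let ?D = "ShO T d G"
    assume [simp]: "z \<in> mor T ?D E" and 0: "Cmp T ?D E X e z = \<zero>\<^bsub>Mor T ?D X\<^esub>"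
    \<comment> \<open>Since \<open>w e = k u\<close> with \<open>k\<close> split by
      \<open>q\<close>, an element killed by \<open>e\<close> has no component in \<open>K\<close>;
      it is a relation on \<open>Q0\<close> alone.\<close>
    have "Cmp T ?D K ?S1 k (Cmp T ?D E K u z) = Cmp T ?D E ?S1 (Cmp T E X ?S1 w e) z"
      by (simp add: we Cmp_assoc)
    also have "\<dots> = \<zero>\<^bsub>Mor T ?D ?S1\<^esub>" using 0 by (simp flip: Cmp_assoc)
    finally have "Cmp T ?D ?S1 K q (Cmp T ?D K ?S1 k (Cmp T ?D E K u z)) = \<zero>\<^bsub>Mor T ?D K\<^esub>" by simp
    then have uz: "Cmp T ?D E K u z = \<zero>\<^bsub>Mor T ?D K\<^esub>" by (simp add: Cmp_assoc b')
    have "z = Cmp T ?D E E (Cmp T E Q0 E a r \<oplus>\<^bsub>Mor T E E\<^esub> Cmp T E K E c u) z" by (simp add: bE')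
    then have z: "Cmp T ?D Q0 E a (Cmp T ?D E Q0 r z) = z"
      by (simp add: Cmp_add_left uz flip: Cmp_assoc)
    have "Cmp T ?D Q0 X s (Cmp T ?D E Q0 r z) = Cmp T ?D E X e (Cmp T ?D Q0 E a (Cmp T ?D E Q0 r z))"
      by (simp add: ea Cmp_assoc)
    also have "\<dots> = \<zero>\<^bsub>Mor T ?D X\<^esub>" by (simp only: z 0)
    finally obtain y where [simp]: "y \<in> mor T ?D Q1" and y: "Cmp T ?D Q1 Q0 f y = Cmp T ?D E Q0 r z"
      using Tri_exact[OF t, of ?D "Cmp T ?D E Q0 r z"] by auto
    have "Cmp T ?D Q1 E (Cmp T Q1 Q0 E a f) y = z" using y z by (simp flip: Cmp_assoc)
    then show "\<exists>x \<in> mor T ?D Q1. Cmp T ?D Q1 E (Cmp T Q1 Q0 E a f) x = z" by auto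
  qed
  moreover have "Cmp T Q1 E X e (Cmp T Q1 Q0 E a f) = \<zero>\<^bsub>Mor T Q1 X\<^esub>"
    using Tri_comp_zero[OF t] by (simp add: Cmp_assoc ea)
  ultimately show ?thesis
    unfolding presentable_def using E Q1
    by (intro conjI bexI[of _ Q1] bexI[of _ E] bexI[of _ "Cmp T Q1 Q0 E a f"] bexI[of _ e]) simp_all
qed

text \<open>Octahedral axiom for \<open>Q0 \<rightarrow> X \<rightarrow> C\<close>: the cone \<open>Y\<close> of the composite is an extension of \<open>\<Sigma>P\<close> by
  \<open>\<Sigma>Q1\<close>, and it splits because \<open>P \<rightarrow> X\<close> factors through \<open>Q0\<close>.\<close>

lemma cone_of_proj:
  assumes P: "P \<in> projs" and t: "(P, X, C, a, v, c) \<in> Tri T" and X: "presentable X"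
  shows "presentable C"
proof -
  note [simp] = Tri_Ob[OF t]
  obtain Q1 Q0 f s w where "resolution Q1 Q0 X f s w" using presentable_resolution[OF X] by blast
  then have Q1: "Q1 \<in> projs" and Q0: "Q0 \<in> projs" and t': "(Q1, Q0, X, f, s, w) \<in> Tri T"
      and surj: "gsurj Q0 X s"
    by (auto simp: resolution_def)
  note [simp] = Tri_Ob[OF t']
  \<comment> \<open>This lift gives \<open>w a = w s a' = 0\<close>, which kills the connecting map
    of the octahedral triangle below.\<close>
  obtain a' where [simp]: "a' \<in> mor T P Q0" and a': "Cmp T P Q0 X s a' = a"
    using gsurjD_projs[OF P _ _ _ surj, of a] by auto
  have wa: "Cmp T P X (ShO T 1 Q1) w a = \<zero>\<^bsub>Mor T P (ShO T 1 Q1)\<^esub>"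
    using Tri_comp_zero'[OF t'] by (simp add: Cmp_assoc flip: a')
  obtain Y l l' where tY: "(Q0, C, Y, Cmp T Q0 X C v s, l, l') \<in> Tri T"
    using TR1_cone[of Q0 C "Cmp T Q0 X C v s"] by auto
  note [simp] = Tri_Ob[OF tY]
  obtain g h where tg: "(ShO T 1 Q1, Y, ShO T 1 P, g, h,
      Cmp T (ShO T 1 P) (ShO T 1 X) (ShO T 1 (ShO T 1 Q1)) (ShM T 1 X (ShO T 1 Q1) w)
       (\<ominus>\<^bsub>Mor T (ShO T 1 P) (ShO T 1 X)\<^esub> ShM T 1 P X a)) \<in> Tri T"
    using TR4[OF Tri_rotate[OF t'] Tri_rotate[OF t] tY] by blast
  have "Cmp T (ShO T 1 P) (ShO T 1 X) (ShO T 1 (ShO T 1 Q1)) (ShM T 1 X (ShO T 1 Q1) w)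
       (\<ominus>\<^bsub>Mor T (ShO T 1 P) (ShO T 1 X)\<^esub> ShM T 1 P X a)
     = \<ominus>\<^bsub>Mor T (ShO T 1 P) (ShO T 1 (ShO T 1 Q1))\<^esub> ShM T 1 P (ShO T 1 Q1) (Cmp T P X (ShO T 1 Q1) w a)"
    by (simp add: ShM_Cmp)
  then have "Cmp T (ShO T 1 P) (ShO T 1 X) (ShO T 1 (ShO T 1 Q1)) (ShM T 1 X (ShO T 1 Q1) w)
       (\<ominus>\<^bsub>Mor T (ShO T 1 P) (ShO T 1 X)\<^esub> ShM T 1 P X a) = \<zero>\<^bsub>Mor T (ShO T 1 P) (ShO T 1 (ShO T 1 Q1))\<^esub>"
    by (simp add: wa)
  then obtain \<sigma> r where \<sigma>: "\<sigma> \<in> mor T (ShO T 1 P) Y" "r \<in> mor T Y (ShO T 1 Q1)"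
    "Cmp T Y (ShO T 1 P) Y \<sigma> h \<oplus>\<^bsub>Mor T Y Y\<^esub> Cmp T Y (ShO T 1 Q1) Y g r = Idn T Y"
    using Tri_split tg by metis
  have "Y \<in> projs"
    by (rule projsI[of Y "ShO T 1 P" "ShO T 1 Q1" h \<sigma> r g]) (use P Q1 Tri_Ob[OF tg] \<sigma> in simp_all)
  \<comment> \<open>\<open>C\<close> is the cone of the map
    \<open>\<Sigma>\<^sup>-\<^sup>1Y -> Q0\<close> obtained by rotating the triangle of
    \<open>Y\<close> back.\<close>
  then show ?thesis
    by (intro cone_presentable[OF _ Q0 Tri_rotate_back[OF tY]]) simp
qed

text \<open>Octahedral axiom for \<open>Q0 -> W -> X\<close>: the cone \<open>Y\<close> of the
  composite is presentable by \<open>cone_of_proj\<close>, and \<open>C\<close> is the cone of a map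
  \<open>\<Sigma>Q1 -> Y\<close>, so \<open>cone_of_proj\<close> applies once more.\<close>

lemma cone_of_presentable:
  assumes W: "presentable W" and t: "(W, X, C, b, v, c) \<in> Tri T" and X: "presentable X"
  shows "presentable C"
proof -
  note [simp] = Tri_Ob[OF t]
  obtain Q1 Q0 f s w where "resolution Q1 Q0 W f s w" using presentable_resolution[OF W] by blast
  then have Q1: "Q1 \<in> projs" and Q0: "Q0 \<in> projs" and t': "(Q1, Q0, W, f, s, w) \<in> Tri T"
    by (auto simp: resolution_def)
  note [simp] = Tri_Ob[OF t']
  obtain Y l l' where tY: "(Q0, X, Y, Cmp T Q0 W X b s, l, l') \<in> Tri T"
    using TR1_cone[of Q0 X "Cmp T Q0 W X b s"] by auto
  have Y: "presentable Y" by (rule cone_of_proj[OF Q0 tY X])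
  obtain g h j where "(ShO T 1 Q1, Y, C, g, h, j) \<in> Tri T"
    using TR4[OF Tri_rotate[OF t'] t tY] by blast
  then show ?thesis by (rule cone_of_proj[OF projs_shift[OF Q1] _ Y])
qed

lemma presentable_shift:
  assumes X: "presentable X"
  shows "presentable (ShO T n X)"
proof -
  obtain R E g s where R: "R \<in> projs" and E: "E \<in> projs" and [simp]: "g \<in> mor T R E" "s \<in> mor T E X"
      "X \<in> Ob T"
    and sg: "Cmp T R E X s g = \<zero>\<^bsub>Mor T R X\<^esub>" and ex: "gexact R E X g s" and surj: "gsurj E X s"
    using assms unfolding presentable_def by blast
  note [simp] = projs_Ob[OF R] projs_Ob[OF E]
  have "Cmp T (ShO T n R) (ShO T n E) (ShO T n X) (ShM T n E X s) (ShM T n R E g)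
      = \<zero>\<^bsub>Mor T (ShO T n R) (ShO T n X)\<^esub>"
    by (simp add: sg flip: ShM_Cmp)
  then show ?thesis
    unfolding presentable_def using R E gexact_shift[OF _ _ _ _ _ ex, of n] gsurj_shift[OF _ _ _ surj,
        of n]
    by (intro conjI bexI[of _ "ShO T n R"] bexI[of _ "ShO T n E"] bexI[of _ "ShM T n R E g"] bexI[of _
        "ShM T n E X s"]) simp_all
qed

lemma presentable_G: "presentable G"
proof -
  have P: "G \<in> projs" using shift_G_projs[of 0] by simp
  have "gexact G G G \<zero>\<^bsub>Mor T G G\<^esub> (Idn T G)"
    unfolding gexact_def
  proof (intro allI ballI impI)
    fix d y assume "y \<in> mor T (ShO T d G) G" "Cmp T (ShO T d G) G G (Idn T G) y
        = \<zero>\<^bsub>Mor T (ShO T d G) G\<^esub>"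
    then show "\<exists>x \<in> mor T (ShO T d G) G. Cmp T (ShO T d G) G G \<zero>\<^bsub>Mor T G G\<^esub> x = y"
        by (intro bexI[of _ y]) simp_all
  qed
  moreover have "gsurj G G (Idn T G)" unfolding gsurj_def by auto
  moreover have "Cmp T G G G (Idn T G) \<zero>\<^bsub>Mor T G G\<^esub> = \<zero>\<^bsub>Mor T G G\<^esub>" by simp
  ultimately show ?thesis
    unfolding presentable_def using P G Idn_closed[OF G] hom_zero_closed[OF G G] by blast
qed

text \<open>A lift \<open>\<phi> : E \<rightarrow> E\<close> of the projection of \<open>S\<close> onto \<open>Y\<close> supplies the additional relations.\<close>

lemma presentable_summand:
  assumes XYS: "is_direct_sum T X Y S" and S: "presentable S"
  shows "presentable X"
proof -
  obtain i j p q where b: "is_biproduct T X Y S i j p q" using XYS by (auto simp: is_direct_sum_def)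
  then have [simp]: "X \<in> Ob T" "Y \<in> Ob T" "S \<in> Ob T" "i \<in> mor T X S" "j \<in> mor T Y S" "p \<in> mor T S X"
      "q \<in> mor T S Y"
    and b': "Cmp T X S X p i = Idn T X" "Cmp T Y S X p j = \<zero>\<^bsub>Mor T Y X\<^esub>"
      "Cmp T S X S i p \<oplus>\<^bsub>Mor T S S\<^esub> Cmp T S Y S j q = Idn T S"
    by (auto simp: is_biproduct_def)
  obtain R E g s where R: "R \<in> projs" and E: "E \<in> projs" and [simp]: "g \<in> mor T R E" "s \<in> mor T E S"
    and sg: "Cmp T R E S s g = \<zero>\<^bsub>Mor T R S\<^esub>" and ex: "gexact R E S g s" and surj: "gsurj E S s"
    using S unfolding presentable_def by blast
  note [simp] = projs_Ob[OF R] projs_Ob[OF E]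
  obtain \<phi> where [simp]: "\<phi> \<in> mor T E E" and \<phi>: "Cmp T E E S s \<phi> = Cmp T E S S (Cmp T S Y S j q) s"
    using gsurjD_projs[OF E _ _ _ surj, of "Cmp T E S S (Cmp T S Y S j q) s"] by auto
  obtain B where "is_direct_sum T R E B" using direct_sum[of R E] by auto
  then obtain a c r u where bB: "is_biproduct T R E B a c r u" by (auto simp: is_direct_sum_def)
  then have [simp]: "B \<in> Ob T" "a \<in> mor T R B" "c \<in> mor T E B" "r \<in> mor T B R" "u \<in> mor T B E"
    and bB': "Cmp T R B R r a = Idn T R" "Cmp T E B E u c = Idn T E"
     "Cmp T E B R r c = \<zero>\<^bsub>Mor T E R\<^esub>" "Cmp T R B E u a = \<zero>\<^bsub>Mor T R E\<^esub>"
    by (auto simp: is_biproduct_def)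
  have B: "B \<in> projs" by (rule projs_biproduct[OF bB R E])
  \<comment> \<open>The relations for \<open>X\<close>: those of \<open>S\<close> through
    \<open>g\<close>, and the image of \<open>\<phi>\<close>, which generates the part of
    \<open>S\<close> belonging to \<open>Y\<close>.\<close>
  define h where "h = Cmp T B R E g r \<oplus>\<^bsub>Mor T B E\<^esub> Cmp T B E E \<phi> u"
  have [simp]: "h \<in> mor T B E" by (simp add: h_def)
  have ha: "Cmp T R B E h a = g" by (simp add: h_def Cmp_add_left bB' flip: Cmp_assoc)
  have hc: "Cmp T E B E h c = \<phi>" by (simp add: h_def Cmp_add_left bB' flip: Cmp_assoc)
  let ?s = "Cmp T E S X p s"
  have "Cmp T B E X ?s h = \<zero>\<^bsub>Mor T B X\<^esub>"
  proof -
    have "Cmp T B E S s h = Cmp T B E S (Cmp T E S S (Cmp T S Y S j q) s) u"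
      by (simp add: h_def Cmp_add_right Cmp_assoc sg \<phi>)
    then have "Cmp T B S X p (Cmp T B E S s h) = Cmp T B S X (Cmp T S Y X (Cmp T Y S X p j) q)
        (Cmp T B E S s u)"
      by (simp add: Cmp_assoc)
    then show ?thesis by (simp add: Cmp_assoc b')
  qed
  moreover have "gsurj E X ?s"
    unfolding gsurj_def
  proof (intro allI ballI)
    fix d y let ?D = "ShO T d G"
    assume [simp]: "y \<in> mor T ?D X"
    obtain x where [simp]: "x \<in> mor T ?D E" and x: "Cmp T ?D E S s x = Cmp T ?D X S i y"
      using gsurjD[OF surj, of "Cmp T ?D X S i y" d] by auto
    have "Cmp T ?D E X ?s x = Cmp T ?D S X p (Cmp T ?D E S s x)" by (simp add: Cmp_assoc)
    also have "\<dots> = y" unfolding x by (simp add: Cmp_assoc b')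
    finally show "\<exists>x \<in> mor T ?D E. Cmp T ?D E X ?s x = y" by auto
  qed
  moreover have "gexact B E X h ?s"
    unfolding gexact_def
  proof (intro allI ballI impI)
    fix d z let ?D = "ShO T d G"
    assume [simp]: "z \<in> mor T ?D E" and 0: "Cmp T ?D E X ?s z = \<zero>\<^bsub>Mor T ?D X\<^esub>"
    have 1: "Cmp T ?D S S (Cmp T S X S i p) (Cmp T ?D E S s z) = \<zero>\<^bsub>Mor T ?D S\<^esub>"
    proof -
      have "Cmp T ?D S S (Cmp T S X S i p) (Cmp T ?D E S s z) = Cmp T ?D X S i (Cmp T ?D E X ?s z)"
        by (simp add: Cmp_assoc)
      then show ?thesis unfolding 0 by simp
    qed
    have "Cmp T ?D E S s z = Cmp T ?D S S (Cmp T S X S i p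
        \<oplus>\<^bsub>Mor T S S\<^esub> Cmp T S Y S j q) (Cmp T ?D E S s z)"
      by (simp add: b')
    also have "\<dots> = Cmp T ?D S S (Cmp T S Y S j q) (Cmp T ?D E S s z)"
      by (subst Cmp_add_left) (simp_all add: 1)
    also have "\<dots> = Cmp T ?D E S (Cmp T E S S (Cmp T S Y S j q) s) z" by (simp add: Cmp_assoc)
    also have "\<dots> = Cmp T ?D E S s (Cmp T ?D E E \<phi> z)" by (simp add: Cmp_assoc flip: \<phi>)
    finally have sz: "Cmp T ?D E S s z = Cmp T ?D E S s (Cmp T ?D E E \<phi> z)" .
    \<comment> \<open>\<open>z\<close> and \<open>\<phi> z\<close> agree in \<open>S\<close> because
      \<open>s z\<close> has no component in \<open>X\<close>; their difference is therefore a
      relation of \<open>S\<close>.\<close>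
    let ?z = "z \<oplus>\<^bsub>Mor T ?D E\<^esub> \<ominus>\<^bsub>Mor T ?D E\<^esub> Cmp T ?D E E \<phi> z"
    have "Cmp T ?D E S s ?z = \<zero>\<^bsub>Mor T ?D S\<^esub>" by (simp add: Cmp_add_right) (simp flip: sz)
    then obtain x where [simp]: "x \<in> mor T ?D R" and x: "Cmp T ?D R E g x = ?z"
      using gexactD[OF ex, of ?z d] by auto
    have "Cmp T ?D B E h (Cmp T ?D R B a x \<oplus>\<^bsub>Mor T ?D B\<^esub> Cmp T ?D E B c z) = z"
      by (simp add: Cmp_add_right Cmp_assoc ha hc x) (simp add: hom_assoc)
    then show "\<exists>x \<in> mor T ?D B. Cmp T ?D B E h x = z"
      by (intro bexI[of _ "Cmp T ?D R B a x \<oplus>\<^bsub>Mor T ?D B\<^esub> Cmp T ?D E B c z"]) simp_all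
  qed
  ultimately show ?thesis
    unfolding presentable_def using B E
    by (intro conjI bexI[of _ B] bexI[of _ E] bexI[of _ h] bexI[of _ ?s]) simp_all
qed

lemma all_presentable:
  assumes "X \<in> Ob T"
  shows "presentable X"
proof -
  have "X \<in> thick_closure T G" using assms generator by simp
  then show ?thesis
  proof (induct rule: thick_closure.induct)
    case (extension X Y Z u v w)
    \<comment> \<open>\<open>Y\<close> is the cone of
      \<open>\<Sigma>\<^sup>-\<^sup>1Z -> X\<close>.\<close>
    show ?case
      by (rule cone_of_presentable[OF presentable_shift[OF extension(5)] Tri_rotate_back[OF
          extension(1)] extension(3)])
  qed (auto intro: presentable_G presentable_shift presentable_summand)
qed

text \<open>A morphism invisible to \<open>Hom(\<Sigma>\<^sup>dG, -)\<close> factors through \<open>w : X \<rightarrow> \<Sigma>I\<close>, since it vanishes on \<open>E\<close>.\<close>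

lemma ghost_comp_zero:
  assumes [simp]: "X \<in> Ob T" "Y \<in> Ob T" "Z \<in> Ob T" "f \<in> mor T X Y" "g \<in> mor T Y Z"
    and f: "\<And>d x. x \<in> mor T (ShO T d G) X \<Longrightarrow> Cmp T (ShO T d G) X Y f x = \<zero>\<^bsub>Mor T (ShO T d G) Y\<^esub>"
    and g: "\<And>d x. x \<in> mor T (ShO T d G) Y \<Longrightarrow> Cmp T (ShO T d G) Y Z g x = \<zero>\<^bsub>Mor T (ShO T d G) Z\<^esub>"
  shows "Cmp T X Y Z g f = \<zero>\<^bsub>Mor T X Z\<^esub>"
proof -
  obtain I E i s w where "resolution I E X i s w"
    using presentable_resolution all_presentable by (metis assms(1))
  then have I: "I \<in> projs" and E: "E \<in> projs" and t: "(I, E, X, i, s, w) \<in> Tri T"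
    by (auto simp: resolution_def)
  note [simp] = Tri_Ob[OF t]
  have "Cmp T E X Y f s = \<zero>\<^bsub>Mor T E Y\<^esub>"
    by (rule projs_faithful[OF E]) (simp_all add: f flip: Cmp_assoc)
  then obtain h where [simp]: "h \<in> mor T (ShO T 1 I) Y" and h: "Cmp T X (ShO T 1 I) Y h w = f"
    using Tri_coexact[OF Tri_rotate[OF t], of Y f] by auto
  have "Cmp T (ShO T 1 I) Y Z g h = \<zero>\<^bsub>Mor T (ShO T 1 I) Z\<^esub>"
    by (rule projs_faithful[OF projs_shift[OF I]]) (simp_all add: g flip: Cmp_assoc)
  then show ?thesis by (simp add: Cmp_assoc flip: h)
qed

end

section \<open>Homomorphisms of graded modules\<close>

lemma ghom_zero:
  assumes M: "graded_module k A M" and N: "graded_module k A N" and f: "f \<in> ghom A M N"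
  shows "f p \<zero>\<^bsub>Gpart M p\<^esub> = \<zero>\<^bsub>Gpart N p\<^esub>"
proof -
  interpret M: module k "Gpart M p" by (rule graded_module.Gpart_module[OF M])
  interpret N: module k "Gpart N p" by (rule graded_module.Gpart_module[OF N])
  have "f p \<zero>\<^bsub>Gpart M p\<^esub> \<oplus>\<^bsub>Gpart N p\<^esub> f p \<zero>\<^bsub>Gpart M p\<^esub> = f p \<zero>\<^bsub>Gpart M p\<^esub>"
    using ghomD(2)[OF f, of "\<zero>\<^bsub>Gpart M p\<^esub>" p "\<zero>\<^bsub>Gpart M p\<^esub>"] by simp
  then show ?thesis using ghomD(1)[OF f, of "\<zero>\<^bsub>Gpart M p\<^esub>" p]
      by (metis M.zero_closed N.add.l_cancel_one')
qed

lemma ghom_diff: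
  assumes M: "graded_module k A M" and N: "graded_module k A N" and f: "f \<in> ghom A M N"
    and x: "x \<in> gcar M p" and y: "y \<in> gcar M p"
  shows "f p (x \<ominus>\<^bsub>Gpart M p\<^esub> y) = f p x \<ominus>\<^bsub>Gpart N p\<^esub> f p y"
proof -
  interpret M: module k "Gpart M p" by (rule graded_module.Gpart_module[OF M])
  interpret N: module k "Gpart N p" by (rule graded_module.Gpart_module[OF N])
  have "f p (\<ominus>\<^bsub>Gpart M p\<^esub> y) \<oplus>\<^bsub>Gpart N p\<^esub> f p y = \<zero>\<^bsub>Gpart N p\<^esub>"
    using ghomD(2)[OF f, of "\<ominus>\<^bsub>Gpart M p\<^esub> y" p y] y by (simp add: M.l_neg ghom_zero[OF M N f])
  then have "f p (\<ominus>\<^bsub>Gpart M p\<^esub> y) = \<ominus>\<^bsub>Gpart N p\<^esub> f p y"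
    using N.minus_equality y ghomD(1)[OF f, of _ p] M.a_inv_closed by metis
  then show ?thesis using ghomD(2)[OF f, of x p "\<ominus>\<^bsub>Gpart M p\<^esub> y"] x y by (simp add: a_minus_def)
qed

text \<open>The source is described by closure conditions so that free modules of lists can be
  sources.\<close>

lemma gcomp_ghom:
  assumes "f \<in> ghom A L M" "g \<in> ghom A M N"
    and L: "\<And>p x y. \<lbrakk>x \<in> gcar L p; y \<in> gcar L p\<rbrakk> \<Longrightarrow> x \<oplus>\<^bsub>Gpart L p\<^esub> y \<in> gcar L p"
    "\<And>p q x a. \<lbrakk>x \<in> gcar L p; a \<in> carrier (Apart A q)\<rbrakk> \<Longrightarrow> Gact L p q x a \<in> gcar L (p + q)"
  shows "(\<lambda>p. compose (gcar L p) (g p) (f p)) \<in> ghom A L N"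
  using ghomD[OF assms(1)] ghomD[OF assms(2)] L by (auto simp: ghom_def compose_def)

lemma ghom_inverse:
  assumes f: "f \<in> ghom A M N" and bij: "\<And>p. bij_betw (f p) (gcar M p) (gcar N p)"
    and M: "\<And>p x y. \<lbrakk>x \<in> gcar M p; y \<in> gcar M p\<rbrakk> \<Longrightarrow> x \<oplus>\<^bsub>Gpart M p\<^esub> y \<in> gcar M p"
    "\<And>p q x a. \<lbrakk>x \<in> gcar M p; a \<in> carrier (Apart A q)\<rbrakk> \<Longrightarrow> Gact M p q x a \<in> gcar M (p + q)"
  obtains g where "g \<in> ghom A N M" "\<And>p x. x \<in> gcar M p \<Longrightarrow> g p (f p x) = x"
      "\<And>p y. y \<in> gcar N p \<Longrightarrow> f p (g p y) = y"
proof
  define g where "g = (\<lambda>p. \<lambda>y \<in> gcar N p. inv_into (gcar M p) (f p) y)"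
  note sur = bij_betw_imp_surj_on[OF bij] and inj = bij_betw_imp_inj_on[OF bij]
  show gf: "g p (f p x) = x" if "x \<in> gcar M p" for p x
    using that ghomD(1)[OF f that] inv_into_f_f[OF inj that] by (simp add: g_def)
  show "f p (g p y) = y" if "y \<in> gcar N p" for p y
    using that f_inv_into_f[of y "f p" "gcar M p"] sur by (simp add: g_def)
  have ex: "\<exists>x \<in> gcar M p. y = f p x" if "y \<in> gcar N p" for p y using that sur by blast
  have "g p y \<in> gcar M p" if "y \<in> gcar N p" for p y using ex[OF that] gf by auto
  moreover have "g p (x \<oplus>\<^bsub>Gpart N p\<^esub> y) = g p x \<oplus>\<^bsub>Gpart M p\<^esub> g p y" if x: "x \<in> gcar N p"
      and y: "y \<in> gcar N p" for p x y
    using ex[OF x] ex[OF y] gf M(1) by (auto simp flip: ghomD(2)[OF f])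
  moreover have "g (p + q) (Gact N p q x a) = Gact M p q (g p x) a" if x: "x \<in> gcar N p"
      and a: "a \<in> carrier (Apart A q)" for p q x a
    using ex[OF x] gf M(2) a by (auto simp flip: ghomD(3)[OF f])
  moreover have "g p \<in> extensional (gcar N p)" for p by (simp add: g_def)
  ultimately show "g \<in> ghom A N M" by (auto simp: ghom_def PiE_iff)
qed

text \<open>Two preimages differ by an element of the kernel of \<open>f\<close>, on which
  \<open>g\<close> vanishes, so any choice of preimage defines \<open>h\<close>. Used in both
  directions, this identifies two quotients of one module by the same kernel.\<close>

lemma ghom_factor:
  assumes M: "graded_module k A M" and N: "graded_module k A N" and L: "graded_module k A L"
    and f: "f \<in> ghom A L M" and g: "g \<in> ghom A L N" and sur: "\<And>p. f p ` gcar L p = gcar M p"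
    and ker: "\<And>p x. x \<in> gcar L p \<Longrightarrow> f p x = \<zero>\<^bsub>Gpart M p\<^esub> \<Longrightarrow> g p x = \<zero>\<^bsub>Gpart N p\<^esub>"
  obtains h where "h \<in> ghom A M N" "\<And>p x. x \<in> gcar L p \<Longrightarrow> h p (f p x) = g p x"
proof
  interpret L: graded_module k A L by (rule L)
  define h where "h = (\<lambda>p. \<lambda>y \<in> gcar M p. g p (inv_into (gcar L p) (f p) y))"
  show hf: "h p (f p x) = g p x" if x: "x \<in> gcar L p" for p x
  proof -
    interpret Lp: module k "Gpart L p" by (rule L.Gpart_module)
    interpret Mp: module k "Gpart M p" by (rule graded_module.Gpart_module[OF M])
    interpret Np: module k "Gpart N p" by (rule graded_module.Gpart_module[OF N])
    let ?x = "inv_into (gcar L p) (f p) (f p x)"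
    have x': "?x \<in> gcar L p" "f p ?x = f p x" using x by (auto intro: inv_into_into f_inv_into_f)
    have "f p (?x \<ominus>\<^bsub>Gpart L p\<^esub> x) = \<zero>\<^bsub>Gpart M p\<^esub>"
      using ghom_diff[OF L M f x'(1) x] x' ghomD(1)[OF f x] by (simp add: a_minus_def Mp.r_neg)
    then have "g p ?x \<ominus>\<^bsub>Gpart N p\<^esub> g p x = \<zero>\<^bsub>Gpart N p\<^esub>"
      using ghom_diff[OF L N g x'(1) x] ker[of "?x \<ominus>\<^bsub>Gpart L p\<^esub> x" p] x x' by simp
    then have "g p ?x = g p x"
      using ghomD(1)[OF g x] ghomD(1)[OF g x'(1)] Np.minus_equality[of "g p ?x" "\<ominus>\<^bsub>Gpart N p\<^esub> g p x"]
      by (simp add: a_minus_def)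
    then show ?thesis using ghomD(1)[OF f x] by (simp add: h_def)
  qed
  have ex: "\<exists>x \<in> gcar L p. y = f p x" if "y \<in> gcar M p" for p y using that sur by blast
  have "h p y \<in> gcar N p" if "y \<in> gcar M p" for p y using ex[OF that] hf ghomD(1)[OF g] by auto
  moreover have "h p (x \<oplus>\<^bsub>Gpart M p\<^esub> y) = h p x \<oplus>\<^bsub>Gpart N p\<^esub> h p y" if x: "x \<in> gcar M p"
      and y: "y \<in> gcar M p" for p x y
    using ex[OF x] ex[OF y] hf module_facts(1)[OF L.Gpart_module] ghomD(2)[OF g]
        by (auto simp flip: ghomD(2)[OF f])
  moreover have "h (p + q) (Gact M p q x a) = Gact N p q (h p x) a" if x: "x \<in> gcar M p"
      and a: "a \<in> carrier (Apart A q)" for p q x a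
    using ex[OF x] hf L.Gact_closed a ghomD(3)[OF g] by (auto simp flip: ghomD(3)[OF f])
  moreover have "h p \<in> extensional (gcar M p)" for p by (simp add: h_def)
  ultimately show "h \<in> ghom A M N" by (auto simp: ghom_def PiE_iff)
qed

text \<open>Splitting off the first basis element matches splitting one shift of \<open>G\<close>
  off a direct sum.\<close>

lemma free_gmod_Cons:
  "gcar (free_gmod A (d # ds)) p = {a # as |a as. a \<in> carrier (Apart A (p - d)) \<and> as
      \<in> gcar (free_gmod A ds) p}"
  "(a # as) \<oplus>\<^bsub>Gpart (free_gmod A (d # ds)) p\<^esub> (b # bs) = (a \<oplus>\<^bsub>Apart A (p - d)\<^esub> b) # (as
      \<oplus>\<^bsub>Gpart (free_gmod A ds) p\<^esub> bs)"
  "Gact (free_gmod A (d # ds)) p q (a # as) c = Amult A (p - d) q a c # Gact (free_gmod A ds) p q as c"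
proof -
  have upt: "[0..<length (d # ds)] = 0 # map Suc [0..<length ds]"
    by (simp add: map_Suc_upt upt_conv_Cons del: upt_Suc)
  show "(a # as) \<oplus>\<^bsub>Gpart (free_gmod A (d # ds)) p\<^esub> (b # bs) = (a \<oplus>\<^bsub>Apart A (p - d)\<^esub> b) # (as
      \<oplus>\<^bsub>Gpart (free_gmod A ds) p\<^esub> bs)"
    "Gact (free_gmod A (d # ds)) p q (a # as) c = Amult A (p - d) q a c # Gact
        (free_gmod A ds) p q as c"
    unfolding free_gmod_def upt by simp_all
  show "gcar (free_gmod A (d # ds)) p = {a # as |a as. a \<in> carrier (Apart A (p - d)) \<and> as
      \<in> gcar (free_gmod A ds) p}"
    by (auto simp: free_gmod_def length_Suc_conv All_less_Suc2)
qed

section \<open>The functor on elements\<close>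

context triangulated_with_object
begin

abbreviation A where "A \<equiv> End_alg T G"
abbreviation F where "F \<equiv> F_ob T G"
abbreviation Fm where "Fm \<equiv> F_mor T G"

text \<open>The elements of \<open>F X\<close> of degree \<open>p\<close>, written as morphisms \<open>\<Sigma>\<^sup>-\<^sup>pG \<rightarrow> X\<close>; in this form \<open>F f\<close> is
  composition with \<open>f\<close>.\<close>

definition el :: "'o \<Rightarrow> int \<Rightarrow> 'm \<Rightarrow> 'm gelt" where
  "el X p x = Inl (ShM T p (ShO T (-p) G) X x)"

lemma A_graded [simp]: "graded_algebra k A"
  using End_alg_graded_algebra[OF G] .

lemma F_graded [simp]: "X \<in> Ob T \<Longrightarrow> graded_module k A (F X)"
  unfolding F_ob_def by (intro relabel_graded_module Hom_gmod_graded_module) simp_all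

lemma F_gcar_Inl: "gcar (F X) p = Inl ` mor T G (ShO T p X)"
  by (simp add: F_ob_def relabel_def Hom_gmod_def)

lemma F_add_Inl: "\<lbrakk>x \<in> mor T G (ShO T p X); y \<in> mor T G (ShO T p X)\<rbrakk>
    \<Longrightarrow> Inl x \<oplus>\<^bsub>Gpart (F X) p\<^esub> Inl y = Inl (x \<oplus>\<^bsub>Mor T G (ShO T p X)\<^esub> y)"
  by (simp add: F_ob_def relabel_def Hom_gmod_def)

lemma F_act_Inl: "x \<in> mor T G (ShO T p X)
    \<Longrightarrow> Gact (F X) p q (Inl x) a = Inl (Cmp T G (ShO T q G) (ShO T (p + q) X) (ShM T q G (ShO T p X) x)
        a)"
  by (simp add: F_ob_def relabel_def Hom_gmod_def)

lemma Fm_Inl: "x \<in> mor T G (ShO T p X) \<Longrightarrow> Fm X Y f p (Inl x)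
    = Inl (Cmp T G (ShO T p X) (ShO T p Y) (ShM T p X Y f) x)"
  by (simp add: F_mor_def F_gcar_Inl)

lemma F_gcar:
  assumes [simp]: "X \<in> Ob T" shows "gcar (F X) p = el X p ` mor T (ShO T (-p) G) X"
proof (intro equalityI subsetI)
  fix y assume "y \<in> gcar (F X) p"
  then obtain x where [simp]: "x \<in> mor T G (ShO T p X)" and y: "y = Inl x" by (auto simp: F_gcar_Inl)
  show "y \<in> el X p ` mor T (ShO T (-p) G) X"
    unfolding y by (intro image_eqI[of _ _ "ShM T (-p) G (ShO T p X) x"]) (simp_all add: el_def)
qed (auto simp: el_def F_gcar_Inl)

lemma el_closed [simp]: "\<lbrakk>X \<in> Ob T; x \<in> mor T (ShO T (-p) G) X\<rbrakk> \<Longrightarrow> el X p x \<in> gcar (F X) p"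
  by (simp add: F_gcar)

lemma elE:
  assumes "X \<in> Ob T" "y \<in> gcar (F X) p"
  obtains x where "x \<in> mor T (ShO T (-p) G) X" "y = el X p x"
  using assms by (auto simp: F_gcar)

lemma el_add: "\<lbrakk>X \<in> Ob T; x \<in> mor T (ShO T (-p) G) X; y \<in> mor T (ShO T (-p) G) X\<rbrakk>
    \<Longrightarrow> el X p x \<oplus>\<^bsub>Gpart (F X) p\<^esub> el X p y = el X p (x \<oplus>\<^bsub>Mor T (ShO T (-p) G) X\<^esub> y)"
  unfolding el_def by (subst F_add_Inl) (simp_all add: ShM_add)

lemma F_zero: "X \<in> Ob T \<Longrightarrow> \<zero>\<^bsub>Gpart (F X) p\<^esub> = el X p \<zero>\<^bsub>Mor T (ShO T (-p) G) X\<^esub>"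
  by (simp add: F_ob_def relabel_def Hom_gmod_def el_def)

lemma el_inj: "\<lbrakk>X \<in> Ob T; x \<in> mor T (ShO T (-p) G) X; y \<in> mor T (ShO T (-p) G) X\<rbrakk> \<Longrightarrow> el X p x
    = el X p y \<longleftrightarrow> x = y"
  using ShM_inj[of "ShO T (-p) G" X x y p] by (auto simp: el_def)

lemma Fm_el: "\<lbrakk>X \<in> Ob T; Y \<in> Ob T; f \<in> mor T X Y; x \<in> mor T (ShO T (-p) G) X\<rbrakk>
    \<Longrightarrow> Fm X Y f p (el X p x) = el Y p (Cmp T (ShO T (-p) G) X Y f x)"
  unfolding el_def by (subst Fm_Inl) (simp_all add: ShM_Cmp)

lemma Fm_ghom [simp]:
  assumes [simp]: "X \<in> Ob T" "Y \<in> Ob T" "f \<in> mor T X Y"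
  shows "Fm X Y f \<in> ghom A (F X) (F Y)"
proof -
  have "Fm X Y f p y \<in> gcar (F Y) p" if "y \<in> gcar (F X) p" for p y
    using elE[OF _ that] Fm_el[of X Y f] by (metis Cmp_closed G ShO_closed assms el_closed)
  moreover have "Fm X Y f p (y \<oplus>\<^bsub>Gpart (F X) p\<^esub> z) = Fm X Y f p y \<oplus>\<^bsub>Gpart (F Y) p\<^esub> Fm X Y f p z"
    if "y \<in> gcar (F X) p" "z \<in> gcar (F X) p" for p y z
    using that by (auto elim!: elE[rotated] simp: el_add Fm_el Cmp_add_right)
  moreover have "Fm X Y f (p + q) (Gact (F X) p q y a) = Gact (F Y) p q (Fm X Y f p y) a"
    if y: "y \<in> gcar (F X) p" and a: "a \<in> carrier (Apart A q)" for p q y a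
  proof -
    obtain x where [simp]: "x \<in> mor T G (ShO T p X)" and y: "y = Inl x" using y
        by (auto simp: F_gcar_Inl)
    have [simp]: "a \<in> mor T G (ShO T q G)" using a by (simp add: End_alg_def)
    show ?thesis
      by (simp add: y F_act_Inl Fm_Inl ShM_Cmp Cmp_assoc add.commute)
  qed
  moreover have "Fm X Y f p \<in> extensional (gcar (F X) p)" for p by (simp add: F_mor_def)
  ultimately show ?thesis by (auto simp: ghom_def PiE_iff)
qed

lemma gmono_iff:
  assumes [simp]: "X \<in> Ob T" "Y \<in> Ob T" "f \<in> mor T X Y"
  shows "gmono X Y f \<longleftrightarrow> (\<forall>p. \<forall>x \<in> gcar (F X) p. Fm X Y f p x = \<zero>\<^bsub>Gpart (F Y) p\<^esub> \<longrightarrow> x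
      = \<zero>\<^bsub>Gpart (F X) p\<^esub>)" (is "_ \<longleftrightarrow> ?R")
proof
  assume "gmono X Y f"
  then show ?R by (auto elim!: elE[rotated] simp: Fm_el F_zero el_inj gmono_def)
next
  assume R: ?R
  have "x = \<zero>\<^bsub>Mor T (ShO T d G) X\<^esub>"
    if [simp]: "x \<in> mor T (ShO T d G) X" and 0: "Cmp T (ShO T d G) X Y f x = \<zero>\<^bsub>Mor T (ShO T d G) Y\<^esub>"
        for d x
    using R[rule_format, of "el X (-d) x" "-d"] by (simp add: 0 Fm_el F_zero el_inj)
  then show "gmono X Y f" by (simp add: gmono_def)
qed

lemma gsurj_iff:
  assumes [simp]: "X \<in> Ob T" "Y \<in> Ob T" "f \<in> mor T X Y"
  shows "gsurj X Y f \<longleftrightarrow> (\<forall>p. Fm X Y f p ` gcar (F X) p = gcar (F Y) p)" (is "_ \<longleftrightarrow> ?R")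
proof
  assume s: "gsurj X Y f"
  have "y \<in> Fm X Y f p ` gcar (F X) p" if y: "y \<in> gcar (F Y) p" for p y
  proof -
    obtain z where z: "z \<in> mor T (ShO T (-p) G) Y" "y = el Y p z" using elE[OF _ y] by auto
    obtain x where "x \<in> mor T (ShO T (-p) G) X" "Cmp T (ShO T (-p) G) X Y f x = z"
        by (rule gsurjD[OF s z(1)])
    then show ?thesis using z by (intro image_eqI[of _ _ "el X p x"]) (auto simp: Fm_el)
  qed
  then show ?R using ghomD(1)[OF Fm_ghom[OF assms]] by blast
next
  assume R: ?R
  show "gsurj X Y f" unfolding gsurj_def
  proof (intro allI ballI)
    fix d y assume [simp]: "y \<in> mor T (ShO T d G) Y"
    have "el Y (-d) y \<in> Fm X Y f (-d) ` gcar (F X) (-d)" using R by simp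
    then show "\<exists>x\<in>mor T (ShO T d G) X. Cmp T (ShO T d G) X Y f x = y"
      by (auto elim!: elE[rotated] simp: Fm_el el_inj)
  qed
qed

lemma gexact_iff:
  assumes [simp]: "X \<in> Ob T" "Y \<in> Ob T" "Z \<in> Ob T" "f \<in> mor T X Y" "g \<in> mor T Y Z"
  shows "gexact X Y Z f g \<longleftrightarrow>
    (\<forall>p. \<forall>y \<in> gcar (F Y) p. Fm Y Z g p y = \<zero>\<^bsub>Gpart (F Z) p\<^esub> \<longrightarrow> y \<in> Fm X Y f p ` gcar (F X)
        p)" (is "_ \<longleftrightarrow> ?R")
proof
  assume s: "gexact X Y Z f g"
  show ?R
  proof (intro allI ballI impI)
    fix p y assume y: "y \<in> gcar (F Y) p" and 0: "Fm Y Z g p y = \<zero>\<^bsub>Gpart (F Z) p\<^esub>"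
    obtain z where z: "z \<in> mor T (ShO T (-p) G) Y" "y = el Y p z" using elE[OF _ y] by auto
    have "Cmp T (ShO T (-p) G) Y Z g z = \<zero>\<^bsub>Mor T (ShO T (-p) G) Z\<^esub>" using 0 z
        by (simp add: Fm_el F_zero el_inj)
    then obtain x where "x \<in> mor T (ShO T (-p) G) X" "Cmp T (ShO T (-p) G) X Y f x = z"
        by (rule gexactD[OF s z(1)])
    then show "y \<in> Fm X Y f p ` gcar (F X) p" using z by (intro image_eqI[of _ _ "el X p x"])
        (auto simp: Fm_el)
  qed
next
  assume R: ?R
  show "gexact X Y Z f g" unfolding gexact_def
  proof (intro allI ballI impI)
    fix d y assume [simp]: "y \<in> mor T (ShO T d G) Y"
        and 0: "Cmp T (ShO T d G) Y Z g y = \<zero>\<^bsub>Mor T (ShO T d G) Z\<^esub>"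
    have "el Y (-d) y \<in> Fm X Y f (-d) ` gcar (F X) (-d)"
      using R[rule_format, of "el Y (-d) y" "-d"] by (simp add: Fm_el 0 F_zero)
    then show "\<exists>x\<in>mor T (ShO T d G) X. Cmp T (ShO T d G) X Y f x = y"
      by (auto elim!: elE[rotated] simp: Fm_el el_inj)
  qed
qed

section \<open>The Yoneda lemma\<close>

text \<open>The identity of \<open>\<Sigma>\<^sup>dG\<close>, in degree \<open>-d\<close>, generates
  \<open>F (\<Sigma>\<^sup>dG)\<close>: an element of degree \<open>p\<close> is this generator
  acted on by an element of \<open>A\<close> of degree \<open>p + d\<close>.\<close>

lemma yoneda_unique:
  assumes f: "f \<in> ghom A (F (ShO T d G)) M" and g: "g \<in> ghom A (F (ShO T d G)) M"
    and eq: "f (-d) (el (ShO T d G) (-d) (Idn T (ShO T d G)))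
        = g (-d) (el (ShO T d G) (-d) (Idn T (ShO T d G)))"
  shows "f = g"
proof (rule ghom_eqI[OF f g])
  fix p x assume "x \<in> gcar (F (ShO T d G)) p"
  then obtain a where [simp]: "a \<in> mor T G (ShO T (p + d) G)" and x: "x = Inl a"
      by (auto simp: F_gcar_Inl)
  have a: "a \<in> carrier (Apart A (p + d))" by (simp add: End_alg_def)
  let ?u = "el (ShO T d G) (-d) (Idn T (ShO T d G))"
  have u: "?u = Inl (Idn T G)" by (simp add: el_def)
  have u': "?u \<in> gcar (F (ShO T d G)) (-d)" by simp
  have "x = Gact (F (ShO T d G)) (-d) (p + d) ?u a"
    unfolding u x by (subst F_act_Inl) simp_all
  then show "f p x = g p x" using ghomD(3)[OF f u' a] ghomD(3)[OF g u' a] eq by simp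
qed

text \<open>The map \<open>a \<mapsto> m a\<close>. Degree \<open>q\<close> of
  \<open>F (\<Sigma>\<^sup>dG)\<close> is degree \<open>q + d\<close> of \<open>A\<close>, and
  \<open>m\<close> has degree \<open>-d\<close>, so the product has degree \<open>q\<close>.\<close>

lemma yoneda:
  assumes M: "graded_module k A M" and m: "m \<in> gcar M (-d)"
  obtains f where "f \<in> ghom A (F (ShO T d G)) M" "f (-d) (el (ShO T d G) (-d) (Idn T (ShO T d G))) = m"
proof
  interpret graded_module k A M by (rule M)
  define f where "f = (\<lambda>q. \<lambda>x \<in> gcar (F (ShO T d G)) q. Gact M (-d) (q + d) m (projl x))"
  have car: "x \<in> mor T G (ShO T (q + d) G) \<longleftrightarrow> x \<in> carrier (Apart A (q + d))" for x q
      by (simp add: End_alg_def)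
  have f: "f q (Inl x) = Gact M (-d) (q + d) m x" if "x \<in> mor T G (ShO T (q + d) G)" for q x
    using that by (simp add: f_def F_gcar_Inl)
  have "f q y \<in> gcar M q" if "y \<in> gcar (F (ShO T d G)) q" for q y
    using that Gact_closed[OF m, of _ "q + d"] by (auto simp: f F_gcar_Inl car)
  moreover have "f q (y \<oplus>\<^bsub>Gpart (F (ShO T d G)) q\<^esub> z) = f q y \<oplus>\<^bsub>Gpart M q\<^esub> f q z"
    if yz: "y \<in> gcar (F (ShO T d G)) q" "z \<in> gcar (F (ShO T d G)) q" for q y z
  proof -
    obtain a b where [simp]: "a \<in> mor T G (ShO T (q + d) G)" "b \<in> mor T G (ShO T (q + d) G)"
        and y: "y = Inl a" "z = Inl b"
      using yz by (auto simp: F_gcar_Inl)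
    have "a \<oplus>\<^bsub>Mor T G (ShO T (q + d) G)\<^esub> b = a \<oplus>\<^bsub>Apart A (q + d)\<^esub> b" by (simp add: End_alg_def)
    moreover have ab: "a \<oplus>\<^bsub>Mor T G (ShO T (q + d) G)\<^esub> b \<in> mor T G (ShO T (q + d) G)" by simp
    ultimately show ?thesis using Gact_add_right[OF m, of a "q + d" b] f[OF ab]
      unfolding y by (subst F_add_Inl) (simp_all add: f flip: car)
  qed
  moreover have "f (p + q) (Gact (F (ShO T d G)) p q y a) = Gact M p q (f p y) a"
    if y: "y \<in> gcar (F (ShO T d G)) p" and a: "a \<in> carrier (Apart A q)" for p q y a
  proof -
    obtain b where b [simp]: "b \<in> mor T G (ShO T (p + d) G)" and y: "y = Inl b" using y
        by (auto simp: F_gcar_Inl)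
    have b2: "b \<in> mor T G (ShO T (d + p) G)" using b by (simp only: add.commute)
    have a' [simp]: "a \<in> mor T G (ShO T q G)" using a by (simp add: End_alg_def)
    have "Cmp T G (ShO T q G) (ShO T (p + d + q) G) (ShM T q G (ShO T (p + d) G) b) a
        = Amult A (p + d) q b a"
      by (simp add: End_alg_def)
    moreover have "Cmp T G (ShO T q G) (ShO T (p + q + d) G) (ShM T q G (ShO T (p + d) G) b) a
        \<in> mor T G (ShO T (p + q + d) G)"
      using ShM_closed[OF G ShO_closed[OF G] b, of q]
      by (intro Cmp_closed) (simp_all add: algebra_simps)
    ultimately show ?thesis
      using Gact_assoc[OF m b[unfolded car] a] f[OF b] b2
      unfolding y by (subst F_act_Inl) (simp_all add: f ac_simps)
  qed
  moreover have "f q \<in> extensional (gcar (F (ShO T d G)) q)" for q by (simp add: f_def)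
  ultimately show "f \<in> ghom A (F (ShO T d G)) M" by (auto simp: ghom_def PiE_iff)
  have "Gact M (-d) 0 m (Idn T G) = m" using Gact_one[OF m] by (simp add: End_alg_def)
  then show "f (-d) (el (ShO T d G) (-d) (Idn T (ShO T d G))) = m"
    using f[of "Idn T G" "-d"] by (simp add: el_def)
qed

end

section \<open>Morphisms of graded modules, elementwise\<close>

lemma grmod_simps:
  "mor (grmod k A) M N = ghom A M N"
  "Cmp (grmod k A) L M N g f = (\<lambda>p. compose (gcar L p) (g p) (f p))"
  "Ob (grmod k A) = {M. graded_module k A M \<and> finitely_presented A M}"
  "Idn (grmod k A) M = (\<lambda>p. \<lambda>x \<in> gcar M p. x)"
  "\<zero>\<^bsub>Mor (grmod k A) M N\<^esub> = (\<lambda>p. \<lambda>x \<in> gcar M p. \<zero>\<^bsub>Gpart N p\<^esub>)"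
  "f \<oplus>\<^bsub>Mor (grmod k A) M N\<^esub> g = (\<lambda>p. \<lambda>x \<in> gcar M p. f p x \<oplus>\<^bsub>Gpart N p\<^esub> g p x)"
  by (simp_all add: grmod_def)

lemma ghom_zero_closed:
  fixes A :: "('k, 'a) galg" and M N :: "('k, 'a gelt, 'a) gmod"
  assumes "graded_algebra k A" "graded_module k A M" "graded_module k A N"
  shows "(\<lambda>p. \<lambda>x \<in> gcar M p. \<zero>\<^bsub>Gpart N p\<^esub>) \<in> ghom A M N"
  using module_facts(2)[OF Mor_grmod_module[OF assms]] by (simp add: grmod_simps)

lemma ghom_add_closed:
  fixes A :: "('k, 'a) galg" and M N :: "('k, 'a gelt, 'a) gmod"
  assumes "graded_algebra k A" "graded_module k A M" "graded_module k A N" "f \<in> ghom A M N"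
      "g \<in> ghom A M N"
  shows "(\<lambda>p. \<lambda>x \<in> gcar M p. f p x \<oplus>\<^bsub>Gpart N p\<^esub> g p x) \<in> ghom A M N"
  using module_facts(1)[OF Mor_grmod_module[OF assms(1-3)]] assms(4,5) by (simp add: grmod_simps)

lemma graded_module_closed:
  assumes "graded_module k A M"
  shows "x \<in> gcar M p \<Longrightarrow> y \<in> gcar M p \<Longrightarrow> x \<oplus>\<^bsub>Gpart M p\<^esub> y \<in> gcar M p"
    and "x \<in> gcar M p \<Longrightarrow> a \<in> carrier (Apart A q) \<Longrightarrow> Gact M p q x a \<in> gcar M (p + q)"
  using module_facts(1)[OF graded_module.Gpart_module[OF assms]] graded_module.Gact_closed[OF assms]
      by auto

lemma ghom_comp:
  assumes "graded_module k A L" "f \<in> ghom A L M" "g \<in> ghom A M N"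
  shows "(\<lambda>p. compose (gcar L p) (g p) (f p)) \<in> ghom A L N"
  using assms graded_module_closed[OF assms(1)] by (intro gcomp_ghom) auto

lemma free_closed:
  assumes "graded_algebra k A"
  shows "x \<in> gcar (free_gmod A ds) p \<Longrightarrow> y \<in> gcar (free_gmod A ds) p \<Longrightarrow>
      x \<oplus>\<^bsub>Gpart (free_gmod A ds) p\<^esub> y \<in> gcar (free_gmod A ds) p"
    and "x \<in> gcar (free_gmod A ds) p \<Longrightarrow> a \<in> carrier (Apart A q) \<Longrightarrow>
      Gact (free_gmod A ds) p q x a \<in> gcar (free_gmod A ds) (p + q)"
  using free_gmod_closed[OF assms] by auto

context triangulated_with_object
begin

section \<open>Lifting through surjections\<close>

lemma F_add_closed [simp]:
  "\<lbrakk>X \<in> Ob T; x \<in> gcar (F X) p; y \<in> gcar (F X) p\<rbrakk> \<Longrightarrow> x \<oplus>\<^bsub>Gpart (F X) p\<^esub> y \<in> gcar (F X) p"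
  using graded_module_closed(1)[OF F_graded] by blast

lemma Fm_closed [simp]:
  "\<lbrakk>X \<in> Ob T; Y \<in> Ob T; f \<in> mor T X Y; x \<in> gcar (F X) p\<rbrakk> \<Longrightarrow> Fm X Y f p x \<in> gcar (F Y) p"
  using ghomD(1)[OF Fm_ghom] by blast

lemma F_zero_closed [simp]: "X \<in> Ob T \<Longrightarrow> \<zero>\<^bsub>Gpart (F X) p\<^esub> \<in> gcar (F X) p"
  by (simp add: F_zero)

lemma Fm_add_arg:
  "\<lbrakk>X \<in> Ob T; Y \<in> Ob T; f \<in> mor T X Y; x \<in> gcar (F X) p; y \<in> gcar (F X) p\<rbrakk>
    \<Longrightarrow> Fm X Y f p (x \<oplus>\<^bsub>Gpart (F X) p\<^esub> y) = Fm X Y f p x \<oplus>\<^bsub>Gpart (F Y) p\<^esub> Fm X Y f p y"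
  using ghomD(2)[OF Fm_ghom] by blast

lemma Fm_zero_arg [simp]:
  "\<lbrakk>X \<in> Ob T; Y \<in> Ob T; f \<in> mor T X Y\<rbrakk> \<Longrightarrow> Fm X Y f p \<zero>\<^bsub>Gpart (F X) p\<^esub> = \<zero>\<^bsub>Gpart (F Y) p\<^esub>"
  by (rule ghom_zero[OF F_graded F_graded Fm_ghom])

lemma Fm_Cmp_app:
  assumes "X \<in> Ob T" "Y \<in> Ob T" "Z \<in> Ob T" "f \<in> mor T X Y" "g \<in> mor T Y Z" "x \<in> gcar (F X) p"
  shows "Fm X Z (Cmp T X Y Z g f) p x = Fm Y Z g p (Fm X Y f p x)"
  using assms by (auto elim!: elE[rotated] simp: Fm_el Cmp_assoc)

lemma Fm_add_app:
  assumes "X \<in> Ob T" "Y \<in> Ob T" "f \<in> mor T X Y" "g \<in> mor T X Y" "x \<in> gcar (F X) p"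
  shows "Fm X Y (f \<oplus>\<^bsub>Mor T X Y\<^esub> g) p x = Fm X Y f p x \<oplus>\<^bsub>Gpart (F Y) p\<^esub> Fm X Y g p x"
  using assms by (auto elim!: elE[rotated] simp: Fm_el Cmp_add_left el_add)

lemma Fm_Idn_app: "\<lbrakk>X \<in> Ob T; x \<in> gcar (F X) p\<rbrakk> \<Longrightarrow> Fm X X (Idn T X) p x = x"
  by (auto elim!: elE[rotated] simp: Fm_el)

lemma Fm_zero_app: "\<lbrakk>X \<in> Ob T; Y \<in> Ob T; x \<in> gcar (F X) p\<rbrakk> \<Longrightarrow> Fm X Y \<zero>\<^bsub>Mor T X Y\<^esub> p x = \<zero>\<^bsub>Gpart (F Y) p\<^esub>"
  by (auto elim!: elE[rotated] simp: Fm_el F_zero)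

lemma Fm_faithful:
  assumes P: "P \<in> projs" and [simp]: "X \<in> Ob T" "f \<in> mor T P X" "g \<in> mor T P X"
    and eq: "\<And>p x. x \<in> gcar (F P) p \<Longrightarrow> Fm P X f p x = Fm P X g p x"
  shows "f = g"
proof -
  note [simp] = projs_Ob[OF P]
  have "f \<oplus>\<^bsub>Mor T P X\<^esub> \<ominus>\<^bsub>Mor T P X\<^esub> g = \<zero>\<^bsub>Mor T P X\<^esub>"
  proof (rule projs_faithful[OF P])
    fix d x assume [simp]: "x \<in> mor T (ShO T d G) P"
    have "Cmp T (ShO T d G) P X f x = Cmp T (ShO T d G) P X g x"
      using eq[of "el P (-d) x" "-d"] by (simp add: Fm_el el_inj)
    then show "Cmp T (ShO T d G) P X (f \<oplus>\<^bsub>Mor T P X\<^esub> \<ominus>\<^bsub>Mor T P X\<^esub> g) x = \<zero>\<^bsub>Mor T (ShO T d G) X\<^esub>"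
      by (simp add: Cmp_add_left)
  qed simp_all
  then show ?thesis by (simp add: hom_diff_eq_zero)
qed

text \<open>Projectivity of \<open>F P\<close> with respect to surjections on elements. By
  induction, \<open>h F(e)\<close> lifts for each \<open>e\<close> in \<open>addG P P\<close>: on a
  term through a shift of \<open>G\<close> it is enough, by Yoneda, to lift the image of the
  generator. Then \<open>e = 1\<close>.\<close>

lemma lift_through_surjection:
  fixes M :: "('k, 'm gelt, 'm) gmod" and N :: "('k, 'x, 'm) gmod"
  assumes P: "P \<in> projs" and M: "graded_module k A M" and N: "graded_module k A N"
    and \<psi>: "\<psi> \<in> ghom A M N" and sur: "\<And>p. \<psi> p ` gcar M p = gcar N p" and h: "h \<in> ghom A (F P) N"
  obtains h' where "h' \<in> ghom A (F P) M" "\<And>p x. x \<in> gcar (F P) p \<Longrightarrow> \<psi> p (h' p x) = h p x"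
proof -
  note [simp] = projs_Ob[OF P]
  have FP: "graded_module k A (F P)" by simp
  have "\<exists>h' \<in> ghom A (F P) M. \<forall>p. \<forall>x \<in> gcar (F P) p. \<psi> p (h' p x) = h p (Fm P P e p x)"
      if "e \<in> addG P P" for e
    using that
  proof induct
    case zero
    show ?case
      by (rule bexI[OF _ ghom_zero_closed[OF A_graded FP M]])
        (simp add: Fm_zero_app ghom_zero[OF FP N h] ghom_zero[OF M N \<psi>])
  next
    case (step a d b e)
    note [simp] = step(1,2) addG_closed[OF _ _ step(3)]
    obtain h0 where h0: "h0 \<in> ghom A (F P) M" and e0: "\<And>p x. x \<in> gcar (F P) p \<Longrightarrow> \<psi> p (h0 p x)
        = h p (Fm P P e p x)"
      using step(4) by blast
    let ?D = "ShO T d G"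
    let ?u = "el ?D (-d) (Idn T ?D)"
    have hb: "(\<lambda>p. compose (gcar (F ?D) p) (h p) (Fm ?D P b p)) \<in> ghom A (F ?D) N" (is "?hb \<in> _")
      by (rule ghom_comp[OF F_graded _ h]) simp_all
    have "?hb (-d) ?u \<in> gcar N (-d)" by (rule ghomD(1)[OF hb]) simp
    then have "?hb (-d) ?u \<in> \<psi> (-d) ` gcar M (-d)" unfolding sur .
    then obtain m where m: "m \<in> gcar M (-d)" "\<psi> (-d) m = ?hb (-d) ?u" by (elim imageE) metis
    obtain y where y: "y \<in> ghom A (F ?D) M" "y (-d) ?u = m" using yoneda[OF M m(1)] by blast
    have \<psi>y: "(\<lambda>p. compose (gcar (F ?D) p) (\<psi> p) (y p)) \<in> ghom A (F ?D) N" (is "?\<psi>y \<in> _")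
      by (rule ghom_comp[OF F_graded y(1) \<psi>]) simp_all
    have "?\<psi>y (-d) ?u = \<psi> (-d) (y (-d) ?u)" by (simp add: compose_def)
    also have "\<dots> = ?hb (-d) ?u" unfolding y(2) by (rule m(2))
    finally have "?\<psi>y = ?hb" by (rule yoneda_unique[OF \<psi>y hb])
    then have \<psi>y': "\<psi> p (y p x) = h p (Fm ?D P b p x)" if "x \<in> gcar (F ?D) p" for p x
      using that fun_cong[OF fun_cong[of ?\<psi>y ?hb p], of x] by (simp add: compose_def)
    have h1: "(\<lambda>p. compose (gcar (F P) p) (y p) (Fm P ?D a p)) \<in> ghom A (F P) M" (is "?h1 \<in> _")
      by (rule ghom_comp[OF F_graded _ y(1)]) simp_all
    show ?case
    proof (rule bexI[OF _ ghom_add_closed[OF A_graded FP M h1 h0]], intro allI ballI)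
      fix p x assume x: "x \<in> gcar (F P) p"
      have "\<psi> p (?h1 p x \<oplus>\<^bsub>Gpart M p\<^esub> h0 p x) = \<psi> p (?h1 p x) \<oplus>\<^bsub>Gpart N p\<^esub> \<psi> p (h0 p x)"
        by (rule ghomD(2)[OF \<psi> ghomD(1)[OF h1 x] ghomD(1)[OF h0 x]])
      also have "\<dots> = h p (Fm ?D P b p (Fm P ?D a p x)) \<oplus>\<^bsub>Gpart N p\<^esub> h p (Fm P P e p x)"
        using x by (simp add: compose_def \<psi>y' e0)
      also have "\<dots> = h p (Fm P P (Cmp T P ?D P b a \<oplus>\<^bsub>Mor T P P\<^esub> e) p x)"
        using x by (simp add: Fm_add_app Fm_Cmp_app ghomD(2)[OF h])
      finally show "\<psi> p ((\<lambda>x\<in>gcar (F P) p. ?h1 p x \<oplus>\<^bsub>Gpart M p\<^esub> h0 p x) x)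
          = h p (Fm P P (Cmp T P ?D P b a \<oplus>\<^bsub>Mor T P P\<^esub> e) p x)"
        using x by simp
    qed
  qed
  from this[OF projs_Idn[OF P]] show ?thesis using that by (auto simp: Fm_Idn_app)
qed

text \<open>The same induction over \<open>addG P P\<close>, with elements of \<open>F X\<close> of
  degree \<open>-d\<close> read as morphisms from \<open>\<Sigma>\<^sup>dG\<close>, yields morphisms
  that realize \<open>h F(e)\<close>.\<close>

lemma Fm_full_projs:
  assumes P: "P \<in> projs" and [simp]: "X \<in> Ob T" and h: "h \<in> ghom A (F P) (F X)"
  obtains f where "f \<in> mor T P X" "Fm P X f = h"
proof -
  note [simp] = projs_Ob[OF P]
  have "\<exists>f \<in> mor T P X. \<forall>p. \<forall>x \<in> gcar (F P) p. Fm P X f p x = h p (Fm P P e p x)" if "e \<in> addG P P"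
      for e
    using that
  proof induct
    case zero
    show ?case
      by (rule bexI[of _ "\<zero>\<^bsub>Mor T P X\<^esub>"]) (simp_all add: Fm_zero_app ghom_zero[OF F_graded F_graded h])
  next
    case (step a d b e)
    note [simp] = step(1,2) addG_closed[OF _ _ step(3)]
    obtain f0 where [simp]: "f0 \<in> mor T P X" and e0: "\<And>p x. x \<in> gcar (F P) p \<Longrightarrow> Fm P X f0 p x
        = h p (Fm P P e p x)"
      using step(4) by blast
    let ?D = "ShO T d G"
    let ?u = "el ?D (-d) (Idn T ?D)"
    have hb: "(\<lambda>p. compose (gcar (F ?D) p) (h p) (Fm ?D P b p)) \<in> ghom A (F ?D) (F X)" (is "?hb \<in> _")
      by (rule ghom_comp[OF F_graded _ h]) simp_all
    have "?hb (-d) ?u \<in> gcar (F X) (-d)" by (rule ghomD(1)[OF hb]) simp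
    then obtain y where [simp]: "y \<in> mor T ?D X" and y: "el X (-d) y = ?hb (-d) ?u"
      by (auto elim!: elE[rotated])
    have "Fm ?D X y (-d) ?u = ?hb (-d) ?u" unfolding y[symmetric] by (simp add: Fm_el)
    then have "Fm ?D X y = ?hb" by (intro yoneda_unique[OF _ hb]) simp_all
    then have y': "Fm ?D X y p x = h p (Fm ?D P b p x)" if "x \<in> gcar (F ?D) p" for p x
      using that by (simp add: compose_def)
    show ?case
      by (rule bexI[of _ "Cmp T P ?D X y a \<oplus>\<^bsub>Mor T P X\<^esub> f0"])
        (simp_all add: Fm_add_app Fm_Cmp_app ghomD(2)[OF h] y' e0)
  qed
  from this[OF projs_Idn[OF P]] obtain f where f: "f \<in> mor T P X"
    "\<And>p x. x \<in> gcar (F P) p \<Longrightarrow> Fm P X f p x = h p x"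
    by (auto simp: Fm_Idn_app)
  then have "Fm P X f = h" by (intro ghom_eqI[OF Fm_ghom h]) simp_all
  then show ?thesis using that f by blast
qed

section \<open>Finitely presented modules\<close>

text \<open>The bridge between free modules of lists and objects of \<open>T\<close>. A basis
  element of degree \<open>d\<close> corresponds to a summand
  \<open>\<Sigma>\<^sup>-\<^sup>dG\<close>, whose image under \<open>F\<close> has in degree
  \<open>p\<close> the component of \<open>A\<close> of degree \<open>p - d\<close>.\<close>

definition realizes :: "int list \<Rightarrow> 'o \<Rightarrow> bool" where
  "realizes ds S \<longleftrightarrow> S \<in> projs \<and>
     (\<exists>\<theta> \<in> ghom A (F S) (free_gmod A ds). \<forall>p. bij_betw (\<theta> p) (gcar (F S) p) (gcar (free_gmod A ds) p))"

lemma realizes_Nil: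
  assumes N: "is_zero_object T N"
  shows "realizes [] N"
proof -
  note [simp] = zero_object_Ob[OF N]
  have car: "gcar (F N) p = {Inl \<zero>\<^bsub>Mor T G (ShO T p N)\<^esub>}" for p
    using zero_object_shift[OF N, of p] by (simp add: F_gcar_Inl is_zero_object_def)
  have free: "gcar (free_gmod A []) p = {[]}" "a \<oplus>\<^bsub>Gpart (free_gmod A []) p\<^esub> b = []"
      "Gact (free_gmod A []) p q a c = []" for p q a b c
    by (auto simp: free_gmod_def)
  have "(\<lambda>p. \<lambda>x \<in> gcar (F N) p. []) \<in> ghom A (F N) (free_gmod A [])"
    using graded_module_closed[OF F_graded, of N] by (auto simp: ghom_def free)
  moreover have "bij_betw (\<lambda>x \<in> gcar (F N) p. []) (gcar (F N) p) (gcar (free_gmod A []) p)" for p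
    by (simp add: car free bij_betw_def)
  ultimately show ?thesis unfolding realizes_def using zero_projs[OF N]
    by (intro conjI bexI[of _ "\<lambda>p. \<lambda>x \<in> gcar (F N) p. []"]) auto
qed

lemma realizes_Cons:
  assumes S': "realizes ds S'" and b: "is_biproduct T (ShO T (-d) G) S' S i j r s"
  shows "realizes (d # ds) S"
proof -
  let ?D = "ShO T (-d) G"
  obtain \<theta> where \<theta>: "\<theta> \<in> ghom A (F S') (free_gmod A ds)"
    and bij: "\<And>p. bij_betw (\<theta> p) (gcar (F S') p) (gcar (free_gmod A ds) p)"
    using S' by (auto simp: realizes_def)
  have [simp]: "S' \<in> Ob T" "S \<in> Ob T" "i \<in> mor T ?D S" "j \<in> mor T S' S" "r \<in> mor T S ?D"
      "s \<in> mor T S S'"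
    and b': "Cmp T ?D S ?D r i = Idn T ?D" "Cmp T S' S S' s j = Idn T S'"
        "Cmp T S' S ?D r j = \<zero>\<^bsub>Mor T S' ?D\<^esub>"
      "Cmp T ?D S S' s i = \<zero>\<^bsub>Mor T ?D S'\<^esub>" "Cmp T S ?D S i r \<oplus>\<^bsub>Mor T S S\<^esub> Cmp T S S' S j s = Idn T S"
    using b by (auto simp: is_biproduct_def)
  have FD: "gcar (F ?D) p = Inl ` carrier (Apart A (p - d))" for p
    by (simp add: F_gcar_Inl End_alg_def)
  have FD_add: "projl (x \<oplus>\<^bsub>Gpart (F ?D) p\<^esub> y) = projl x \<oplus>\<^bsub>Apart A (p - d)\<^esub> projl y"
    if "x \<in> gcar (F ?D) p" "y \<in> gcar (F ?D) p" for p x y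
    using that by (auto simp: F_gcar_Inl F_add_Inl End_alg_def)
  have FD_act: "projl (Gact (F ?D) p q x a) = Amult A (p - d) q (projl x) a"
    if "x \<in> gcar (F ?D) p" for p q x a
    using that by (auto simp: F_gcar_Inl F_act_Inl End_alg_def algebra_simps)
  have FD_car: "projl x \<in> carrier (Apart A (p - d))" if "x \<in> gcar (F ?D) p" for p x
    using that by (auto simp: FD)
  note act_closed = graded_module_closed(2)[OF F_graded]
  \<comment> \<open>The new coordinate is the component along \<open>r\<close>, with the tag
    \<open>Inl\<close> of elements of \<open>F\<close> removed.\<close>
  define \<eta> where "\<eta> = (\<lambda>p. \<lambda>x \<in> gcar (F S) p. projl (Fm S ?D r p x) # \<theta> p (Fm S S' s p x))"
  have rec: "x = Fm ?D S i p (Fm S ?D r p x) \<oplus>\<^bsub>Gpart (F S) p\<^esub> Fm S' S j p (Fm S S' s p x)"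
      if "x \<in> gcar (F S) p" for x p
  proof -
    have "x = Fm S S (Cmp T S ?D S i r \<oplus>\<^bsub>Mor T S S\<^esub> Cmp T S S' S j s) p x" using that
        by (simp add: b' Fm_Idn_app)
    then show ?thesis using that by (simp add: Fm_add_app Fm_Cmp_app)
  qed
  have "\<eta> \<in> ghom A (F S) (free_gmod A (d # ds))"
    using act_closed[of S] ghomD(1,2,3)[OF \<theta>] ghomD(3)[OF Fm_ghom]
    by (auto simp: ghom_def \<eta>_def free_gmod_Cons FD_car FD_add FD_act Fm_add_arg)
  moreover have "bij_betw (\<eta> p) (gcar (F S) p) (gcar (free_gmod A (d # ds)) p)" for p
    unfolding bij_betw_def
  proof
    show "inj_on (\<eta> p) (gcar (F S) p)"
    proof (rule inj_onI)
      fix x y assume x: "x \<in> gcar (F S) p" and y: "y \<in> gcar (F S) p" and e: "\<eta> p x = \<eta> p y"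
      have "Fm S S' s p x = Fm S S' s p y"
        using e x y inj_onD[OF bij_betw_imp_inj_on[OF bij[of p]]] by (auto simp: \<eta>_def)
      moreover have "Fm S ?D r p x = Fm S ?D r p y"
        using e x y Fm_closed[of S ?D r x p] Fm_closed[of S ?D r y p] by (auto simp: \<eta>_def FD)
      ultimately show "x = y" using rec[OF x] rec[OF y] by simp
    qed
    show "\<eta> p ` gcar (F S) p = gcar (free_gmod A (d # ds)) p"
    proof (intro equalityI subsetI)
      fix y assume "y \<in> gcar (free_gmod A (d # ds)) p"
      then obtain a as where y: "y = a # as" and a: "a \<in> carrier (Apart A (p - d))"
          and as: "as \<in> gcar (free_gmod A ds) p"
        by (auto simp: free_gmod_Cons)
      have a': "Inl a \<in> gcar (F ?D) p" using a by (simp add: FD)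
      obtain z where z: "z \<in> gcar (F S') p" "\<theta> p z = as" using as
          unfolding bij_betw_imp_surj_on[OF bij[of p], symmetric] by auto
      let ?x = "Fm ?D S i p (Inl a) \<oplus>\<^bsub>Gpart (F S) p\<^esub> Fm S' S j p z"
      have D: "Inl a \<oplus>\<^bsub>Gpart (F ?D) p\<^esub> \<zero>\<^bsub>Gpart (F ?D) p\<^esub> = Inl a"
          "\<zero>\<^bsub>Gpart (F S') p\<^esub> \<oplus>\<^bsub>Gpart (F S') p\<^esub> z = z"
        using module_facts(2,5,6)[OF graded_module.Gpart_module[OF F_graded[OF ShO_closed[OF G]]]]
          module_facts(5)[OF graded_module.Gpart_module[OF F_graded[OF \<open>S' \<in> Ob T\<close>]]] a' z by metis+
      have "Fm S ?D r p ?x = Inl a"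
        using a' z D by (simp add: Fm_add_arg b' Fm_zero_app Fm_Idn_app flip: Fm_Cmp_app)
      moreover have "Fm S S' s p ?x = z"
        using a' z D by (simp add: Fm_add_arg b' Fm_zero_app Fm_Idn_app flip: Fm_Cmp_app)
      ultimately show "y \<in> \<eta> p ` gcar (F S) p"
        using a' z y by (intro image_eqI[of _ _ ?x]) (simp_all add: \<eta>_def)
    next
      fix y assume "y \<in> \<eta> p ` gcar (F S) p"
      then show "y \<in> gcar (free_gmod A (d # ds)) p" using ghomD(1)[OF \<open>\<eta> \<in> _\<close>] by auto
    qed
  qed
  moreover have "S \<in> projs" using S' by (intro projs_biproduct[OF b]) (simp_all add: realizes_def)
  ultimately show ?thesis unfolding realizes_def by blast
qed

lemma realizes_exists: "\<exists>S. realizes ds S"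
proof (induct ds)
  case Nil
  then show ?case using zero_object realizes_Nil by blast
next
  case (Cons d ds)
  then obtain S' where S': "realizes ds S'" by blast
  then obtain S i j p q where "is_biproduct T (ShO T (-d) G) S' S i j p q"
    using direct_sum[of "ShO T (-d) G" S'] by (auto simp: realizes_def is_direct_sum_def)
  then show ?case using realizes_Cons[OF S'] by blast
qed

text \<open>The factorizations that make up an element of \<open>addG\<close> are combined into one,
  through a single sum of shifts. For \<open>e = 1\<close> this makes each object of
  \<open>projs\<close> a retract of such a sum.\<close>

lemma addG_realizes:
  assumes [simp]: "X \<in> Ob T" "Y \<in> Ob T" and "e \<in> addG X Y"
  shows "\<exists>ds S. realizes ds S \<and> (\<exists>a \<in> mor T X S. \<exists>b \<in> mor T S Y. Cmp T X S Y b a = e)"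
  using assms(3)
proof induct
  case zero
  obtain N where N: "is_zero_object T N" using zero_object by blast
  note [simp] = zero_object_Ob[OF N]
  show ?case using realizes_Nil[OF N]
    by (intro exI[of _ "[]"] exI[of _ N] conjI bexI[of _ "\<zero>\<^bsub>Mor T X N\<^esub>"] bexI[of _ "\<zero>\<^bsub>Mor T N Y\<^esub>"])
        simp_all
next
  case (step a d b e)
  then obtain ds S' a' b' where S': "realizes ds S'" and [simp]: "a' \<in> mor T X S'" "b' \<in> mor T S' Y"
    and e: "Cmp T X S' Y b' a' = e" by blast
  have [simp]: "S' \<in> Ob T" using S' by (simp add: realizes_def)
  let ?D = "ShO T d G"
  note [simp] = step(1,2)
  obtain S i j r s where bS: "is_biproduct T ?D S' S i j r s"
    using direct_sum[of ?D S'] by (auto simp: is_direct_sum_def)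
  have [simp]: "S \<in> Ob T" "i \<in> mor T ?D S" "j \<in> mor T S' S" "r \<in> mor T S ?D" "s \<in> mor T S S'"
    and bp: "Cmp T ?D S ?D r i = Idn T ?D" "Cmp T S' S S' s j = Idn T S'"
        "Cmp T S' S ?D r j = \<zero>\<^bsub>Mor T S' ?D\<^esub>"
      "Cmp T ?D S S' s i = \<zero>\<^bsub>Mor T ?D S'\<^esub>"
    using bS by (auto simp: is_biproduct_def)
  let ?a = "Cmp T X ?D S i a \<oplus>\<^bsub>Mor T X S\<^esub> Cmp T X S' S j a'"
  let ?b = "Cmp T S ?D Y b r \<oplus>\<^bsub>Mor T S Y\<^esub> Cmp T S S' Y b' s"
  have bi: "Cmp T ?D S Y ?b i = b" "Cmp T S' S Y ?b j = b'"
    using bp by (simp_all add: Cmp_add_left flip: Cmp_assoc)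
  have "Cmp T X S Y ?b ?a = Cmp T X ?D Y b a \<oplus>\<^bsub>Mor T X Y\<^esub> e"
    using bi by (subst Cmp_add_right) (simp_all add: Cmp_assoc e)
  \<comment> \<open>The summand \<open>\<Sigma>\<^sup>dG\<close> is listed with degree
    \<open>-d\<close>.\<close>
  then show ?case using realizes_Cons[OF S', of "-d" S i j r s] bS
    by (intro exI[of _ "(-d) # ds"] exI[of _ S] conjI bexI[of _ ?a] bexI[of _ ?b]) simp_all
qed

lemma projs_realizes:
  assumes "P \<in> projs"
  obtains ds S a b where "realizes ds S" "a \<in> mor T P S" "b \<in> mor T S P" "Cmp T P S P b a = Idn T P"
  using addG_realizes[OF _ _ projs_Idn[OF assms]] assms by auto

end

lemma ghom_id: "graded_module k A M \<Longrightarrow> (\<lambda>p. \<lambda>x \<in> gcar M p. x) \<in> ghom A M M"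
  using graded_module_closed[of k A M] by (auto simp: ghom_def)

context triangulated_with_object
begin

text \<open>Finite presentation with free modules replaced by \<open>F\<close> of objects of
  \<open>projs\<close>. Generators and relations are joined by a morphism of \<open>T\<close>, which
  can be split or completed to a triangle.\<close>

definition presents :: "'o \<Rightarrow> 'o \<Rightarrow> 'm \<Rightarrow> (int \<Rightarrow> 'm gelt \<Rightarrow> 'm gelt) \<Rightarrow> ('k, 'm gelt, 'm) gmod \<Rightarrow> bool" where
  "presents P Q f \<psi> M \<longleftrightarrow> P \<in> projs \<and> Q \<in> projs \<and> f \<in> mor T P Q \<and> \<psi> \<in> ghom A (F Q) M \<and>
     (\<forall>p. \<psi> p ` gcar (F Q) p = gcar M p) \<and>
     (\<forall>p. \<forall>x \<in> gcar (F Q) p. \<psi> p x = \<zero>\<^bsub>Gpart M p\<^esub> \<longleftrightarrow> x \<in> Fm P Q f p ` gcar (F P) p)"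

text \<open>\<open>Q\<close> is only a retract of a sum of shifts \<open>S\<close>, so the
  complement of \<open>F Q\<close> in \<open>F S\<close> is added to the relations, whose source
  becomes \<open>P \<oplus> S\<close>. That in turn is a retract of a sum of shifts
  \<open>S'\<close>.\<close>

lemma presents_finitely_presented:
  assumes "presents P Q f \<psi> M" and M: "graded_module k A M"
  shows "finitely_presented A M"
proof -
  have P: "P \<in> projs" and Q: "Q \<in> projs" and [simp]: "f \<in> mor T P Q" and \<psi>: "\<psi> \<in> ghom A (F Q) M"
    and sur: "\<And>p. \<psi> p ` gcar (F Q) p = gcar M p"
    and ker: "\<And>p x. x \<in> gcar (F Q) p \<Longrightarrow> \<psi> p x = \<zero>\<^bsub>Gpart M p\<^esub> \<longleftrightarrow> x \<in> Fm P Q f p ` gcar (F P) p"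
    using assms(1) unfolding presents_def by blast+
  note [simp] = projs_Ob[OF P] projs_Ob[OF Q]
  obtain ds S a b where S: "realizes ds S" and [simp]: "a \<in> mor T Q S" "b \<in> mor T S Q"
      and ba: "Cmp T Q S Q b a = Idn T Q"
    using projs_realizes[OF Q] by metis
  then obtain \<theta> where [simp]: "S \<in> projs" and \<theta>: "\<theta> \<in> ghom A (F S) (free_gmod A ds)"
    and bij: "\<And>p. bij_betw (\<theta> p) (gcar (F S) p) (gcar (free_gmod A ds) p)"
    by (auto simp: realizes_def)
  obtain \<eta> where \<eta>: "\<eta> \<in> ghom A (free_gmod A ds) (F S)"
      and \<eta>\<theta>: "\<And>p x. x \<in> gcar (F S) p \<Longrightarrow> \<eta> p (\<theta> p x) = x"
    and \<theta>\<eta>: "\<And>p y. y \<in> gcar (free_gmod A ds) p \<Longrightarrow> \<theta> p (\<eta> p y) = y"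
    using ghom_inverse[OF \<theta> bij graded_module_closed[OF F_graded[of S]]] by auto
  obtain R i j r s where bp: "is_biproduct T P S R i j r s" using direct_sum[of P S]
      by (auto simp: is_direct_sum_def)
  then have [simp]: "R \<in> Ob T" "i \<in> mor T P R" "j \<in> mor T S R" "r \<in> mor T R P" "s \<in> mor T R S"
    and bp': "Cmp T P R P r i = Idn T P" "Cmp T S R S s j = Idn T S" "Cmp T S R P r j = \<zero>\<^bsub>Mor T S P\<^esub>"
      "Cmp T P R S s i = \<zero>\<^bsub>Mor T P S\<^esub>"
    by (auto simp: is_biproduct_def)
  have R: "R \<in> projs" by (rule projs_biproduct[OF bp P \<open>S \<in> projs\<close>])
  \<comment> \<open>As \<open>b a = 1\<close>, this idempotent projects onto what \<open>b\<close>
    kills; \<open>g\<close> joins it to the relations \<open>f\<close>.\<close>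
  define e where "e = Idn T S \<oplus>\<^bsub>Mor T S S\<^esub> \<ominus>\<^bsub>Mor T S S\<^esub> Cmp T S Q S a b"
  define g where "g = Cmp T R P S (Cmp T P Q S a f) r \<oplus>\<^bsub>Mor T R S\<^esub> Cmp T R S S e s"
  have [simp]: "e \<in> mor T S S" by (simp add: e_def)
  have [simp]: "g \<in> mor T R S" by (simp add: g_def)
  have gi: "Cmp T P R S g i = Cmp T P Q S a f" and gj: "Cmp T S R S g j = e"
    using bp' by (simp_all add: g_def Cmp_add_left flip: Cmp_assoc)
  have be: "Cmp T S S Q b e = \<zero>\<^bsub>Mor T S Q\<^esub>" by (simp add: e_def Cmp_add_right Cmp_assoc ba)
  have bg: "Cmp T R S Q b g = Cmp T R P Q f r"
    by (simp add: g_def Cmp_add_right Cmp_assoc ba be)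
  obtain es S' a' b' where S': "realizes es S'" and [simp]: "a' \<in> mor T R S'" "b' \<in> mor T S' R"
      and ba': "Cmp T R S' R b' a' = Idn T R"
    using projs_realizes[OF R] by metis
  then obtain \<theta>' where [simp]: "S' \<in> projs" and \<theta>': "\<theta>' \<in> ghom A (F S') (free_gmod A es)"
    and bij': "\<And>p. bij_betw (\<theta>' p) (gcar (F S') p) (gcar (free_gmod A es) p)"
    by (auto simp: realizes_def)
  obtain \<eta>' where \<eta>': "\<eta>' \<in> ghom A (free_gmod A es) (F S')"
      and \<eta>\<theta>': "\<And>p x. x \<in> gcar (F S') p \<Longrightarrow> \<eta>' p (\<theta>' p x) = x"
    and "\<And>p y. y \<in> gcar (free_gmod A es) p \<Longrightarrow> \<theta>' p (\<eta>' p y) = y"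
    using ghom_inverse[OF \<theta>' bij' graded_module_closed[OF F_graded[of S']]] by auto
  note free = free_closed[OF A_graded]
  \<comment> \<open>\<open>b'\<close> has the right inverse \<open>a'\<close>, so precomposing with
    it changes the source but not the image under \<open>F\<close>.\<close>
  define gb where "gb = Cmp T S' R S g b'"
  have [simp]: "gb \<in> mor T S' S" by (simp add: gb_def)
  define \<phi> where "\<phi> = (\<lambda>p. compose (gcar (free_gmod A es) p) (\<theta> p) (compose (gcar (free_gmod A es) p)
      (Fm S' S gb p) (\<eta>' p)))"
  define \<chi> where "\<chi> = (\<lambda>p. compose (gcar (free_gmod A ds) p) (\<psi> p) (compose (gcar (free_gmod A ds) p)
      (Fm S Q b p) (\<eta> p)))"
  have \<phi>: "\<phi> \<in> ghom A (free_gmod A es) (free_gmod A ds)"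
    unfolding \<phi>_def by (intro gcomp_ghom[OF gcomp_ghom[OF \<eta>' Fm_ghom free] \<theta> free]) simp_all
  have \<chi>: "\<chi> \<in> ghom A (free_gmod A ds) M"
    unfolding \<chi>_def by (intro gcomp_ghom[OF gcomp_ghom[OF \<eta> Fm_ghom free] \<psi> free]) simp_all
  have \<chi>_app: "\<chi> p x = \<psi> p (Fm S Q b p (\<eta> p x))" if "x \<in> gcar (free_gmod A ds) p" for p x
    using that by (simp add: \<chi>_def compose_def)
  have \<phi>_app: "\<phi> p x = \<theta> p (Fm S' S gb p (\<eta>' p x))" if "x \<in> gcar (free_gmod A es) p" for p x
    using that by (simp add: \<phi>_def compose_def)
  have sur': "\<chi> p ` gcar (free_gmod A ds) p = gcar M p" for p
  proof (intro equalityI subsetI)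
    fix m assume "m \<in> gcar M p"
    then obtain y where y: "y \<in> gcar (F Q) p" "\<psi> p y = m" unfolding sur[symmetric] by auto
    have "Fm S Q b p (Fm Q S a p y) = y" using y by (simp add: ba Fm_Idn_app flip: Fm_Cmp_app)
    then show "m \<in> \<chi> p ` gcar (free_gmod A ds) p"
      using y by (intro image_eqI[of _ _ "\<theta> p (Fm Q S a p y)"]) (simp_all add: \<chi>_app \<eta>\<theta> ghomD(1)[OF \<theta>])
  qed (use ghomD(1)[OF \<chi>] in auto)
  have "\<phi> p ` gcar (free_gmod A es) p = {x \<in> gcar (free_gmod A ds) p. \<chi> p x = \<zero>\<^bsub>Gpart M p\<^esub>}" for p
  proof (intro equalityI subsetI)
    fix x assume "x \<in> \<phi> p ` gcar (free_gmod A es) p"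
    then obtain y where y: "y \<in> gcar (free_gmod A es) p" "x = \<phi> p y" by auto
    define z where "z = Fm S' R b' p (\<eta>' p y)"
    have z: "z \<in> gcar (F R) p" using ghomD(1)[OF \<eta>' y(1)] by (simp add: z_def)
    have x: "x = \<theta> p (Fm R S g p z)" using y ghomD(1)[OF \<eta>' y(1)]
        by (simp add: \<phi>_app z_def gb_def Fm_Cmp_app)
    have x': "x \<in> gcar (free_gmod A ds) p" using x z ghomD(1)[OF \<theta>] by simp
    have "\<chi> p x = \<psi> p (Fm P Q f p (Fm R P r p z))"
      using x x' z by (simp add: \<chi>_app \<eta>\<theta> bg flip: Fm_Cmp_app)
    also have "\<dots> = \<zero>\<^bsub>Gpart M p\<^esub>" using z by (subst ker) auto
    finally show "x \<in> {x \<in> gcar (free_gmod A ds) p. \<chi> p x = \<zero>\<^bsub>Gpart M p\<^esub>}" using x' by simp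
  next
    fix x assume x: "x \<in> {x \<in> gcar (free_gmod A ds) p. \<chi> p x = \<zero>\<^bsub>Gpart M p\<^esub>}"
    let ?D = "ShO T (-p) G"
    obtain \<zeta> where [simp]: "\<zeta> \<in> mor T ?D S" and \<zeta>: "\<eta> p x = el S p \<zeta>"
      using ghomD(1)[OF \<eta>, of x p] x by (auto elim!: elE[rotated])
    have "\<psi> p (Fm S Q b p (el S p \<zeta>)) = \<zero>\<^bsub>Gpart M p\<^esub>" using x by (auto simp: \<chi>_app \<zeta>)
    then have "Fm S Q b p (el S p \<zeta>) \<in> Fm P Q f p ` gcar (F P) p" by (subst (asm) ker) simp_all
    then obtain \<upsilon> where [simp]: "\<upsilon> \<in> mor T ?D P" and \<upsilon>: "Cmp T ?D S Q b \<zeta> = Cmp T ?D P Q f \<upsilon>"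
      by (auto elim!: elE[rotated] simp: Fm_el el_inj)
    \<comment> \<open>\<open>\<zeta> = a b \<zeta> + e \<zeta> = a f \<upsilon> + e \<zeta>\<close>,
      so \<open>\<upsilon>\<close> and \<open>\<zeta>\<close> are the components of a preimage under
      \<open>g\<close>.\<close>
    define w where "w = Cmp T ?D P R i \<upsilon> \<oplus>\<^bsub>Mor T ?D R\<^esub> Cmp T ?D S R j \<zeta>"
    have [simp]: "w \<in> mor T ?D R" by (simp add: w_def)
    have "Cmp T ?D P S (Cmp T P Q S a f) \<upsilon> = Cmp T ?D S S (Cmp T S Q S a b) \<zeta>"
      using arg_cong[OF \<upsilon>, of "Cmp T ?D Q S a"] by (simp add: Cmp_assoc)
    then have gw: "Cmp T ?D R S g w = \<zeta>"
      by (simp add: w_def Cmp_add_right Cmp_assoc gi gj) (simp add: e_def Cmp_add_left)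
    have "Cmp T ?D S' S gb (Cmp T ?D R S' a' w) = Cmp T ?D R S g (Cmp T ?D R R (Cmp T R S' R b' a') w)"
      by (simp add: gb_def Cmp_assoc)
    also have "\<dots> = \<zeta>" unfolding ba' by (simp add: gw)
    finally have "Cmp T ?D S' S gb (Cmp T ?D R S' a' w) = \<zeta>" .
    then have "Fm S' S gb p (el S' p (Cmp T ?D R S' a' w)) = \<eta> p x" unfolding \<zeta> by (subst Fm_el)
        simp_all
    then have "x = \<phi> p (\<theta>' p (el S' p (Cmp T ?D R S' a' w)))"
      using x ghomD(1)[OF \<theta>'] by (simp add: \<phi>_app \<eta>\<theta>' \<theta>\<eta>)
    then show "x \<in> \<phi> p ` gcar (free_gmod A es) p" using ghomD(1)[OF \<theta>'] by auto
  qed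
  then show ?thesis using \<phi> \<chi> sur' unfolding finitely_presented_def by blast
qed

text \<open>Both free modules are replaced by realizing objects; the map between them then comes
  from a morphism of \<open>T\<close> by \<open>Fm_full_projs\<close>.\<close>

lemma finitely_presented_presents:
  fixes M :: "('k, 'm gelt, 'm) gmod"
  assumes fp: "finitely_presented A M"
  obtains P Q f \<psi> where "presents P Q f \<psi> M"
proof -
  obtain ds es \<phi> \<chi> where \<phi>: "\<phi> \<in> ghom A (free_gmod A es) (free_gmod A ds)"
      and \<chi>: "\<chi> \<in> ghom A (free_gmod A ds) M"
    and sur: "\<And>p. \<chi> p ` gcar (free_gmod A ds) p = gcar M p"
    and ker: "\<And>p. \<phi> p ` gcar (free_gmod A es) p = {x \<in> gcar (free_gmod A ds) p. \<chi> p x = \<zero>\<^bsub>Gpart M p\<^esub>}"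
    using fp unfolding finitely_presented_def
  proof (elim exE bexE, goal_cases)
    case (1 ds es \<phi> \<chi>)
    show ?case by (rule 1(1)[OF 1(2,3)]) (use 1(4) in simp_all)
  qed
  obtain S \<theta> where [simp]: "S \<in> projs" and \<theta>: "\<theta> \<in> ghom A (F S) (free_gmod A ds)"
    and bij: "\<And>p. bij_betw (\<theta> p) (gcar (F S) p) (gcar (free_gmod A ds) p)"
    using realizes_exists[of ds] by (auto simp: realizes_def)
  obtain \<eta> where \<eta>: "\<eta> \<in> ghom A (free_gmod A ds) (F S)"
      and \<eta>\<theta>: "\<And>p x. x \<in> gcar (F S) p \<Longrightarrow> \<eta> p (\<theta> p x) = x"
    and \<theta>\<eta>: "\<And>p y. y \<in> gcar (free_gmod A ds) p \<Longrightarrow> \<theta> p (\<eta> p y) = y"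
    using ghom_inverse[OF \<theta> bij graded_module_closed[OF F_graded[of S]]] by auto
  obtain S' \<theta>' where [simp]: "S' \<in> projs" and \<theta>': "\<theta>' \<in> ghom A (F S') (free_gmod A es)"
    and bij': "\<And>p. bij_betw (\<theta>' p) (gcar (F S') p) (gcar (free_gmod A es) p)"
    using realizes_exists[of es] by (auto simp: realizes_def)
  have F: "graded_module k A (F S)" "graded_module k A (F S')" by simp_all
  have "(\<lambda>p. compose (gcar (F S') p) (\<eta> p) (compose (gcar (F S') p) (\<phi> p) (\<theta>' p)))
      \<in> ghom A (F S') (F S)"
    by (rule ghom_comp[OF F(2) ghom_comp[OF F(2) \<theta>' \<phi>] \<eta>])
  then obtain f where f: "f \<in> mor T S' S" and "Fm S' S f
      = (\<lambda>p. compose (gcar (F S') p) (\<eta> p) (compose (gcar (F S') p) (\<phi> p) (\<theta>' p)))"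
    using Fm_full_projs[of S' S] by auto
  then have f': "Fm S' S f p x = \<eta> p (\<phi> p (\<theta>' p x))" if "x \<in> gcar (F S') p" for p x
    using that by (simp add: compose_def)
  define \<psi> where "\<psi> = (\<lambda>p. compose (gcar (F S) p) (\<chi> p) (\<theta> p))"
  have \<psi>: "\<psi> \<in> ghom A (F S) M" unfolding \<psi>_def by (rule ghom_comp[OF F(1) \<theta> \<chi>])
  have \<psi>_app: "\<psi> p x = \<chi> p (\<theta> p x)" if "x \<in> gcar (F S) p" for p x
    using that by (simp add: \<psi>_def compose_def)
  have "\<psi> p ` gcar (F S) p = gcar M p" for p
    unfolding sur[of p, symmetric] bij_betw_imp_surj_on[OF bij[of p], symmetric] by (auto simp: \<psi>_app)
  moreover have "\<psi> p x = \<zero>\<^bsub>Gpart M p\<^esub> \<longleftrightarrow> x \<in> Fm S' S f p ` gcar (F S') p" if x: "x \<in> gcar (F S) p"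
      for p x
  proof -
    have "\<psi> p x = \<zero>\<^bsub>Gpart M p\<^esub> \<longleftrightarrow> \<theta> p x \<in> \<phi> p ` gcar (free_gmod A es) p"
      using x ghomD(1)[OF \<theta> x] by (simp add: \<psi>_app ker)
    also have "\<dots> \<longleftrightarrow> (\<exists>y \<in> gcar (F S') p. \<theta> p x = \<phi> p (\<theta>' p y))"
      unfolding bij_betw_imp_surj_on[OF bij'[of p], symmetric] by auto
    also have "\<dots> \<longleftrightarrow> (\<exists>y \<in> gcar (F S') p. x = \<eta> p (\<phi> p (\<theta>' p y)))"
      using x \<eta>\<theta>[OF x] \<theta>\<eta> ghomD(1)[OF \<theta>'] ghomD(1)[OF \<phi>] by metis
    finally show ?thesis by (auto simp: f')
  qed
  ultimately have "presents S' S f \<psi> M" using f \<psi> by (simp add: presents_def)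
  then show ?thesis by (rule that)
qed

lemma F_proj_Ob:
  assumes P: "P \<in> projs"
  shows "F P \<in> Ob (grmod k A)"
proof -
  note [simp] = projs_Ob[OF P]
  have "presents P P \<zero>\<^bsub>Mor T P P\<^esub> (\<lambda>p. \<lambda>x \<in> gcar (F P) p. x) (F P)"
    unfolding presents_def using P ghom_id[OF F_graded, of P]
    by (auto simp: Fm_zero_app image_iff intro: bexI[of _ "\<zero>\<^bsub>Gpart (F P) _\<^esub>"])
  then show ?thesis using presents_finitely_presented by (simp add: grmod_simps)
qed

end

section \<open>Images\<close>

text \<open>The operations are those of \<open>N\<close> on smaller carriers, so the inclusion into
  \<open>N\<close> is the identity on elements.\<close>

definition image_gmod :: "('k, 'x, 'a) gmod \<Rightarrow> ('k, 'y, 'a) gmod \<Rightarrow> (int \<Rightarrow> 'x \<Rightarrow> 'y) \<Rightarrow> ('k, 'y, 'a) gmod"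
    where
  "image_gmod M N f = \<lparr>Gpart = (\<lambda>p. (Gpart N p)\<lparr>carrier := f p ` gcar M p\<rparr>), Gact = Gact N\<rparr>"

lemma image_gmod_simps [simp]:
  "gcar (image_gmod M N f) p = f p ` gcar M p"
  "x \<oplus>\<^bsub>Gpart (image_gmod M N f) p\<^esub> y = x \<oplus>\<^bsub>Gpart N p\<^esub> y"
  "\<zero>\<^bsub>Gpart (image_gmod M N f) p\<^esub> = \<zero>\<^bsub>Gpart N p\<^esub>"
  "c \<odot>\<^bsub>Gpart (image_gmod M N f) p\<^esub> x = c \<odot>\<^bsub>Gpart N p\<^esub> x"
  "Gact (image_gmod M N f) = Gact N"
  by (simp_all add: image_gmod_def)

lemma image_graded_module:
  assumes A: "graded_algebra k A" and M: "graded_module k A M" and N: "graded_module k A N"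
      and f: "f \<in> ghom A M N"
  shows "graded_module k A (image_gmod M N f)"
proof -
  interpret M: graded_module k A M by (rule M)
  interpret N: graded_module k A N by (rule N)
  have "submodule (f p ` gcar M p) k (Gpart N p)" for p
  proof -
    interpret Mp: module k "Gpart M p" by (rule M.Gpart_module)
    interpret Np: module k "Gpart N p" by (rule N.Gpart_module)
    have neg: "\<ominus>\<^bsub>Gpart N p\<^esub> f p x = f p (\<ominus>\<^bsub>Gpart M p\<^esub> x)" if x: "x \<in> gcar M p" for x
      using ghom_diff[OF M N f Mp.zero_closed x] ghom_zero[OF M N f] x ghomD(1)[OF f x]
          by (simp add: a_minus_def)
    show ?thesis
    proof (rule Np.submoduleI)
      show "\<zero>\<^bsub>Gpart N p\<^esub> \<in> f p ` gcar M p" using ghom_zero[OF M N f, of p]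
          by (metis Mp.zero_closed imageI)
      show "f p ` gcar M p \<subseteq> gcar N p" using ghomD(1)[OF f] by auto
      show "\<ominus>\<^bsub>Gpart N p\<^esub> a \<in> f p ` gcar M p" if "a \<in> f p ` gcar M p" for a using that neg by auto
      show "a \<oplus>\<^bsub>Gpart N p\<^esub> b \<in> f p ` gcar M p" if "a \<in> f p ` gcar M p" "b \<in> f p ` gcar M p" for a b
        using that by (auto simp flip: ghomD(2)[OF f])
      show "a \<odot>\<^bsub>Gpart N p\<^esub> x \<in> f p ` gcar M p" if "a \<in> carrier k" "x \<in> f p ` gcar M p" for a x
        using that by (auto simp flip: ghom_smult[OF A M N f])
    qed
  qed
  then have mod: "module k (Gpart (image_gmod M N f) p)" for p
    using submodule.submodule_is_module N.Gpart_module unfolding image_gmod_def by force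
  have cl: "y \<in> gcar N p" if "y \<in> f p ` gcar M p" for p y using that ghomD(1)[OF f] by auto
  show ?thesis
  proof (intro graded_module.intro mod, goal_cases)
    case (1 x p a q)
    then show ?case by (auto simp: M.Gact_closed simp flip: ghomD(3)[OF f])
  qed (auto simp: N.Gact_add_left N.Gact_add_right N.Gact_smult_left N.Gact_smult_right N.Gact_assoc
      N.Gact_one
         dest!: cl)
qed

lemma image_ghom: "f \<in> ghom A M N \<Longrightarrow> f \<in> ghom A M (image_gmod M N f)"
  by (auto simp: ghom_def)

lemma image_inclusion:
  assumes f: "f \<in> ghom A M N" and M: "graded_module k A M"
  shows "(\<lambda>p. \<lambda>y \<in> f p ` gcar M p. y) \<in> ghom A (image_gmod M N f) N"
  using graded_module_closed[OF M] ghomD(1)[OF f]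
  by (auto simp: ghom_def simp flip: ghomD(2,3)[OF f])

section \<open>Consequences of coherence and hereditariness\<close>

locale hereditary_endomorphisms = triangulated_with_object k T G +
  D: abelian_category k "grmod k (End_alg T G)"
  for k :: "('k, 'r) ring_scheme" and T :: "('o, 'm, 'k, 'z) tcat_scheme" and G :: 'o +
  assumes idem: "idempotent_complete T" and hereditary: "is_hereditary (grmod k (End_alg T G))"
begin

lemma ObD: "M \<in> Ob (grmod k A) \<Longrightarrow> graded_module k A M" "M \<in> Ob (grmod k A) \<Longrightarrow> finitely_presented A M"
  by (simp_all add: grmod_simps)

text \<open>Elements of \<open>M\<close> are morphisms from the modules \<open>F (\<Sigma>\<^sup>dG)\<close>, so categorical kernels are computed
  on elements.\<close>

lemma kernel_elements:
  assumes X: "X \<in> Ob (grmod k A)" and Y: "Y \<in> Ob (grmod k A)" and e: "e \<in> ghom A X Y"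
  obtains K i where "K \<in> Ob (grmod k A)" "i \<in> ghom A K X"
    "\<And>p x. x \<in> gcar X p \<Longrightarrow> e p x = \<zero>\<^bsub>Gpart Y p\<^esub> \<longleftrightarrow> x \<in> i p ` gcar K p"
proof -
  have "\<exists>K i. is_kernel (grmod k A) X Y e K i" using e by (intro D.has_kernel[OF X Y])
      (simp add: grmod_simps)
  then obtain K i where ker: "is_kernel (grmod k A) X Y e K i" by blast
  then have K: "K \<in> Ob (grmod k A)" and i: "i \<in> ghom A K X"
    and ei: "(\<lambda>p. compose (gcar K p) (e p) (i p)) = (\<lambda>p. \<lambda>x \<in> gcar K p. \<zero>\<^bsub>Gpart Y p\<^esub>)"
    by (simp_all add: is_kernel_def grmod_simps(1,2,5))
  have "e p x = \<zero>\<^bsub>Gpart Y p\<^esub> \<longleftrightarrow> x \<in> i p ` gcar K p" if x: "x \<in> gcar X p" for p x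
  proof
    assume "x \<in> i p ` gcar K p"
    then obtain y where "y \<in> gcar K p" "x = i p y" by auto
    then show "e p x = \<zero>\<^bsub>Gpart Y p\<^esub>" using fun_cong[OF fun_cong[OF ei, of p], of y]
        by (simp add: compose_def)
  next
    assume 0: "e p x = \<zero>\<^bsub>Gpart Y p\<^esub>"
    let ?D = "ShO T (-p) G"
    let ?u = "el ?D p (Idn T ?D)"
    have DOb: "F ?D \<in> Ob (grmod k A)" by (rule F_proj_Ob) simp
    obtain f where f: "f \<in> ghom A (F ?D) X" "f p ?u = x"
      using yoneda[OF ObD(1)[OF X], of x "-p"] x by auto
    have ef: "(\<lambda>p. compose (gcar (F ?D) p) (e p) (f p)) \<in> ghom A (F ?D) Y"
      by (rule ghom_comp[OF F_graded f(1) e]) simp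
    have z: "(\<lambda>p. \<lambda>x \<in> gcar (F ?D) p. \<zero>\<^bsub>Gpart Y p\<^esub>) \<in> ghom A (F ?D) Y"
      by (rule ghom_zero_closed[OF A_graded F_graded ObD(1)[OF Y]]) simp
    have "(\<lambda>p. compose (gcar (F ?D) p) (e p) (f p)) = (\<lambda>p. \<lambda>x \<in> gcar (F ?D) p. \<zero>\<^bsub>Gpart Y p\<^esub>)"
      by (rule yoneda_unique[OF ef z]) (simp add: compose_def f(2) 0)
    then have "Cmp (grmod k A) (F ?D) X Y e f = \<zero>\<^bsub>Mor (grmod k A) (F ?D) Y\<^esub>" by (simp add: grmod_simps)
    moreover have "f \<in> mor (grmod k A) (F ?D) X" using f by (simp add: grmod_simps)
    ultimately obtain h where h: "h \<in> ghom A (F ?D) K" "(\<lambda>p. compose (gcar (F ?D) p) (i p) (h p)) = f"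
      using ker DOb unfolding is_kernel_def grmod_simps(1,2) by blast
    have "x = i p (h p ?u)" using fun_cong[OF fun_cong[OF h(2), of p], of ?u] f(2)
        by (simp add: compose_def)
    then show "x \<in> i p ` gcar K p" using ghomD(1)[OF h(1), of ?u p] by auto
  qed
  then show ?thesis using that K i by blast
qed

text \<open>Coherence enters here: the kernel \<open>K\<close> of \<open>e\<close> is an object of
  \<open>grmod A\<close>, hence finitely generated. The image has the generators of
  \<open>X\<close>, and its relations are those of \<open>X\<close> together with lifts of
  generators of \<open>K\<close>.\<close>

lemma image_Ob:
  assumes X: "X \<in> Ob (grmod k A)" and Y: "Y \<in> Ob (grmod k A)" and e: "e \<in> ghom A X Y"
  shows "image_gmod X Y e \<in> Ob (grmod k A)"
proof -
  let ?I = "image_gmod X Y e"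
  have I: "graded_module k A ?I" by (rule image_graded_module[OF A_graded ObD(1)[OF X] ObD(1)[OF Y] e])
  obtain K i where K: "K \<in> Ob (grmod k A)" and i: "i \<in> ghom A K X"
    and ker: "\<And>p x. x \<in> gcar X p \<Longrightarrow> e p x = \<zero>\<^bsub>Gpart Y p\<^esub> \<longleftrightarrow> x \<in> i p ` gcar K p"
    using kernel_elements[OF X Y e] by blast
  obtain P Q f \<psi> where pX: "presents P Q f \<psi> X" using finitely_presented_presents[OF ObD(2)[OF X]]
      by blast
  then have P: "P \<in> projs" and Q: "Q \<in> projs" and [simp]: "f \<in> mor T P Q" and \<psi>: "\<psi> \<in> ghom A (F Q) X"
    and sur: "\<And>p. \<psi> p ` gcar (F Q) p = gcar X p"
    and ker\<psi>: "\<And>p x. x \<in> gcar (F Q) p \<Longrightarrow> \<psi> p x = \<zero>\<^bsub>Gpart X p\<^esub> \<longleftrightarrow> x \<in> Fm P Q f p ` gcar (F P) p"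
    unfolding presents_def by blast+
  obtain P' Q' f' \<chi> where pK: "presents P' Q' f' \<chi> K"
      using finitely_presented_presents[OF ObD(2)[OF K]] by blast
  then have Q': "Q' \<in> projs" and \<chi>: "\<chi> \<in> ghom A (F Q') K" and sur': "\<And>p. \<chi> p ` gcar (F Q') p = gcar K p"
    unfolding presents_def by blast+
  note [simp] = projs_Ob[OF P] projs_Ob[OF Q] projs_Ob[OF Q']
  have FQ': "graded_module k A (F Q')" and FQ: "graded_module k A (F Q)"
      and FP: "graded_module k A (F P)" by simp_all
  \<comment> \<open>Generators of \<open>K\<close>, expressed through the generators of
    \<open>X\<close>.\<close>
  obtain g' where g': "g' \<in> ghom A (F Q') (F Q)"
    "\<And>p x. x \<in> gcar (F Q') p \<Longrightarrow> \<psi> p (g' p x) = compose (gcar (F Q') p) (i p) (\<chi> p) x"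
    using lift_through_surjection[OF Q' FQ ObD(1)[OF X] \<psi> sur ghom_comp[OF FQ' \<chi> i]] by blast
  obtain g where [simp]: "g \<in> mor T Q' Q" and "Fm Q' Q g = g'" using Fm_full_projs[OF Q' _ g'(1)]
      by auto
  then have g: "\<psi> p (Fm Q' Q g p x) = i p (\<chi> p x)" if "x \<in> gcar (F Q') p" for p x
      using g'(2)[OF that] that by (simp add: compose_def)
  obtain R a b r s where bp: "is_biproduct T P Q' R a b r s" using direct_sum[of P Q']
      by (auto simp: is_direct_sum_def)
  then have [simp]: "R \<in> Ob T" "a \<in> mor T P R" "b \<in> mor T Q' R" "r \<in> mor T R P" "s \<in> mor T R Q'"
    and bp': "Cmp T P R P r a = Idn T P" "Cmp T Q' R Q' s b = Idn T Q'"
        "Cmp T Q' R P r b = \<zero>\<^bsub>Mor T Q' P\<^esub>"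
      "Cmp T P R Q' s a = \<zero>\<^bsub>Mor T P Q'\<^esub>"
    by (auto simp: is_biproduct_def)
  have R: "R \<in> projs" by (rule projs_biproduct[OF bp P Q'])
  define h where "h = Cmp T R P Q f r \<oplus>\<^bsub>Mor T R Q\<^esub> Cmp T R Q' Q g s"
  have [simp]: "h \<in> mor T R Q" by (simp add: h_def)
  have h_app: "Fm R Q h p x = Fm P Q f p (Fm R P r p x) \<oplus>\<^bsub>Gpart (F Q) p\<^esub> Fm Q' Q g p (Fm R Q' s p x)"
    if "x \<in> gcar (F R) p" for p x using that by (simp add: h_def Fm_add_app Fm_Cmp_app)
  have h_sum: "Fm R Q h p (Fm P R a p x \<oplus>\<^bsub>Gpart (F R) p\<^esub> Fm Q' R b p y) = Fm P Q f p x
      \<oplus>\<^bsub>Gpart (F Q) p\<^esub> Fm Q' Q g p y"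
    if "x \<in> gcar (F P) p" "y \<in> gcar (F Q') p" for p x y
  proof -
    have "Cmp T P R Q h a = f" "Cmp T Q' R Q h b = g"
      using bp' by (simp_all add: h_def Cmp_add_left flip: Cmp_assoc)
    then show ?thesis using that by (simp add: Fm_add_arg flip: Fm_Cmp_app)
  qed
  define \<omega> where "\<omega> = (\<lambda>p. compose (gcar (F Q) p) (e p) (\<psi> p))"
  have \<omega>: "\<omega> \<in> ghom A (F Q) ?I" unfolding \<omega>_def by (rule ghom_comp[OF FQ \<psi> image_ghom[OF e]])
  have \<omega>_app: "\<omega> p x = e p (\<psi> p x)" if "x \<in> gcar (F Q) p" for p x using that
      by (simp add: \<omega>_def compose_def)
  have "\<omega> p ` gcar (F Q) p = gcar ?I p" for p
    by (auto simp: \<omega>_app sur[of p, symmetric])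
  moreover have "\<omega> p x = \<zero>\<^bsub>Gpart ?I p\<^esub> \<longleftrightarrow> x \<in> Fm R Q h p ` gcar (F R) p" if x: "x \<in> gcar (F Q) p" for p x
  proof
    interpret Fp: module k "Gpart (F Q) p" by (rule graded_module.Gpart_module[OF FQ])
    interpret Xp: module k "Gpart X p" by (rule graded_module.Gpart_module[OF ObD(1)[OF X]])
    assume "\<omega> p x = \<zero>\<^bsub>Gpart ?I p\<^esub>"
    then have "\<psi> p x \<in> i p ` gcar K p" using x ker[OF ghomD(1)[OF \<psi> x]] by (simp add: \<omega>_app)
    then obtain y where y: "y \<in> gcar (F Q') p" "\<psi> p x = i p (\<chi> p y)" unfolding sur'[of p, symmetric]
        by auto
    let ?y = "Fm Q' Q g p y"
    have y': "?y \<in> gcar (F Q) p" using y by simp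
    \<comment> \<open>\<open>\<psi> x\<close> lies in the image of \<open>K\<close>; subtracting the
      lift of it supplied by \<open>g\<close> leaves a relation of \<open>X\<close>.\<close>
    have "\<psi> p (x \<ominus>\<^bsub>Gpart (F Q) p\<^esub> ?y) = \<zero>\<^bsub>Gpart X p\<^esub>"
      using ghom_diff[OF FQ ObD(1)[OF X] \<psi> x y'] y g[OF y(1)] ghomD(1)[OF \<psi> x]
          by (simp add: a_minus_def Xp.r_neg)
    then obtain z where z: "z \<in> gcar (F P) p" "x \<ominus>\<^bsub>Gpart (F Q) p\<^esub> ?y = Fm P Q f p z"
      using ker\<psi>[of "x \<ominus>\<^bsub>Gpart (F Q) p\<^esub> ?y" p] x y' Fp.minus_closed by auto
    have "x = (x \<ominus>\<^bsub>Gpart (F Q) p\<^esub> ?y) \<oplus>\<^bsub>Gpart (F Q) p\<^esub> ?y"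
      using x y' by (simp add: a_minus_def Fp.a_assoc Fp.l_neg)
    then have "x = Fm R Q h p (Fm P R a p z \<oplus>\<^bsub>Gpart (F R) p\<^esub> Fm Q' R b p y)"
      using z y by (simp add: h_sum)
    then show "x \<in> Fm R Q h p ` gcar (F R) p" using z y by auto
  next
    assume "x \<in> Fm R Q h p ` gcar (F R) p"
    then obtain z where z: "z \<in> gcar (F R) p" "x = Fm R Q h p z" by auto
    interpret Xp: module k "Gpart X p" by (rule graded_module.Gpart_module[OF ObD(1)[OF X]])
    have 1: "\<psi> p (Fm P Q f p (Fm R P r p z)) = \<zero>\<^bsub>Gpart X p\<^esub>" using z by (subst ker\<psi>) auto
    have 2: "i p (\<chi> p (Fm R Q' s p z)) \<in> gcar X p" using z ghomD(1)[OF \<chi>] ghomD(1)[OF i] by auto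
    have "\<psi> p x = i p (\<chi> p (Fm R Q' s p z))" using z 2 by (simp add: h_app ghomD(2)[OF \<psi>] 1 g)
    then have "e p (\<psi> p x) = \<zero>\<^bsub>Gpart Y p\<^esub>" using ker[OF 2] z ghomD(1)[OF \<chi>] by auto
    then show "\<omega> p x = \<zero>\<^bsub>Gpart ?I p\<^esub>" using x by (simp add: \<omega>_app)
  qed
  ultimately have "presents R Q h \<omega> ?I" using R Q \<omega> by (simp add: presents_def)
  then show ?thesis using presents_finitely_presented I by (simp add: grmod_simps)
qed

text \<open>An epimorphism \<open>e\<close> is a cokernel, so its corestriction to the image factors through \<open>e\<close>; this splits
  the inclusion of the image.\<close>

lemma epi_surjective:
  assumes X: "X \<in> Ob (grmod k A)" and Y: "Y \<in> Ob (grmod k A)" and epi: "is_epi (grmod k A) X Y e"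
  shows "e p ` gcar X p = gcar Y p"
proof -
  let ?I = "image_gmod X Y e"
  have e: "e \<in> ghom A X Y" using epi by (simp add: is_epi_def grmod_simps)
  have I: "?I \<in> Ob (grmod k A)" by (rule image_Ob[OF X Y e])
  obtain W g where W: "W \<in> Ob (grmod k A)" and g: "g \<in> ghom A W X"
      and cok: "is_cokernel (grmod k A) W X g Y e"
    using D.epi_is_cokernel[OF X Y epi] by (auto simp: grmod_simps(1))
  have "Cmp (grmod k A) W X ?I e g = \<zero>\<^bsub>Mor (grmod k A) W ?I\<^esub>"
    using cok by (simp add: is_cokernel_def grmod_simps(2,5))
  moreover have "e \<in> mor (grmod k A) X ?I" using image_ghom[OF e] by (simp add: grmod_simps)
  ultimately obtain h where h: "h \<in> ghom A Y ?I" "Cmp (grmod k A) X Y ?I h e = e"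
    using cok I unfolding is_cokernel_def grmod_simps(1) by blast
  have "h p y \<in> gcar Y p" if "y \<in> gcar Y p" for p y
    using ghomD(1)[OF h(1) that] ghomD(1)[OF e] by auto
  then have h': "h \<in> ghom A Y Y"
    using h(1) by (auto simp: ghom_def PiE_iff)
  \<comment> \<open>\<open>h e = e = 1 e\<close>, so \<open>h\<close> is the identity because
    \<open>e\<close> is epi; yet its values lie in the image.\<close>
  have "Cmp (grmod k A) X Y Y h e = Cmp (grmod k A) X Y Y (Idn (grmod k A) Y) e"
    using h(2) D.Idn_left[OF X Y, of e] e by (simp add: grmod_simps(1,2))
  moreover have "Idn (grmod k A) Y \<in> mor (grmod k A) Y Y" by (rule D.Idn_closed[OF Y])
  ultimately have "h = Idn (grmod k A) Y"
    using epi Y h' unfolding is_epi_def grmod_simps(1) by blast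
  then have "h p y = y" if "y \<in> gcar Y p" for y using that by (simp add: grmod_simps)
  then show ?thesis using ghomD(1)[OF h(1), of _ p] ghomD(1)[OF e] by force
qed

lemma surjective_epi:
  assumes "X \<in> Ob (grmod k A)" "Y \<in> Ob (grmod k A)" and e: "e \<in> ghom A X Y"
      and sur: "\<And>p. e p ` gcar X p = gcar Y p"
  shows "is_epi (grmod k A) X Y e"
  unfolding is_epi_def grmod_simps(1,2)
proof (intro conjI e ballI impI)
  fix Z g h assume g: "g \<in> ghom A Y Z" and h: "h \<in> ghom A Y Z"
    and eq: "(\<lambda>p. compose (gcar X p) (g p) (e p)) = (\<lambda>p. compose (gcar X p) (h p) (e p))"
  show "g = h"
  proof (rule ghom_eqI[OF g h])
    fix p y assume "y \<in> gcar Y p"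
    then obtain x where "x \<in> gcar X p" "y = e p x" using sur by blast
    then show "g p y = h p y" using fun_cong[OF fun_cong[OF eq, of p], of x] by (simp add: compose_def)
  qed
qed

lemma injective_mono:
  assumes "X \<in> Ob (grmod k A)" "Y \<in> Ob (grmod k A)" and e: "e \<in> ghom A X Y"
      and inj: "\<And>p. inj_on (e p) (gcar X p)"
  shows "is_mono (grmod k A) X Y e"
  unfolding is_mono_def grmod_simps(1,2)
proof (intro conjI e ballI impI)
  fix Z g h assume g: "g \<in> ghom A Z X" and h: "h \<in> ghom A Z X"
    and eq: "(\<lambda>p. compose (gcar Z p) (e p) (g p)) = (\<lambda>p. compose (gcar Z p) (e p) (h p))"
  show "g = h"
  proof (rule ghom_eqI[OF g h])
    fix p y assume y: "y \<in> gcar Z p"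
    then have "e p (g p y) = e p (h p y)" using fun_cong[OF fun_cong[OF eq, of p], of y]
        by (simp add: compose_def)
    then show "g p y = h p y" by (rule inj_onD[OF inj _ ghomD(1)[OF g y] ghomD(1)[OF h y]])
  qed
qed

text \<open>\<open>epi_surjective\<close> turns categorical epimorphisms into surjections on
  elements, to which \<open>lift_through_surjection\<close> applies.\<close>

lemma F_projective:
  assumes P: "P \<in> projs"
  shows "is_projective (grmod k A) (F P)"
  unfolding is_projective_def
proof (intro conjI F_proj_Ob[OF P] ballI allI impI)
  fix X Y e f assume X: "X \<in> Ob (grmod k A)" and Y: "Y \<in> Ob (grmod k A)"
      and epi: "is_epi (grmod k A) X Y e"
    and f: "f \<in> mor (grmod k A) (F P) Y"
  have f': "f \<in> ghom A (F P) Y" using f by (simp add: grmod_simps)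
  have e: "e \<in> ghom A X Y" using epi by (simp add: is_epi_def grmod_simps)
  obtain h where h: "h \<in> ghom A (F P) X" "\<And>p x. x \<in> gcar (F P) p \<Longrightarrow> e p (h p x) = f p x"
    using lift_through_surjection[OF P ObD(1)[OF X] ObD(1)[OF Y] e epi_surjective[OF X Y epi] f']
        by blast
  have "(\<lambda>p. compose (gcar (F P) p) (e p) (h p)) = f"
    by (rule ghom_eqI[OF ghom_comp[OF F_graded h(1) e] f'])
        (simp_all add: projs_Ob[OF P] compose_def h(2))
  then show "\<exists>h \<in> mor (grmod k A) (F P) X. Cmp (grmod k A) (F P) X Y e h = f"
    using h(1) by (auto simp: grmod_simps)
qed

text \<open>The image of \<open>F f\<close> is a subobject of the projective \<open>F Q\<close>,
  hence projective, and the surjection of \<open>F P\<close> onto it has a section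
  \<open>\<sigma>\<close>. As \<open>F\<close> is fully faithful on \<open>projs\<close>, the
  idempotent \<open>\<sigma> F(f)\<close> comes from an idempotent \<open>e\<close> of
  \<open>P\<close>; splitting \<open>e\<close> and \<open>1 - e\<close> in \<open>T\<close> gives
  \<open>I\<close> and \<open>K\<close>.\<close>

lemma splitting_from_hereditary:
  assumes P: "P \<in> projs" and Q: "Q \<in> projs" and f [simp]: "f \<in> mor T P Q"
  shows "\<exists>I K i j p q. is_biproduct T I K P i j p q \<and> gmono I Q (Cmp T I P Q f i) \<and>
        Cmp T P I Q (Cmp T I P Q f i) p = f"
proof -
  note [simp] = projs_Ob[OF P] projs_Ob[OF Q]
  let ?\<phi> = "Fm P Q f" and ?M = "image_gmod (F P) (F Q) (Fm P Q f)"
  have FP: "graded_module k A (F P)" by simp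
  have \<phi>: "?\<phi> \<in> ghom A (F P) (F Q)" by simp
  have M: "?M \<in> Ob (grmod k A)" by (rule image_Ob[OF F_proj_Ob[OF P] F_proj_Ob[OF Q] \<phi>])
  have "is_mono (grmod k A) ?M (F Q) (\<lambda>p. \<lambda>y \<in> ?\<phi> p ` gcar (F P) p. y)"
    by (rule injective_mono[OF M F_proj_Ob[OF Q] image_inclusion[OF \<phi> FP]]) (auto simp: inj_on_def)
  then have proj: "is_projective (grmod k A) ?M"
    using hereditary F_projective[OF Q] M unfolding is_hereditary_def by blast
  have "is_epi (grmod k A) (F P) ?M ?\<phi>"
    by (rule surjective_epi[OF F_proj_Ob[OF P] M image_ghom[OF \<phi>]]) simp
  then obtain \<sigma> where \<sigma>: "\<sigma> \<in> ghom A ?M (F P)"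
      and \<sigma>_eq: "Cmp (grmod k A) ?M (F P) ?M ?\<phi> \<sigma> = Idn (grmod k A) ?M"
    using proj F_proj_Ob[OF P] M D.Idn_closed[OF M] unfolding is_projective_def grmod_simps(1) by blast
  have \<phi>\<sigma>: "?\<phi> p (\<sigma> p y) = y" if "y \<in> gcar ?M p" for p y
    using that fun_cong[OF fun_cong[OF \<sigma>_eq[unfolded grmod_simps(2,4)], of p], of y]
        by (simp add: compose_def)
  have \<sigma>\<phi>: "(\<lambda>p. compose (gcar (F P) p) (\<sigma> p) (?\<phi> p)) \<in> ghom A (F P) (F P)"
    by (rule ghom_comp[OF FP image_ghom[OF \<phi>] \<sigma>])
  obtain e where e [simp]: "e \<in> mor T P P" and "Fm P P e = (\<lambda>p. compose (gcar (F P) p) (\<sigma> p) (?\<phi> p))"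
    by (rule Fm_full_projs[OF P projs_Ob[OF P] \<sigma>\<phi>])
  then have e_app: "Fm P P e p x = \<sigma> p (?\<phi> p x)" if "x \<in> gcar (F P) p" for p x
    using that by (simp add: compose_def)
  have fe: "Cmp T P P Q f e = f"
    by (rule Fm_faithful[OF P projs_Ob[OF Q]]) (simp_all add: Fm_Cmp_app e_app \<phi>\<sigma>)
  have ee: "Cmp T P P P e e = e"
  proof (rule Fm_faithful[OF P projs_Ob[OF P]])
    fix p x assume x: "x \<in> gcar (F P) p"
    have "Fm P P e p (Fm P P e p x) = \<sigma> p (?\<phi> p (Fm P P e p x))" using x by (intro e_app) simp
    also have "?\<phi> p (Fm P P e p x) = ?\<phi> p x" using x by (simp add: fe flip: Fm_Cmp_app)
    finally show "Fm P P (Cmp T P P P e e) p x = Fm P P e p x" using x by (simp add: Fm_Cmp_app e_app)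
  qed simp_all
  obtain I r s where [simp]: "I \<in> Ob T" "r \<in> mor T P I" "s \<in> mor T I P"
    and rs: "Cmp T I P I r s = Idn T I" "Cmp T P I P s r = e"
    using idem ee unfolding idempotent_complete_def by (metis e projs_Ob[OF P])
  let ?e = "Idn T P \<oplus>\<^bsub>Mor T P P\<^esub> \<ominus>\<^bsub>Mor T P P\<^esub> e"
  note e' = idempotent_compl[OF projs_Ob[OF P] e ee]
  obtain K r' s' where [simp]: "K \<in> Ob T" "r' \<in> mor T P K" "s' \<in> mor T K P"
    and rs': "Cmp T K P K r' s' = Idn T K" "Cmp T P K P s' r' = ?e"
    using idem e'(1,4) unfolding idempotent_complete_def by (metis projs_Ob[OF P])
  \<comment> \<open>\<open>v w = (v v') v w (w' w) = v (v' v w w') w\<close>, and the product of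
    complementary idempotents in the middle is zero.\<close>
  have orth: "Cmp T U P V v w = \<zero>\<^bsub>Mor T U V\<^esub>"
    if [simp]: "U \<in> Ob T" "V \<in> Ob T" "v \<in> mor T P V" "w \<in> mor T U P" "v' \<in> mor T V P" "w' \<in> mor T P U"
      and "Cmp T V P V v v' = Idn T V" "Cmp T U P U w' w = Idn T U"
      and 0: "Cmp T P P P (Cmp T P V P v' v) (Cmp T P U P w w') = \<zero>\<^bsub>Mor T P P\<^esub>" for U V v w v' w'
  proof -
    have "Cmp T U P V v w = Cmp T U V V (Cmp T V P V v v') (Cmp T U U V (Cmp T U P V v w)
        (Cmp T U P U w' w))"
      using that by simp
    also have "\<dots> = Cmp T U P V (Cmp T P P V v (Cmp T P P P (Cmp T P V P v' v) (Cmp T P U P w w'))) w"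
      by (simp add: Cmp_assoc)
    finally show ?thesis by (simp add: 0)
  qed
  have "is_biproduct T I K P s s' r r'"
    unfolding is_biproduct_def
    using orth[of K I r s' s r'] orth[of I K r' s s' r] rs rs' e' by simp
  moreover have "Cmp T P I Q (Cmp T I P Q f s) r = f" using fe by (simp add: rs flip: Cmp_assoc)
  moreover have "gmono I Q (Cmp T I P Q f s)"
    unfolding gmono_iff[OF \<open>I \<in> Ob T\<close> projs_Ob[OF Q] Cmp_closed[OF \<open>I \<in> Ob T\<close> projs_Ob[OF P]
        projs_Ob[OF Q] \<open>s \<in> _\<close> f]]
  proof (intro allI ballI impI)
    fix p x assume x: "x \<in> gcar (F I) p" and 0: "Fm I Q (Cmp T I P Q f s) p x = \<zero>\<^bsub>Gpart (F Q) p\<^esub>"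
    \<comment> \<open>The idempotent is the identity on \<open>I\<close>, so
      \<open>s x = \<sigma> (f s x)\<close>, which vanishes with \<open>f s x\<close>.\<close>
    have es: "Cmp T I P P e s = s" by (simp add: rs(1) flip: Cmp_assoc rs(2))
    have "Fm I P s p x = Fm P P e p (Fm I P s p x)" using x by (simp add: es flip: Fm_Cmp_app)
    also have "\<dots> = \<sigma> p (?\<phi> p (Fm I P s p x))" using x by (simp add: e_app)
    also have "?\<phi> p (Fm I P s p x) = \<zero>\<^bsub>Gpart ?M p\<^esub>" using x 0 by (simp add: Fm_Cmp_app)
    also have "\<sigma> p \<zero>\<^bsub>Gpart ?M p\<^esub> = \<zero>\<^bsub>Gpart (F P) p\<^esub>" by (rule ghom_zero[OF ObD(1)[OF M] FP \<sigma>])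
    finally have "Fm P I r p (Fm I P s p x) = \<zero>\<^bsub>Gpart (F I) p\<^esub>" by simp
    then show "x = \<zero>\<^bsub>Gpart (F I) p\<^esub>" using x by (simp add: rs Fm_Idn_app flip: Fm_Cmp_app)
  qed
  ultimately show ?thesis by blast
qed

end

section \<open>Properties of the functor\<close>

locale hereditary_generator = hereditary_endomorphisms k T G
  for k :: "('k, 'r) ring_scheme" and T :: "('o, 'm, 'k, 'z) tcat_scheme" and G :: 'o +
  assumes generator: "thick_closure T G = Ob T"
begin

sublocale triangulated_with_generator k T G
  by unfold_locales (rule generator splitting_from_hereditary; assumption)+

lemma resolution_exists:
  assumes "X \<in> Ob T"
  obtains I E f s w where "resolution I E X f s w"
  using presentable_resolution all_presentable assms by metis

lemma resolution_presents:
  assumes "resolution I E X f s w"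
  shows "presents I E f (Fm E X s) (F X)"
proof -
  have I: "I \<in> projs" and E: "E \<in> projs" and t: "(I, E, X, f, s, w) \<in> Tri T" and sur: "gsurj E X s"
    using assms by (auto simp: resolution_def)
  note [simp] = Tri_Ob[OF t]
  have "gexact I E X f s" using Tri_exact[OF t] by (auto simp: gexact_def)
  moreover have "Fm E X s p (Fm I E f p x) = \<zero>\<^bsub>Gpart (F X) p\<^esub>" if "x \<in> gcar (F I) p" for p x
    using that Tri_comp_zero[OF t] by (simp add: Fm_zero_app flip: Fm_Cmp_app)
  ultimately show ?thesis
    using I E sur unfolding presents_def by (auto simp: gexact_iff gsurj_iff)
qed

text \<open>The resolution of \<open>X\<close> is a finite presentation of \<open>F X\<close>; only
  from here on is \<open>F\<close> a functor into \<open>grmod A\<close>.\<close>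

lemma F_closed: "X \<in> Ob T \<Longrightarrow> F X \<in> Ob (grmod k A)"
  using resolution_exists[of X] resolution_presents presents_finitely_presented[OF _ F_graded[of X]]
  by (metis (mono_tags, lifting) F_graded grmod_simps(3) mem_Collect_eq)

sublocale FF: additive_functor k T "grmod k A" F Fm
proof
  show "is_functor T (grmod k A) F Fm"
    unfolding is_functor_def grmod_simps(1,2,4)
  proof (intro conjI ballI)
    fix X assume [simp]: "X \<in> Ob T"
    show "F X \<in> Ob (grmod k A)" by (rule F_closed) simp
    show "Fm X X (Idn T X) = (\<lambda>p. \<lambda>x \<in> gcar (F X) p. x)"
      by (rule ghom_eqI[OF Fm_ghom ghom_id[OF F_graded]]) (simp_all add: Fm_Idn_app)
    fix Y assume [simp]: "Y \<in> Ob T"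
    show "Fm X Y f \<in> ghom A (F X) (F Y)" if "f \<in> mor T X Y" for f using that by simp
    fix Z f g assume [simp]: "Z \<in> Ob T" "f \<in> mor T X Y" "g \<in> mor T Y Z"
    show "Fm X Z (Cmp T X Y Z g f) = (\<lambda>p. compose (gcar (F X) p) (Fm Y Z g p) (Fm X Y f p))"
      by (rule ghom_eqI[OF Fm_ghom ghom_comp[OF F_graded Fm_ghom Fm_ghom]])
          (simp_all add: Fm_Cmp_app compose_def)
  qed
next
  fix X Y f g assume [simp]: "X \<in> Ob T" "Y \<in> Ob T" "f \<in> mor T X Y" "g \<in> mor T X Y"
  show "Fm X Y (f \<oplus>\<^bsub>Mor T X Y\<^esub> g) = Fm X Y f \<oplus>\<^bsub>Mor (grmod k A) (F X) (F Y)\<^esub> Fm X Y g"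
    unfolding grmod_simps(6)
    by (rule ghom_eqI[OF Fm_ghom ghom_add_closed[OF A_graded F_graded F_graded Fm_ghom Fm_ghom]])
        (simp_all add: Fm_add_app)
qed

lemma F_full: "is_full T (grmod k A) F Fm"
  unfolding is_full_def grmod_simps(1)
proof (intro ballI)
  fix X Y h assume [simp]: "X \<in> Ob T" "Y \<in> Ob T" and h: "h \<in> ghom A (F X) (F Y)"
  obtain I E f s w where r: "resolution I E X f s w" by (rule resolution_exists[OF \<open>X \<in> Ob T\<close>])
  then have I: "I \<in> projs" and E: "E \<in> projs" and t: "(I, E, X, f, s, w) \<in> Tri T" and "gsurj E X s"
    by (auto simp: resolution_def)
  note [simp] = Tri_Ob[OF t]
  have sur: "Fm E X s p ` gcar (F E) p = gcar (F X) p" for p using \<open>gsurj E X s\<close>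
      by (simp add: gsurj_iff)
  have "(\<lambda>p. compose (gcar (F E) p) (h p) (Fm E X s p)) \<in> ghom A (F E) (F Y)"
    by (rule ghom_comp[OF F_graded _ h]) simp_all
  then obtain v where [simp]: "v \<in> mor T E Y" and "Fm E Y v
      = (\<lambda>p. compose (gcar (F E) p) (h p) (Fm E X s p))"
    using Fm_full_projs[OF E, of Y] by auto
  then have v: "Fm E Y v p x = h p (Fm E X s p x)" if "x \<in> gcar (F E) p" for p x
    using that by (simp add: compose_def)
  \<comment> \<open>After \<open>F\<close> this is \<open>h\<close> applied to
    \<open>F(s f) = 0\<close>; faithfulness on \<open>projs\<close> returns to
    \<open>T\<close>.\<close>
  have "Cmp T I E Y v f = \<zero>\<^bsub>Mor T I Y\<^esub>"
  proof (rule Fm_faithful[OF I \<open>Y \<in> Ob T\<close>])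
    fix p x assume x: "x \<in> gcar (F I) p"
    have "Fm E X s p (Fm I E f p x) = \<zero>\<^bsub>Gpart (F X) p\<^esub>"
      using x Tri_comp_zero[OF t] by (simp add: grmod_simps(5) flip: Fm_Cmp_app)
    then show "Fm I Y (Cmp T I E Y v f) p x = Fm I Y \<zero>\<^bsub>Mor T I Y\<^esub> p x"
      using x ghom_zero[OF F_graded F_graded h, of p] by (simp add: Fm_Cmp_app v grmod_simps(5))
  qed simp_all
  then obtain u where [simp]: "u \<in> mor T X Y" and u: "Cmp T E X Y u s = v"
    using Tri_coexact[OF t, of Y v] by auto
  have "Fm X Y u = h"
  proof (rule ghom_eqI[OF Fm_ghom h])
    fix p y assume "y \<in> gcar (F X) p"
    then obtain x where "x \<in> gcar (F E) p" "y = Fm E X s p x" using sur by blast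
    then show "Fm X Y u p y = h p y" by (simp add: u flip: Fm_Cmp_app v)
  qed simp_all
  then show "\<exists>f \<in> mor T X Y. Fm X Y f = h" by (intro bexI[of _ u]) simp_all
qed

lemma F_ess_surj: "is_essentially_surjective T (grmod k A) F"
  unfolding is_essentially_surjective_def
proof
  fix M assume M: "M \<in> Ob (grmod k A)"
  note gM = ObD(1)[OF M]
  obtain P Q f \<psi> where "presents P Q f \<psi> M" using finitely_presented_presents[OF ObD(2)[OF M]] by blast
  then have P: "P \<in> projs" and Q: "Q \<in> projs" and [simp]: "f \<in> mor T P Q" and \<psi>: "\<psi> \<in> ghom A (F Q) M"
    and sur: "\<And>p. \<psi> p ` gcar (F Q) p = gcar M p"
    and ker: "\<And>p x. x \<in> gcar (F Q) p \<Longrightarrow> \<psi> p x = \<zero>\<^bsub>Gpart M p\<^esub> \<longleftrightarrow> x \<in> Fm P Q f p ` gcar (F P) p"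
    unfolding presents_def by blast+
  note [simp] = projs_Ob[OF P] projs_Ob[OF Q]
  obtain I i r where I: "I \<in> projs" and [simp]: "i \<in> mor T I P" "r \<in> mor T P I"
      and "Cmp T I P I r i = Idn T I" and m: "gmono I Q (Cmp T I P Q f i)"
    and fr: "Cmp T P I Q (Cmp T I P Q f i) r = f"
    using gmono_part[OF P Q, of f] by auto
  note [simp] = projs_Ob[OF I]
  let ?g = "Cmp T I P Q f i"
  obtain X s w where t: "(I, Q, X, ?g, s, w) \<in> Tri T" using TR1_cone[of I Q ?g] by auto
  note [simp] = Tri_Ob(3,5)[OF t]
  have s: "Fm Q X s \<in> ghom A (F Q) (F X)" by simp
  have sur': "Fm Q X s p ` gcar (F Q) p = gcar (F X) p" for p
    using cone_gsurj[OF t m] by (simp add: gsurj_iff)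
  have ex: "gexact I Q X ?g s" using Tri_exact[OF t] by (auto simp: gexact_def)
  \<comment> \<open>As \<open>f = (f i) r\<close>, passing to the injective part keeps the submodule
    of relations.\<close>
  have im: "x \<in> Fm I Q ?g p ` gcar (F I) p \<longleftrightarrow> x \<in> Fm P Q f p ` gcar (F P) p" for p x
  proof
    assume "x \<in> Fm I Q ?g p ` gcar (F I) p"
    then show "x \<in> Fm P Q f p ` gcar (F P) p" by (auto simp: Fm_Cmp_app)
  next
    assume "x \<in> Fm P Q f p ` gcar (F P) p"
    then obtain y where "y \<in> gcar (F P) p" "x = Fm P Q (Cmp T P I Q ?g r) p y" using fr by auto
    then show "x \<in> Fm I Q ?g p ` gcar (F I) p" by (simp add: Fm_Cmp_app[of P I Q r ?g])
  qed
  have ker': "Fm Q X s p x = \<zero>\<^bsub>Gpart (F X) p\<^esub> \<longleftrightarrow> x \<in> Fm P Q f p ` gcar (F P) p"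
      if x: "x \<in> gcar (F Q) p" for p x
  proof -
    have "Fm Q X s p (Fm I Q ?g p y) = \<zero>\<^bsub>Gpart (F X) p\<^esub>" if "y \<in> gcar (F I) p" for y
      using that Tri_comp_zero[OF t] by (simp add: grmod_simps(5) flip: Fm_Cmp_app[of I Q X ?g s])
    then have "Fm Q X s p x = \<zero>\<^bsub>Gpart (F X) p\<^esub> \<longleftrightarrow> x \<in> Fm I Q ?g p ` gcar (F I) p"
      using x ex by (auto simp: gexact_iff)
    then show ?thesis by (simp only: im)
  qed
  have FX: "graded_module k A (F X)" and FQ: "graded_module k A (F Q)" by simp_all
  \<comment> \<open>\<open>F X\<close> and \<open>M\<close> are quotients of \<open>F Q\<close> by
    the same submodule, so the two quotient maps factor through each other.\<close>
  obtain h where h: "h \<in> ghom A (F X) M" "\<And>p x. x \<in> gcar (F Q) p \<Longrightarrow> h p (Fm Q X s p x) = \<psi> p x"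
    using ghom_factor[OF FX gM FQ s \<psi> sur'] ker ker' by metis
  obtain h' where h': "h' \<in> ghom A M (F X)" "\<And>p x. x \<in> gcar (F Q) p \<Longrightarrow> h' p (\<psi> p x) = Fm Q X s p x"
    using ghom_factor[OF gM FX FQ \<psi> s sur] ker ker' by metis
  have "h' p (h p y) = y" if "y \<in> gcar (F X) p" for p y
    using that h(2) h'(2) unfolding sur'[of p, symmetric] by auto
  then have 1: "(\<lambda>p. compose (gcar (F X) p) (h' p) (h p)) = (\<lambda>p. \<lambda>x \<in> gcar (F X) p. x)"
    by (auto simp: compose_def fun_eq_iff)
  have "h p (h' p y) = y" if "y \<in> gcar M p" for p y
    using that h(2) h'(2) unfolding sur[of p, symmetric] by auto
  then have 2: "(\<lambda>p. compose (gcar M p) (h p) (h' p)) = (\<lambda>p. \<lambda>x \<in> gcar M p. x)"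
    by (auto simp: compose_def fun_eq_iff)
  have "is_iso (grmod k A) (F X) M h"
    unfolding is_iso_def grmod_simps(1,2,4) using h(1) h'(1) 1 2 by blast
  then show "\<exists>X \<in> Ob T. (F X, M) \<in> iso_rel (grmod k A)"
    unfolding iso_rel_def using M F_closed[of X] by (intro bexI[of _ X]) auto
qed

lemma F_kernel_square_zero: "kernel_square_zero T (grmod k A) F Fm"
  unfolding kernel_square_zero_def grmod_simps(5)
proof (intro ballI impI)
  fix X Y Z f g assume [simp]: "X \<in> Ob T" "Y \<in> Ob T" "Z \<in> Ob T" "f \<in> mor T X Y" "g \<in> mor T Y Z"
    and f: "Fm X Y f = (\<lambda>p. \<lambda>x \<in> gcar (F X) p. \<zero>\<^bsub>Gpart (F Y) p\<^esub>)"
    and g: "Fm Y Z g = (\<lambda>p. \<lambda>x \<in> gcar (F Y) p. \<zero>\<^bsub>Gpart (F Z) p\<^esub>)"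
  \<comment> \<open>Vanishing of \<open>F h\<close> in degree \<open>-d\<close> says that
    \<open>h\<close> kills every map from \<open>\<Sigma>\<^sup>dG\<close>.\<close>
  have ghost: "Cmp T (ShO T d G) U V h x = \<zero>\<^bsub>Mor T (ShO T d G) V\<^esub>"
    if [simp]: "U \<in> Ob T" "V \<in> Ob T" "h \<in> mor T U V" "x \<in> mor T (ShO T d G) U"
      and h: "Fm U V h = (\<lambda>p. \<lambda>x \<in> gcar (F U) p. \<zero>\<^bsub>Gpart (F V) p\<^esub>)" for U V h d x
  proof -
    have "Fm U V h (-d) (el U (-d) x) = \<zero>\<^bsub>Gpart (F V) (-d)\<^esub>" by (simp add: h)
    then show ?thesis by (simp add: Fm_el F_zero el_inj)
  qed
  show "Cmp T X Y Z g f = \<zero>\<^bsub>Mor T X Z\<^esub>"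
    by (rule ghost_comp_zero) (simp_all add: ghost f g)
qed

sublocale FF: epivalence k T "grmod k A" F Fm
  by unfold_locales (rule F_full F_ess_surj F_kernel_square_zero direct_sum; assumption?)+

end

theorem theorem3p6:
  fixes k :: "('k, 'r) ring_scheme"
    and T :: "('o, 'm, 'k, 'z) tcat_scheme"
    and G :: 'o
    and A :: "('k, 'm) galg"
  assumes "cring k"
    and "triangulated_category k T"
    and "idempotent_complete T"
    and "classical_generator T G"
    and "A = End_alg T G"
    and "abelian_category k (grmod k A)"
    and "is_hereditary (grmod k A)"
  shows "is_functor T (grmod k A) (F_ob T G) (F_mor T G)
    \<and> is_full T (grmod k A) (F_ob T G) (F_mor T G)
    \<and> is_essentially_surjective T (grmod k A) (F_ob T G)
    \<and> kernel_square_zero T (grmod k A) (F_ob T G) (F_mor T G)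
    \<and> bij_betw (iso_class_map (grmod k A) (F_ob T G))
        (Ob T // iso_rel T) (Ob (grmod k A) // iso_rel (grmod k A))
    \<and> bij_betw (iso_class_map (grmod k A) (F_ob T G))
        (indecomposables T // iso_rel T)
        (indecomposables (grmod k A) // iso_rel (grmod k A))"
proof -
  interpret triangulated_category k T by fact
  interpret D: abelian_category k "grmod k (End_alg T G)" using assms(5,6) by simp
  interpret hereditary_generator k T G
    using assms(3,4,5,7) by unfold_locales (auto simp: classical_generator_def)
  have "bij_betw (iso_class_map (grmod k A) (F_ob T G))
        (Ob T // iso_rel T) (Ob (grmod k A) // iso_rel (grmod k A))"
    unfolding assms(5) by (rule FF.bij_iso_classes) (auto simp: iso_rel_def)
  moreover have "bij_betw (iso_class_map (grmod k A) (F_ob T G))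
        (indecomposables T // iso_rel T)
        (indecomposables (grmod k A) // iso_rel (grmod k A))"
    unfolding assms(5)
    by (rule FF.bij_iso_classes)
      (auto simp: FF.indecomposable_iff intro: D.indecomposable_iso, auto simp: indecomposables_def)
  ultimately show ?thesis
    unfolding assms(5) using FF.is_functor F_full F_ess_surj F_kernel_square_zero by blast
qed

end
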